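(* Let $G$ be a graph with $n \ge 3$ vertices, without loops or parallel edges. If $G$ can be drawn as a simple topological graph in which every two edges that cross a common third edge share a common endpoint, then $G$ has at most $5n-10$ edges. If, moreover, $G$ admits such a drawing in which every edge is drawn as a straight-line segment, then $G$ has at most $5n-11$ edges.
   Context: A topological graph (drawing) is a graph drawn in the plane with vertices as distinct points and edges as Jordan arcs connecting the corresponding points and not passing through any other vertex; any two edges have finitely many common points, each of which is either a shared endpoint or a proper crossing. A topological graph is simple if every two edges intersect in at most one point (a shared endpoint or a single crossing). The condition in the theorem says: whenever two distinct edges $e_1,e_2$ both cross an edge $e$, then $e_1$ and $e_2$ have a common endpoint. *)

theory Defs
  imports "HOL-Analysis.Analysis"
begin

definition loopless_simple_graph :: "'v set \<Rightarrow> 'v set set \<Rightarrow> bool" where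
  "loopless_simple_graph V E \<longleftrightarrow> finite V \<and>
     (\<forall>e\<in>E. \<exists>u v. u \<in> V \<and> v \<in> V \<and> u \<noteq> v \<and> e = {u, v})"

definition topological_drawing ::
  "'v set \<Rightarrow> 'v set set \<Rightarrow> ('v \<Rightarrow> real^2) \<Rightarrow> ('v set \<Rightarrow> real \<Rightarrow> real^2) \<Rightarrow> bool" where
  "topological_drawing V E pos \<gamma> \<longleftrightarrow>
     inj_on pos V \<and>
     (\<forall>e\<in>E. arc (\<gamma> e) \<and> {pathstart (\<gamma> e), pathfinish (\<gamma> e)} = pos ` e \<and>
              path_image (\<gamma> e) \<inter> pos ` V = pos ` e) \<and>
     (\<forall>e\<in>E. \<forall>f\<in>E. e \<noteq> f \<longrightarrow> finite (path_image (\<gamma> e) \<inter> path_image (\<gamma> f)))"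

definition simple_drawing ::
  "'v set set \<Rightarrow> ('v set \<Rightarrow> real \<Rightarrow> real^2) \<Rightarrow> bool" where
  "simple_drawing E \<gamma> \<longleftrightarrow>
     (\<forall>e\<in>E. \<forall>f\<in>E. e \<noteq> f \<longrightarrow> card (path_image (\<gamma> e) \<inter> path_image (\<gamma> f)) \<le> 1)"

definition crosses ::
  "'v set \<Rightarrow> ('v \<Rightarrow> real^2) \<Rightarrow> ('v set \<Rightarrow> real \<Rightarrow> real^2) \<Rightarrow> 'v set \<Rightarrow> 'v set \<Rightarrow> bool" where
  "crosses V pos \<gamma> e f \<longleftrightarrow> e \<noteq> f \<and>
     (\<exists>p. p \<in> path_image (\<gamma> e) \<and> p \<in> path_image (\<gamma> f) \<and> p \<notin> pos ` V)"

definition crossing_condition ::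
  "'v set \<Rightarrow> 'v set set \<Rightarrow> ('v \<Rightarrow> real^2) \<Rightarrow> ('v set \<Rightarrow> real \<Rightarrow> real^2) \<Rightarrow> bool" where
  "crossing_condition V E pos \<gamma> \<longleftrightarrow>
     (\<forall>e\<in>E. \<forall>e1\<in>E. \<forall>e2\<in>E. e1 \<noteq> e2 \<and> crosses V pos \<gamma> e1 e \<and> crosses V pos \<gamma> e2 e
         \<longrightarrow> e1 \<inter> e2 \<noteq> {})"

definition good_drawing ::
  "'v set \<Rightarrow> 'v set set \<Rightarrow> ('v \<Rightarrow> real^2) \<Rightarrow> ('v set \<Rightarrow> real \<Rightarrow> real^2) \<Rightarrow> bool" where
  "good_drawing V E pos \<gamma> \<longleftrightarrow>
     topological_drawing V E pos \<gamma> \<and> simple_drawing E \<gamma> \<and> crossing_condition V E pos \<gamma>"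

definition straight_line_drawing ::
  "'v set set \<Rightarrow> ('v \<Rightarrow> real^2) \<Rightarrow> ('v set \<Rightarrow> real \<Rightarrow> real^2) \<Rightarrow> bool" where
  "straight_line_drawing E pos \<gamma> \<longleftrightarrow>
     (\<forall>e\<in>E. \<forall>u v. e = {u, v} \<longrightarrow> path_image (\<gamma> e) = closed_segment (pos u) (pos v))"

end

theory Submission
  imports Defs "HOL-Combinatorics.Orbits"
begin

text \<open>
  Subdivide every edge at its crossings. This gives a plane map whose inner points all have four
  darts, and a dart is called real when it starts at a vertex of the graph. With F faces and 2m
  real darts among the set D of all darts, Euler's inequality turns the bound m \<le> 5n - 10 into
  40 F \<le> 10 |D| + 2m * 6, so it suffices to give each dart weight 10, each real dart 6 more, and
  to redistribute the weights until every face carries 40. Only triangles with exactly one real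
  dart are short (they carry 36). Each of them asks for 4 units from the first face that is not
  a quadrilateral of crossings, reached by going straight on between the two edges at its vertex;
  the condition on crossing edges limits how many such demands one face receives, and the faces
  that cannot pay are supplied with single units by neighbouring faces that contain a vertex.

  The planar map itself is built ear by ear, every face of a region being tracked through
  Janiszewski's theorem, and points where edges merely touch are dissolved first. Vertices of
  degree at most 5 are removed by induction. For straight edges, send an interior point of the
  convex hull to infinity by an inversion; the unbounded directions become a new vertex, joined by
  three uncrossed edges to three corners of the hull, and the faces around these edges have 24
  units of weight to spare.
\<close>

section \<open>Orbits of permutations\<close>

text \<open>Let m edges, N vertices and F faces be given, with X darts at crossings, so |D| = 2m +
  X. Ten times Euler's inequality 2|D| + 8 <= 4F + X + 4N, set against 40 per face and 10 per dart,
  loses its X terms. With 6 more per real dart it leaves 40m + 80 <= 20m + 12m + 40N, that is m <=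
  5N - 10. A quadrilateral of crossings is then exactly balanced, so demands have to pass through
  it. After paying 4 per demand only three kinds of face can fall below 40: a quadrilateral with one
  vertex and two demands (46 - 8), a pentagon of crossings (down to 50 - 20) and a hexagon of
  crossings with six demands (60 - 24). Here the condition on crossing edges decides: an edge that
  crosses a strip far from its triangle must share endpoints with the edges around the paying face
  and is forced to equal one of them. So strips into such faces are short, or neighbouring faces can
  give. From topology only a lower bound on the number of faces is used; the map may be
  disconnected. Degree at least two at every vertex keeps the rotation free of fixed points.\<close>

definition orbs :: "('a \<Rightarrow> 'a) \<Rightarrow> 'a set \<Rightarrow> 'a set set" where
  "orbs f A = orbit f ` A"

lemma perm_self_in_orbit: "finite A \<Longrightarrow> f permutes A \<Longrightarrow> x \<in> orbit f x"
  by (metis permutation_permutes permutation_self_in_orbit)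

lemma perm_orbit_eq:
  assumes "finite A" "f permutes A" "y \<in> orbit f x"
  shows "orbit f y = orbit f x"
  by (rule orbit_cyclic_eq3[OF cyclic_on_orbit[OF assms(2,1)] assms(3)])

lemma perm_orbit_step: "finite A \<Longrightarrow> f permutes A \<Longrightarrow> orbit f (f x) = orbit f x"
  by (meson orbit.base perm_orbit_eq)

lemma perm_orbit_subset: "f permutes A \<Longrightarrow> x \<in> A \<Longrightarrow> orbit f x \<subseteq> A"
  by (rule permutes_orbit_subset)

lemma orbs_disjoint:
  assumes "finite A" "f permutes A" "P \<in> orbs f A" "Q \<in> orbs f A" "P \<noteq> Q"
  shows "P \<inter> Q = {}"
proof -
  obtain x y where xy: "P = orbit f x" "Q = orbit f y" using assms by (auto simp: orbs_def)
  show ?thesis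
  proof (rule ccontr)
    assume "P \<inter> Q \<noteq> {}"
    then obtain z where "z \<in> orbit f x" "z \<in> orbit f y" using xy by auto
    then show False using perm_orbit_eq[OF assms(1,2)] xy assms(5) by metis
  qed
qed

lemma Union_orbs: "finite A \<Longrightarrow> f permutes A \<Longrightarrow> \<Union>(orbs f A) = A"
  unfolding orbs_def using perm_self_in_orbit perm_orbit_subset by fastforce

lemma sum_orbs:
  fixes w :: "'a \<Rightarrow> 'b::comm_monoid_add"
  assumes "finite A" "f permutes A"
  shows "sum w A = (\<Sum>P\<in>orbs f A. sum w P)"
proof -
  have "sum w (\<Union>(orbs f A)) = (\<Sum>P\<in>orbs f A. sum w P)"
  proof (subst sum.Union_disjoint)
    show "\<forall>P\<in>orbs f A. finite P"
      using Union_orbs[OF assms] assms(1) by (metis Sup_upper finite_subset)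
    show "\<forall>P\<in>orbs f A. \<forall>Q\<in>orbs f A. P \<noteq> Q \<longrightarrow> P \<inter> Q = {}"
      using orbs_disjoint[OF assms] by blast
  qed simp
  then show ?thesis by (simp add: Union_orbs assms)
qed

text \<open>Every closed class contains a whole orbit, and disjoint classes contain different ones.
  Most lower bounds on the number of faces come from here.\<close>

lemma card_le_orbs_if_closed_partition:
  assumes A: "finite A" "f permutes A" and S: "\<Union>S = A" "disjoint S" "{} \<notin> S"
    and cl: "\<And>P x. P \<in> S \<Longrightarrow> x \<in> P \<Longrightarrow> f x \<in> P"
  shows "card S \<le> card (orbs f A)"
proof -
  have orb: "orbit f x \<subseteq> P" if "P \<in> S" "x \<in> P" for P x
  proof
    fix y assume "y \<in> orbit f x"
    then show "y \<in> P" by induction (use that cl in auto)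
  qed
  define g where "g P = orbit f (SOME x. x \<in> P)" for P
  have sm: "(SOME x. x \<in> P) \<in> P" if "P \<in> S" for P
    using that S(3) by (metis ex_in_conv someI_ex)
  have "inj_on g S"
  proof
    fix P Q assume PQ: "P \<in> S" "Q \<in> S" "g P = g Q"
    have "f (SOME x. x \<in> P) \<in> g P" unfolding g_def by (rule orbit.base)
    then have "f (SOME x. x \<in> P) \<in> P \<inter> Q"
      using orb[OF PQ(1) sm] orb[OF PQ(2) sm] PQ unfolding g_def by blast
    then show "P = Q" using S(2) PQ unfolding disjoint_def by blast
  qed
  moreover have "g ` S \<subseteq> orbs f A"
    unfolding g_def orbs_def using sm S(1) by blast
  ultimately show ?thesis
    by (metis A(1) card_inj_on_le finite_imageI orbs_def)
qed

text \<open>The traces of the \<open>f\<close>-orbits on \<open>B\<close> are nonempty and closed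
  under \<open>g\<close>. Used when darts are deleted: no face disappears as long as each keeps a
  dart.\<close>

lemma card_orbs_le_if_finer:
  assumes A: "finite A" "f permutes A" and B: "finite B" "g permutes B" "B \<subseteq> A"
    and st: "\<And>x. x \<in> B \<Longrightarrow> g x \<in> orbit f x"
    and meet: "\<And>x. x \<in> A \<Longrightarrow> orbit f x \<inter> B \<noteq> {}"
  shows "card (orbs f A) \<le> card (orbs g B)"
proof -
  let ?S = "(\<lambda>P. P \<inter> B) ` orbs f A"
  have le: "card ?S \<le> card (orbs g B)"
  proof (rule card_le_orbs_if_closed_partition[OF B(1,2)])
  show "\<Union>((\<lambda>P. P \<inter> B) ` orbs f A) = B"
    using Union_orbs[OF A] B(3) by blast
  show "disjoint ((\<lambda>P. P \<inter> B) ` orbs f A)"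
    using orbs_disjoint[OF A] by (fastforce simp: disjoint_def)
  show "{} \<notin> (\<lambda>P. P \<inter> B) ` orbs f A"
    using meet by (auto simp: orbs_def)
  show "g x \<in> P" if "P \<in> (\<lambda>P. P \<inter> B) ` orbs f A" "x \<in> P" for P x
  proof -
    from that obtain y where y: "y \<in> A" "P = orbit f y \<inter> B" "x \<in> B" "x \<in> orbit f y"
      by (auto simp: orbs_def)
    then show ?thesis
      using st[of x] perm_orbit_eq[OF A, of x y] permutes_in_image[OF B(2), of x] by auto
  qed
  qed
  have "inj_on (\<lambda>P. P \<inter> B) (orbs f A)"
  proof
    fix P Q assume "P \<in> orbs f A" "Q \<in> orbs f A" "P \<inter> B = Q \<inter> B"
    moreover from this have "P \<inter> B \<noteq> {}" using meet by (auto simp: orbs_def)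
    ultimately show "P = Q" using orbs_disjoint[OF A, of P Q] by auto
  qed
  then have "card ?S = card (orbs f A)" by (rule card_image)
  then show ?thesis using le by simp
qed

text \<open>Orbits that avoid \<open>a\<close> and \<open>b\<close> survive the swap unchanged. At
  most two others exist before it and at least one exists after it, so at most one orbit is
  lost.\<close>

lemma card_orbs_swap:
  assumes A: "finite A" "f permutes A" and "a \<in> A" "b \<in> A"
  shows "card (orbs f A) \<le> card (orbs (f \<circ> Transposition.transpose a b) A) + 1"
proof -
  let ?g = "f \<circ> Transposition.transpose a b"
  have g: "?g permutes A"
    using assms by (simp add: permutes_compose permutes_swap_id)
  let ?S = "{P \<in> orbs f A. a \<notin> P \<and> b \<notin> P}"
  have fin: "finite (orbs f A)" "finite (orbs ?g A)" by (auto simp: orbs_def A)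
  have "?S \<subseteq> orbs ?g A - {orbit ?g a}"
  proof
    fix P assume "P \<in> ?S"
    then obtain x where x: "x \<in> A" "P = orbit f x" "a \<notin> P" "b \<notin> P" by (auto simp: orbs_def)
    have sub: "x \<in> orbit f x" using perm_self_in_orbit[OF A] .
    have "orbit ?g x = orbit f x"
    proof (rule orbit_cong)
      show "?g y = f y" if "y \<in> orbit f x" for y
      proof -
        have "y \<noteq> a" "y \<noteq> b" using x that by auto
        then show ?thesis by simp
      qed
    qed (use sub in auto)
    moreover have "orbit f x \<noteq> orbit ?g a"
      using x perm_self_in_orbit[OF A(1) g] by blast
    ultimately show "P \<in> orbs ?g A - {orbit ?g a}" using x by (auto simp: orbs_def)
  qed
  then have "card ?S \<le> card (orbs ?g A) - 1"
  proof -
    assume sub: "?S \<subseteq> orbs ?g A - {orbit ?g a}"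
    have "card ?S \<le> card (orbs ?g A - {orbit ?g a})"
      by (rule card_mono[OF _ sub]) (use fin in simp)
    moreover have "orbit ?g a \<in> orbs ?g A" using assms(3) by (auto simp: orbs_def)
    ultimately show ?thesis by simp
  qed
  moreover have "card (orbs ?g A) > 0" using fin assms by (auto simp: card_gt_0_iff orbs_def)
  moreover have "orbs f A \<subseteq> ?S \<union> {orbit f a, orbit f b}"
  proof
    fix P assume "P \<in> orbs f A"
    then obtain x where "x \<in> A" "P = orbit f x" by (auto simp: orbs_def)
    then show "P \<in> ?S \<union> {orbit f a, orbit f b}"
      using perm_orbit_eq[OF A, of a x] perm_orbit_eq[OF A, of b x] by (auto simp: orbs_def)
  qed
  then have "card (orbs f A) \<le> card (?S \<union> {orbit f a, orbit f b})"
    by (rule card_mono[rotated]) (use fin in simp)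
  then have "card (orbs f A) \<le> card ?S + card {orbit f a, orbit f b}"
    using card_Un_le[of ?S "{orbit f a, orbit f b}"] by linarith
  moreover have "card {orbit f a, orbit f b} \<le> 2" by (simp add: card_insert_if)
  ultimately show ?thesis by linarith
qed

section \<open>Discharging on the planar map of a drawing\<close>

text \<open>
  A dart is a directed piece of an edge between consecutive points (vertices or crossings). The
  permutation n walks along the boundary of a face, r reverses a dart, and n o r rotates about the
  origin of a dart; rl d says that this origin is a vertex of the graph. The dart d lies on the
  graph edge ed d and points towards its end dest d; at a crossing, xe d is the other edge, and
  n (r (n (r d))) continues d backwards on the same edge. The parameter par d of the origin
  orders the points of an edge.
\<close>

locale planar_map =
  fixes D :: "'d set" and n r :: "'d \<Rightarrow> 'd" and rl :: "'d \<Rightarrow> bool"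
    and ed xe :: "'d \<Rightarrow> 'v set" and dest :: "'d \<Rightarrow> 'v" and par :: "'d \<Rightarrow> real"
  assumes finD: "finite D"
    and n_perm: "n permutes D" and r_perm: "r permutes D"
    and r_r [simp]: "r (r d) = d"
    and rl_n: "d \<in> D \<Longrightarrow> rl (n d) \<longleftrightarrow> rl (r d)"
    and n_ne_r: "d \<in> D \<Longrightarrow> n d \<noteq> r d"
    and ed_r: "d \<in> D \<Longrightarrow> ed (r d) = ed d"
    and ed_eq: "d \<in> D \<Longrightarrow> ed d = {dest d, dest (r d)}"
    and dest_ne: "d \<in> D \<Longrightarrow> dest d \<noteq> dest (r d)"
    and dest_head: "d \<in> D \<Longrightarrow> rl (r d) \<Longrightarrow> dest (r (n d)) = dest d"
    and real_unique: "\<lbrakk>d \<in> D; d' \<in> D; rl d; rl d'; ed d = ed d'; dest (r d) = dest (r d')\<rbrakk> \<Longrightarrow> d = d'"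
    and rot4: "d \<in> D \<Longrightarrow> \<not> rl d \<Longrightarrow> n (r (n (r (n (r (n (r d))))))) = d"
    and ed_rot: "d \<in> D \<Longrightarrow> \<not> rl d \<Longrightarrow> ed (n (r d)) = xe d"
    and xe_rot: "d \<in> D \<Longrightarrow> \<not> rl d \<Longrightarrow> xe (n (r d)) = ed d"
    and dest_straight: "d \<in> D \<Longrightarrow> \<not> rl (r d) \<Longrightarrow> dest (n (r (n d))) = dest d"
    and par_ne: "d \<in> D \<Longrightarrow> par d \<noteq> par (r d)"
    and par_opp: "d \<in> D \<Longrightarrow> \<not> rl d \<Longrightarrow> par (n (r (n (r d)))) = par d"
    and par_straight: "d \<in> D \<Longrightarrow> \<not> rl (r d) \<Longrightarrow>
          par d < par (r d) \<longleftrightarrow> par (n (r (n d))) < par (r (n (r (n d))))"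
    and cross_disjoint: "d \<in> D \<Longrightarrow> \<not> rl d \<Longrightarrow> ed d \<inter> xe d = {}"
    and cross_once: "\<lbrakk>d \<in> D; d' \<in> D; \<not> rl d; \<not> rl d'; ed d = ed d'; xe d = xe d'\<rbrakk>
          \<Longrightarrow> d' = d \<or> d' = n (r (n (r d)))"
    and cross_adjacent: "\<lbrakk>d \<in> D; d' \<in> D; \<not> rl d; \<not> rl d'; ed d = ed d'\<rbrakk> \<Longrightarrow> xe d \<inter> xe d' \<noteq> {}"
begin

section \<open>Elementary consequences of the map axioms\<close>

lemma n_D [simp]: "n d \<in> D \<longleftrightarrow> d \<in> D"
  using n_perm by (rule permutes_in_image)

lemma r_D [simp]: "r d \<in> D \<longleftrightarrow> d \<in> D"
  using r_perm by (rule permutes_in_image)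

lemma n_eq [simp]: "n x = n y \<longleftrightarrow> x = y"
  using permutes_inj[OF n_perm] by (auto dest: injD)

lemma r_eq [simp]: "r x = r y \<longleftrightarrow> x = y"
  by (metis r_r)

lemma rl_r [simp]: "d \<in> D \<Longrightarrow> rl (r d) \<longleftrightarrow> rl (n d)"
  by (simp add: rl_n)

lemma rl_rot [simp]: "d \<in> D \<Longrightarrow> rl (n (r d)) \<longleftrightarrow> rl d"
  by (simp add: rl_n)

lemma ed_next: "d \<in> D \<Longrightarrow> \<not> rl (n d) \<Longrightarrow> ed (n d) = xe (r d)"
  using ed_rot[of "r d"] by (simp add: rl_r)

lemma xe_next: "d \<in> D \<Longrightarrow> \<not> rl (n d) \<Longrightarrow> xe (n d) = ed d"
  using xe_rot[of "r d"] by (simp add: rl_r ed_r)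

lemma ed_straight: "d \<in> D \<Longrightarrow> \<not> rl (n d) \<Longrightarrow> ed (n (r (n d))) = ed d"
  using ed_rot[of "n d"] xe_next[of d] by simp

lemma next_disjoint: "d \<in> D \<Longrightarrow> \<not> rl (n d) \<Longrightarrow> ed d \<inter> ed (n d) = {}"
  using cross_disjoint[of "r d"] ed_next[of d] by (simp add: rl_r ed_r)

lemma dest_in: "d \<in> D \<Longrightarrow> dest d \<in> ed d" "d \<in> D \<Longrightarrow> dest (r d) \<in> ed d"
  using ed_eq[of d] by auto

lemma ed_ne: "d \<in> D \<Longrightarrow> ed d \<noteq> {}"
  using ed_eq by auto

text \<open>Typical use of \<open>par\<close>: opposite darts at a crossing share the parameter, the
  two ends of one piece do not, so a piece cannot close up on itself.\<close>

lemma straight_ne_r: "d \<in> D \<Longrightarrow> \<not> rl d \<Longrightarrow> n (r (n (r d))) \<noteq> r d"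
  using par_opp[of d] par_ne[of d] by auto

lemma ed_same: "d \<in> D \<Longrightarrow> d' \<in> D \<Longrightarrow> x \<in> ed d \<Longrightarrow> y \<in> ed d \<Longrightarrow> x \<in> ed d' \<Longrightarrow> y \<in> ed d' \<Longrightarrow> x \<noteq> y
   \<Longrightarrow> ed d = ed d'"
  using ed_eq[of d] ed_eq[of d'] by auto

lemma rot4_cross: "d \<in> D \<Longrightarrow> \<not> rl (n d) \<Longrightarrow> n (r (n (r (n (r (n d)))))) = r d"
  using rot4[of "r d"] by (simp add: rl_r)

text \<open>
  The side b of a face with only crossings as corners (four of them); the side t, starting at the
  only vertex of a triangle.
\<close>

definition quad0 :: "'d \<Rightarrow> bool" where
  "quad0 b \<longleftrightarrow> b \<in> D \<and> n (n (n (n b))) = b \<and> \<not> rl b \<and> \<not> rl (n b) \<and> \<not> rl (n (n b)) \<and> \<not> rl (n (n (n b)))"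

definition tri1 :: "'d \<Rightarrow> bool" where
  "tri1 t \<longleftrightarrow> t \<in> D \<and> n (n (n t)) = t \<and> rl t \<and> \<not> rl (n t) \<and> \<not> rl (n (n t))"

text \<open>
  The two edges through the vertex of a triangle bound a strip. A chain follows it across
  quadrilaterals of crossings; the face where it leaves them has to pay the triangle.
\<close>

inductive chain :: "'d \<Rightarrow> nat \<Rightarrow> 'd \<Rightarrow> bool" where
  chain_0: "tri1 t \<Longrightarrow> chain t 0 (r (n t))"
| chain_Suc: "chain t i b \<Longrightarrow> quad0 b \<Longrightarrow> chain t (Suc i) (r (n (n b)))"

definition demanded :: "'d \<Rightarrow> bool" where
  "demanded d \<longleftrightarrow> \<not> quad0 d \<and> (\<exists>t i. chain t i d)"

section \<open>Strips and the chains along them\<close>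

lemma quad0_n: "quad0 b \<Longrightarrow> quad0 (n b)"
  by (auto simp: quad0_def)

lemma tri1_dest: "tri1 t \<Longrightarrow> dest (n (n t)) = dest (r t)"
  using dest_head[of "n (n t)"] by (auto simp: tri1_def rl_r)

text \<open>One edge on both sides of the vertex would, by \<open>real_unique\<close>, make the face
  turn back on itself there, which \<open>n_ne_r\<close> forbids.\<close>

lemma tri1_ed_ne:
  assumes "tri1 t" shows "ed t \<noteq> ed (n (n t))"
proof
  assume eq: "ed t = ed (n (n t))"
  have t: "t \<in> D" "rl t" "n (n (n t)) = t" using assms by (auto simp: tri1_def)
  have "t = r (n (n t))"
    by (rule real_unique) (use t eq tri1_dest[OF assms] in \<open>auto simp: rl_r ed_r\<close>)
  then show False using n_ne_r[of "n (n t)"] t by simp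
qed

lemma chain_tri1: "chain t i b \<Longrightarrow> tri1 t"
  by (induction rule: chain.induct) auto

text \<open>Invariant of the strip: \<open>b\<close> joins crossings on the two edges through the
  vertex of \<open>t\<close>. The dart \<open>n b\<close> runs away from that vertex along the edge
  of \<open>t\<close>, and \<open>n (r b)\<close> runs towards it along the edge of
  \<open>n (n t)\<close>.\<close>

lemma chain_facts:
  assumes "chain t i b"
  shows "b \<in> D \<and> \<not> rl b \<and> \<not> rl (r b) \<and> ed (n b) = ed t \<and> dest (r (n b)) = dest (r t)
     \<and> ed (n (r b)) = ed (n (n t)) \<and> dest (n (r b)) = dest (r t)"
  using assms
proof (induction rule: chain.induct)
  case (chain_0 t)
  then have t: "t \<in> D" "n (n (n t)) = t" "rl t" "\<not> rl (n t)" "\<not> rl (n (n t))"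
    by (auto simp: tri1_def)
  have "dest (r (n (r (n t)))) = dest (r t)"
  proof -
    let ?m = "r (n (r (n t)))"
    have "dest (n (r (n ?m))) = dest ?m"
      by (rule dest_straight) (use t in \<open>auto simp: rl_r\<close>)
    moreover have "n (r (n ?m)) = r t" using rot4_cross[of t] t by simp
    ultimately show ?thesis by simp
  qed
  then show ?case
    using t ed_straight[of t] tri1_dest[OF chain_0] by (auto simp: rl_r)
next
  case (chain_Suc t i b)
  then have b: "b \<in> D" "n (n (n (n b))) = b" "\<not> rl b" "\<not> rl (n b)" "\<not> rl (n (n b))" "\<not> rl (n (n (n b)))"
    by (auto simp: quad0_def)
  let ?b = "r (n (n b))"
  have 1: "ed (n ?b) = ed (n b)" using ed_straight[of "n b"] b by simp
  have 2: "dest (r (n ?b)) = dest (r (n b))"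
  proof -
    let ?m = "r (n ?b)"
    have "dest (n (r (n ?m))) = dest ?m"
      by (rule dest_straight) (use b in \<open>auto simp: rl_r\<close>)
    moreover have "n (r (n ?m)) = r (n b)" using rot4_cross[of "n b"] b by simp
    ultimately show ?thesis by simp
  qed
  have 3: "ed (n (r ?b)) = ed (n (r b))"
    using ed_straight[of "n (n (n b))"] b by simp
  have 4: "dest (n (r ?b)) = dest (n (r b))"
    using dest_straight[of "n (n (n b))"] b by (simp add: rl_r)
  show ?case using chain_Suc 1 2 3 4 b by (auto simp: rl_r)
qed

text \<open>The side \<open>r b\<close> belongs to a one-vertex triangle or to a quadrilateral of
  crossings, never to both, and this determines the previous side. Hence no side is asked by two
  triangles.\<close>

lemma chain_unique:
  "chain t i b \<Longrightarrow> chain t' i' b \<Longrightarrow> t = t' \<and> i = i'"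
proof (induction i arbitrary: i' b)
  case 0
  then have t: "tri1 t" "b = r (n t)" by (auto elim: chain.cases)
  show ?case
  proof (cases i')
    case 0
    then have "b = r (n t')" using 0(1) \<open>chain t' i' b\<close> by (auto elim: chain.cases)
    then show ?thesis using t 0 by simp
  next
    case (Suc k)
    then obtain b' where "quad0 b'" "b = r (n (n b'))" using \<open>chain t' i' b\<close> by (auto elim: chain.cases)
    then show ?thesis using t by (auto simp: quad0_def tri1_def)
  qed
next
  case (Suc i)
  then obtain c where c: "quad0 c" "b = r (n (n c))" "chain t i c" by (auto elim: chain.cases)
  show ?case
  proof (cases i')
    case 0
    then have "tri1 t'" "b = r (n t')" using \<open>chain t' i' b\<close> by (auto elim: chain.cases)
    then show ?thesis using c by (auto simp: quad0_def tri1_def)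
  next
    case (Suc k)
    then obtain b' where "chain t' k b'" "b = r (n (n b'))" using \<open>chain t' i' b\<close> by (auto elim: chain.cases)
    then show ?thesis using c Suc.IH[of c k] Suc by auto
  qed
qed

text \<open>By \<open>chain_unique\<close> an endless chain would visit infinitely many
  darts.\<close>

lemma chain_end:
  assumes "tri1 t" shows "\<exists>i b. chain t i b \<and> \<not> quad0 b"
proof (rule ccontr)
  assume "\<not> ?thesis"
  then have q: "\<And>i b. chain t i b \<Longrightarrow> quad0 b" by blast
  have "\<exists>b. chain t i b" for i
    by (induction i) (use assms q in \<open>blast intro: chain.intros\<close>)+
  then obtain B where B: "\<And>i. chain t i (B i)" by metis
  have "inj B" by (rule injI) (metis B chain_unique)
  moreover have "range B \<subseteq> D" using chain_facts[OF B] by auto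
  ultimately show False using finD by (meson finite_subset infinite_UNIV_nat finite_imageD)
qed

text \<open>Beyond \<open>b\<close> the two strip edges would be the other sides of the triangle.
  They start at one vertex, so they can neither cross nor meet again at a vertex. Hence no triangle
  ever has to pay.\<close>

lemma chain_not_triangle:
  assumes "chain t i b" shows "n (n (n b)) \<noteq> b"
proof
  assume b3: "n (n (n b)) = b"
  note f = chain_facts[OF assms]
  have t: "tri1 t" using assms by (rule chain_tri1)
  let ?u = "dest (r t)" let ?m = "n (n b)"
  have D: "b \<in> D" "t \<in> D" using f t by (auto simp: tri1_def)
  have nrl: "\<not> rl b" using f by simp
  have "xe b = ed ?m" using xe_next[of ?m] b3 nrl D by simp
  then have edm: "ed ?m = ed (n (n t))" using ed_rot[of b] f nrl by simp
  have uc: "?u \<in> ed (n b)" "?u \<in> ed ?m"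
    using dest_in(2)[of "n b"] dest_in(1)[of "n (n t)"] f D edm tri1_dest[OF t] by auto
  show False
  proof (cases "rl ?m")
    case False
    then show False using next_disjoint[of "n b"] uc D by auto
  next
    case True
    have "dest (n b) = dest (r ?m)" using dest_head[of "n b"] True D by (simp add: rl_r)
    moreover have "dest ?m = ?u"
      using dest_straight[of ?m] b3 nrl f D by (simp add: rl_r)
    ultimately have "ed (n b) = ed ?m"
      using ed_eq[of "n b"] ed_eq[of ?m] D f by auto
    then show False using edm f tri1_ed_ne[OF t] by simp
  qed
qed

section \<open>Small faces that cannot occur\<close>

lemma n_ne: assumes "d \<in> D" shows "n d \<noteq> d"
proof
  assume eq: "n d = d"
  show False
  proof (cases "rl d")
    case True
    then have "dest (r d) = dest d" using dest_head[of d] eq assms by simp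
    then show False using dest_ne assms by metis
  next
    case False
    then show False using next_disjoint[of d] eq ed_ne[of d] assms by simp
  qed
qed

lemma opp_opp: "d \<in> D \<Longrightarrow> \<not> rl d \<Longrightarrow> n (r (n (r (n (r (n (r d))))))) = d"
  by (rule rot4)

lemma opp_cross: "d \<in> D \<Longrightarrow> \<not> rl (n d) \<Longrightarrow> xe (r d) = ed (n d)"
  by (simp add: ed_next)

lemma r_ne: "d \<in> D \<Longrightarrow> r d \<noteq> d"
  using par_ne by metis

text \<open>The two ends of one piece are different points, so they cannot both be crossings with
  the same edge.\<close>

lemma cross_once':
  assumes "d \<in> D" "\<not> rl d" "\<not> rl (n d)" "xe d = xe (r d)"
  shows False
  using cross_once[of d "r d"] straight_ne_r[of d] r_ne[of d] assms by (auto simp: ed_r)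

text \<open>A digon would be a pair of parallel edges, a crossing of adjacent edges, or a second
  crossing of two edges, according to its number of real corners.\<close>

lemma n_n_ne: assumes "d \<in> D" shows "n (n d) \<noteq> d"
proof
  assume eq: "n (n d) = d"
  have *: False if d: "d \<in> D" "n (n d) = d" "\<not> rl (n d)" for d
  proof (cases "rl d")
    case True
    have "dest (n d) = dest (r d)"
      using dest_head[of "n d"] d True by simp
    then show False using next_disjoint[of d] dest_in(2)[of d] dest_in(1)[of "n d"] d by auto
  next
    case False
    have "xe d = ed (n d)" using xe_next[of "n d"] d False by simp
    then show False using cross_once'[of d] opp_cross[of d] d False by simp
  qed
  show False
  proof (cases "rl d \<and> rl (n d)")
    case True
    have "ed d = ed (n d)"
      using dest_head[of d] dest_head[of "n d"] True eq assms ed_eq[of d] ed_eq[of "n d"] by auto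
    then have "r d = n d"
      by (intro real_unique) (use True assms ed_r dest_head[of d] in auto)
    then show False using n_ne_r[OF assms] by simp
  next
    case False
    then show False using *[of d] *[of "n d"] eq assms by auto
  qed
qed

text \<open>The edges of two sides both cross the edge of the third, so they share an endpoint; but
  they also cross each other, which adjacent edges cannot do.\<close>

lemma no_tri0:
  assumes "d \<in> D" "n (n (n d)) = d" shows "rl d \<or> rl (n d) \<or> rl (n (n d))"
proof (rule ccontr)
  assume "\<not> ?thesis"
  then have nr: "\<not> rl d" "\<not> rl (n d)" "\<not> rl (n (n d))" by auto
  have "xe d \<inter> xe (r d) \<noteq> {}"
    by (rule cross_adjacent) (use assms nr ed_r in auto)
  moreover have "xe d = ed (n (n d))" using xe_next[of "n (n d)"] assms nr by simp
  moreover have "xe (r d) = ed (n d)" using opp_cross[of d] assms nr by simp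
  ultimately show False using next_disjoint[of "n d"] assms nr by auto
qed

text \<open>Parameters are monotone along an edge, so the far end of the piece that continues
  \<open>m\<close> is not the origin of \<open>m\<close>, where both excluded darts start.\<close>

lemma straight_par:
  assumes "m \<in> D" "\<not> rl m" "\<not> rl (n m)"
  shows "r (n (r (n m))) \<noteq> m" "r (n (r (n m))) \<noteq> n (r (n (r m)))"
proof -
  have 1: "par (n (r (n m))) = par (r m)" using par_opp[of "r m"] assms by simp
  have 2: "par m < par (r m) \<longleftrightarrow> par (n (r (n m))) < par (r (n (r (n m))))"
    using par_straight[of m] assms by simp
  have "par (r (n (r (n m)))) \<noteq> par m" using 1 2 par_ne[of m] assms by auto
  then show "r (n (r (n m))) \<noteq> m" "r (n (r (n m))) \<noteq> n (r (n (r m)))"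
    using par_opp[of m] assms by auto
qed

section \<open>Chains into faces whose corners are all crossings\<close>

lemma quad0_opposite:
  assumes "quad0 b" shows "ed (n (n b)) \<noteq> ed b"
proof
  assume eq: "ed (n (n b)) = ed b"
  have b: "b \<in> D" "\<not> rl b" "\<not> rl (n b)" "\<not> rl (n (n b))" using assms by (auto simp: quad0_def)
  show False
    using cross_once'[of "n b"] xe_next[of b] opp_cross[of "n b"] eq b by simp
qed

text \<open>In the last quadrilateral before \<open>d\<close>, the side \<open>b\<close> opposite to
  \<open>d\<close> lies on a second edge that crosses both strip edges. The later arguments play
  this transversal off against the edges around \<open>d\<close>.\<close>

lemma chain_crossings:
  assumes "chain t (Suc i) d"
  obtains b where "quad0 b" "chain t i b" "d = r (n (n b))" "ed b \<noteq> ed d"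
    "ed (n b) = ed (n d)" "xe (n b) = ed b" "ed (n (r d)) = ed (n (n (n b)))" "xe (r (n (n (n b)))) = ed b"
    "ed b \<inter> ed (n d) = {}" "ed b \<inter> ed (n (r d)) = {}"
proof -
  from assms obtain b where b: "quad0 b" "chain t i b" "d = r (n (n b))"
    by (auto elim: chain.cases)
  then have q: "b \<in> D" "\<not> rl b" "\<not> rl (n b)" "\<not> rl (n (n b))" "\<not> rl (n (n (n b)))" "n (n (n (n b))) = b"
    by (auto simp: quad0_def)
  have e: "ed (n b) = ed (n d)" "ed (n (r d)) = ed (n (n (n b)))"
    using chain_facts[OF assms] chain_facts[OF b(2)] b by auto
  show ?thesis
  proof (rule that[OF b])
    show "ed b \<noteq> ed d" using quad0_opposite[OF b(1)] b q ed_r by auto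
    show "xe (n b) = ed b" using xe_next q by simp
    show "xe (r (n (n (n b)))) = ed b" using opp_cross[of "n (n (n b))"] q by simp
    show "ed b \<inter> ed (n d) = {}" using next_disjoint[of b] q e by simp
    show "ed b \<inter> ed (n (r d)) = {}" using next_disjoint[of "n (n (n b))"] q e by auto
  qed (use e in auto)
qed

lemma demanded_D: "demanded d \<Longrightarrow> d \<in> D \<and> \<not> rl d \<and> \<not> rl (n d)"
  unfolding demanded_def using chain_facts by fastforce

text \<open>A longer chain supplies an edge \<open>ed b\<close>, different from \<open>ed d\<close>,
  that crosses the strip edges, which carry the two sides next to \<open>d\<close>. So it shares
  endpoints with the edges of the remaining two sides, \<open>n (n d)\<close> and
  \<open>n (n (n d))\<close>. The other adjacencies around the pentagon put both of these endpoints
  on \<open>ed d\<close>, which gives \<open>ed b = ed d\<close>.\<close>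

lemma pentagon_chain_0:
  assumes d: "d \<in> D" "n (n (n (n (n d)))) = d"
    and nr: "\<not> rl d" "\<not> rl (n d)" "\<not> rl (n (n d))" "\<not> rl (n (n (n d)))" "\<not> rl (n (n (n (n d))))"
    and ch: "chain t i d"
  shows "i = 0"
proof (rule ccontr)
  assume "i \<noteq> 0"
  then obtain k where "chain t (Suc k) d" using ch by (cases i) auto
  from chain_crossings[OF this] obtain b where b: "quad0 b" "d = r (n (n b))" "ed b \<noteq> ed d"
    "ed (n b) = ed (n d)" "xe (n b) = ed b" "ed (n (r d)) = ed (n (n (n b)))" "xe (r (n (n (n b)))) = ed b"
    "ed b \<inter> ed (n d) = {}" "ed b \<inter> ed (n (r d)) = {}" by metis
  have bD: "b \<in> D" "\<not> rl (n b)" "\<not> rl b" "n (n (n (n b))) = b" using b by (auto simp: quad0_def)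
  let ?a = "\<lambda>x. ed x" let ?d1 = "n d" let ?d2 = "n ?d1" let ?d3 = "n ?d2" let ?d4 = "n ?d3"
  have last: "ed (n (r d)) = ed ?d4"
    using ed_rot[of d] xe_next[of ?d4] d nr by simp
  have m2: "ed b \<inter> ed ?d2 \<noteq> {}"
    using cross_adjacent[of "n b" "r ?d1"] b(4,5) opp_cross[of ?d1] nr d bD ed_r[of ?d1] by simp
  have m3: "ed b \<inter> ed ?d3 \<noteq> {}"
    using cross_adjacent[of "r (n (n (n b)))" "?d4"] b(6,7) xe_next[of ?d3] nr d bD last ed_r[of "n (n (n b))"]
    by auto
  have adj: "ed x \<inter> ed (n (n x)) \<noteq> {}" if "x \<in> D" "\<not> rl (n x)" "\<not> rl (n (n x))" for x
    using cross_adjacent[of "n x" "r (n x)"] xe_next[of x] opp_cross[of "n x"] ed_r[of "n x"] that by auto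
  from m2 obtain \<alpha> where \<alpha>: "\<alpha> \<in> ed b" "\<alpha> \<in> ed ?d2" by auto
  from m3 obtain \<beta> where \<beta>: "\<beta> \<in> ed b" "\<beta> \<in> ed ?d3" by auto
  have dis: "ed d \<inter> ed ?d1 = {}" "ed ?d2 \<inter> ed ?d3 = {}" "ed ?d4 \<inter> ed d = {}"
    using next_disjoint[of d] next_disjoint[of ?d2] next_disjoint[of ?d4] d nr by auto
  have "\<alpha> \<in> ed d"
    using adj[of d] adj[of ?d2] dis b(9) last \<alpha> ed_eq[of ?d2] d nr by auto
  moreover have "\<beta> \<in> ed d"
    using adj[of ?d1] adj[of ?d3] dis b(8) \<beta> ed_eq[of ?d3] d nr by auto
  moreover have "\<alpha> \<noteq> \<beta>" using \<alpha> \<beta> dis by auto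
  ultimately have "ed b = ed d" using ed_same[of b d \<alpha> \<beta>] \<alpha> \<beta> bD d by auto
  then show False using b by simp
qed

text \<open>When all six sides are demanded, the edges of every second side form a triangle
  (\<open>e0\<close>, \<open>e2\<close>, \<open>e4\<close>). The transversal \<open>ed b\<close> of
  a longer chain meets all three, so it equals one of them. \<open>ed d\<close> is excluded by
  \<open>chain_crossings\<close>; each of the other two would cross a strip edge a second
  time.\<close>

lemma hexagon_chain_0:
  assumes d: "d \<in> D" "n (n (n (n (n (n d))))) = d"
    and dm: "\<And>k. demanded ((n ^^ k) d)"
    and ch: "chain t i d"
  shows "i = 0"
proof (rule ccontr)
  assume "i \<noteq> 0"
  then obtain k where "chain t (Suc k) d" using ch by (cases i) auto
  from chain_crossings[OF this] obtain b where b: "quad0 b" "d = r (n (n b))" "ed b \<noteq> ed d"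
    "ed (n b) = ed (n d)" "xe (n b) = ed b" "ed (n (r d)) = ed (n (n (n b)))" "xe (r (n (n (n b)))) = ed b"
    "ed b \<inter> ed (n d) = {}" "ed b \<inter> ed (n (r d)) = {}" by metis
  have bD: "b \<in> D" "\<not> rl b" "\<not> rl (n b)" "\<not> rl (n (n b))" "\<not> rl (n (n (n b)))" "n (n (n (n b))) = b"
    using b by (auto simp: quad0_def)
  let ?d1 = "n d" let ?d2 = "n ?d1" let ?d3 = "n ?d2" let ?d4 = "n ?d3" let ?d5 = "n ?d4"
  have demanded: "demanded d" "demanded ?d1" "demanded ?d2" "demanded ?d3" "demanded ?d4" "demanded ?d5"
    using dm[of 0] dm[of 1] dm[of 2] dm[of 3] dm[of 4] dm[of 5] by (simp_all add: eval_nat_numeral)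
  note nr = demanded[THEN demanded_D]
  have tips: "dest (n (r (n (n x)))) = dest (n x)" "dest (r (n x)) = dest (n (r x))"
    if "demanded x" "demanded (n x)" for x
  proof -
    show "dest (n (r (n (n x)))) = dest (n x)"
      using dest_straight[of "n x"] demanded_D[OF that(1)] demanded_D[OF that(2)] by simp
    show "dest (r (n x)) = dest (n (r x))"
      using that(1) unfolding demanded_def using chain_facts by force
  qed
  \<comment> \<open>\<open>T x\<close> is the vertex where the strip through \<open>x\<close>
    starts. The edge of \<open>n x\<close> bounds the strips through both \<open>x\<close> and
    \<open>n (n x)\<close>, so it joins their starting vertices.\<close>
  define T where "T x = dest (n (r x))" for x
  have e: "ed (n x) = {T x, T (n (n x))}" if "demanded x" "demanded (n x)" for x
    using tips[OF that] ed_eq[of "n x"] demanded_D[OF that(2)] unfolding T_def by auto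
  have e0: "ed d = {T ?d5, T ?d1}" and e2: "ed ?d2 = {T ?d1, T ?d3}" and e4: "ed ?d4 = {T ?d3, T ?d5}"
    using e[of ?d5] e[of ?d1] e[of ?d3] d demanded by simp_all
  have last: "ed (n (r d)) = ed ?d5"
    using ed_rot[of d] xe_next[of ?d5] d nr by simp
  have m0: "ed b \<inter> ed d \<noteq> {}"
    using cross_adjacent[of "n b" ?d1] b(4,5) xe_next[of d] nr d bD by simp
  have m2: "ed b \<inter> ed ?d2 \<noteq> {}"
    using cross_adjacent[of "n b" "r ?d1"] b(4,5) opp_cross[of ?d1] nr d bD ed_r[of ?d1] by simp
  have m4: "ed b \<inter> ed ?d4 \<noteq> {}"
    using cross_adjacent[of "r (n (n (n b)))" ?d5] b(6,7) xe_next[of ?d4] nr d bD last ed_r[of "n (n (n b))"]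
    by auto
  \<comment> \<open>An edge that meets all three sides of a triangle contains two of its
    corners.\<close>
  have two: "ed b = ed d \<or> ed b = ed ?d2 \<or> ed b = ed ?d4"
  proof -
    have ne: "T ?d5 \<noteq> T ?d1" "T ?d1 \<noteq> T ?d3" "T ?d3 \<noteq> T ?d5"
      using dest_ne[of d] dest_ne[of ?d2] dest_ne[of ?d4] ed_eq[of d] ed_eq[of ?d2] ed_eq[of ?d4] nr
      unfolding e0 e2 e4 by (metis doubleton_eq_iff)+
    have "(T ?d5 \<in> ed b \<and> T ?d1 \<in> ed b) \<or> (T ?d1 \<in> ed b \<and> T ?d3 \<in> ed b) \<or> (T ?d3 \<in> ed b \<and> T ?d5 \<in> ed b)"
      using m0 m2 m4 unfolding e0 e2 e4 by blast
    then show ?thesis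
      using ed_same[of b d "T ?d5" "T ?d1"] ed_same[of b ?d2 "T ?d1" "T ?d3"] ed_same[of b ?d4 "T ?d3" "T ?d5"]
        ne e0 e2 e4 bD nr by blast
  qed
  have n2: "ed b \<noteq> ed ?d2"
  proof
    assume eq: "ed b = ed ?d2"
    have "xe (n b) = xe (r ?d1)" using b(5) eq opp_cross[of ?d1] nr by simp
    then have "r ?d1 = n b \<or> r ?d1 = n (r (n (r (n b))))"
      using cross_once[of "n b" "r ?d1"] nr bD b(4) ed_r[of ?d1] by simp
    moreover have "n (r (n (n b))) = ?d1" using b by simp
    ultimately show False using straight_par[of "n b"] bD by simp
  qed
  have n4: "ed b \<noteq> ed ?d4"
  proof
    assume eq: "ed b = ed ?d4"
    have "xe ?d5 = xe (r (n (n (n b))))" using b(7) eq xe_next[of ?d4] nr by simp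
    then have "r (n (n (n b))) = ?d5 \<or> r (n (n (n b))) = n (r (n (r ?d5)))"
      using cross_once[of ?d5 "r (n (n (n b)))"] nr bD b(6) last ed_r[of "n (n (n b))"] by simp
    moreover have "n (r (n ?d5)) = n (n (n b))" using b d by simp
    ultimately show False using straight_par[of ?d5] nr d by simp
  qed
  show False using two n2 n4 b(3) by blast
qed

text \<open>
  Such a quadrilateral has to pay twice but owns only one vertex. It and the faces with crossings
  only are helped by units, called tokens, from faces with a vertex that have something to spare;
  a token sits on a side with one real end.
\<close>

definition demanded_quad :: "'d \<Rightarrow> bool" where
  "demanded_quad e \<longleftrightarrow> e \<in> D \<and> n (n (n (n e))) = e \<and> rl e \<and> \<not> rl (n e) \<and> \<not> rl (n (n e)) \<and> \<not> rl (n (n (n e)))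
     \<and> demanded (n e) \<and> demanded (n (n e))"

definition giver :: "'d \<Rightarrow> bool" where
  "giver d \<longleftrightarrow> (\<exists>x\<in>orbit n d. rl x) \<and> (\<forall>x\<in>orbit n d. \<not> tri1 x \<and> \<not> demanded_quad x)"

definition token :: "'d \<Rightarrow> bool" where
  "token d \<longleftrightarrow> d \<in> D \<and> rl d \<noteq> rl (n d) \<and> giver d"

text \<open>
  A token offered to a triangle is handed on, around the vertex, through triangles whose strip
  starts with a quadrilateral; ewalk and lwalk are the two directions of rotation.
\<close>

inductive ewalk :: "'d \<Rightarrow> 'd \<Rightarrow> bool" where
  "tri1 t \<Longrightarrow> \<not> quad0 (r (n t)) \<Longrightarrow> ewalk t t"
| "tri1 t \<Longrightarrow> quad0 (r (n t)) \<Longrightarrow> ewalk (r (n (n t))) t' \<Longrightarrow> ewalk t t'"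

inductive lwalk :: "'d \<Rightarrow> 'd \<Rightarrow> bool" where
  "tri1 t \<Longrightarrow> \<not> quad0 (r (n t)) \<Longrightarrow> lwalk t t"
| "tri1 t \<Longrightarrow> quad0 (r (n t)) \<Longrightarrow> lwalk (n (r t)) t' \<Longrightarrow> lwalk t t'"

text \<open>The relation own d x: the token of d is spent on the side x of a paying face.\<close>

inductive own :: "'d \<Rightarrow> 'd \<Rightarrow> bool" where
  own_quad: "token d \<Longrightarrow> demanded_quad (r d) \<or> demanded_quad (n (r d)) \<Longrightarrow> own d (r d)"
| own_enter: "token d \<Longrightarrow> \<not> rl d \<Longrightarrow> ewalk (r d) t \<Longrightarrow> own d (r (n t))"
| own_leave: "token d \<Longrightarrow> rl d \<Longrightarrow> lwalk (n (r d)) t \<Longrightarrow> own d (r (n t))"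

section \<open>Each token is spent at most once\<close>

lemma own_token: "own d x \<Longrightarrow> token d"
  by (induction rule: own.induct) auto

lemma ewalk_tri1: "ewalk t t' \<Longrightarrow> tri1 t \<and> tri1 t' \<and> \<not> quad0 (r (n t'))"
  by (induction rule: ewalk.induct) auto

lemma lwalk_tri1: "lwalk t t' \<Longrightarrow> tri1 t \<and> tri1 t' \<and> \<not> quad0 (r (n t'))"
  by (induction rule: lwalk.induct) auto

lemma ewalk_fun: "ewalk t a \<Longrightarrow> ewalk t b \<Longrightarrow> a = b"
proof (induction rule: ewalk.induct)
  case (2 t a)
  then show ?case by (auto elim: ewalk.cases)
qed (auto elim: ewalk.cases)

lemma lwalk_fun: "lwalk t a \<Longrightarrow> lwalk t b \<Longrightarrow> a = b"
proof (induction rule: lwalk.induct)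
  case (2 t a)
  then show ?case by (auto elim: lwalk.cases)
qed (auto elim: lwalk.cases)

lemma demanded_quad_not_tri1: "demanded_quad x \<Longrightarrow> \<not> tri1 x"
  unfolding demanded_quad_def tri1_def using n_ne by metis

text \<open>The rules exclude each other: the face across the token's side is a demanded
  quadrilateral or a triangle, not both, and \<open>rl d\<close> fixes the direction of the walk,
  which is deterministic.\<close>

lemma own_fun: assumes "own d x" "own d y" shows "x = y"
proof -
  have tk: "d \<in> D" "rl d \<noteq> rl (n d)" using own_token[OF assms(1)] by (auto simp: token_def)
  have q: "rl (r x)" if "demanded_quad (r x)" "x \<in> D" for x using that by (simp add: demanded_quad_def)
  have e: "\<not> demanded_quad (r d) \<and> \<not> demanded_quad (n (r d))" if "\<not> rl d" "ewalk (r d) t" for t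
    using ewalk_tri1[OF that(2)] demanded_quad_not_tri1[of "r d"] that tk by (auto simp: demanded_quad_def)
  have l: "\<not> demanded_quad (r d) \<and> \<not> demanded_quad (n (r d))" if "rl d" "lwalk (n (r d)) t" for t
    using lwalk_tri1[OF that(2)] demanded_quad_not_tri1[of "n (r d)"] that tk by (auto simp: demanded_quad_def)
  show ?thesis
    using assms(1)
  proof cases
    case own_quad
    show ?thesis using assms(2) by cases (use own_quad e l in auto)
  next
    case (own_enter t)
    show ?thesis using assms(2) by cases (use own_enter e[OF own_enter(3,4)] ewalk_fun in auto)
  next
    case (own_leave t)
    show ?thesis using assms(2) by cases (use own_leave l[OF own_leave(3,4)] lwalk_fun in auto)
  qed
qed

lemma orbit_cycle:
  assumes "(n ^^ Suc k) d = d" shows "orbit n d = (\<lambda>i. (n ^^ i) d) ` {..k}"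
proof
  show "orbit n d \<subseteq> (\<lambda>i. (n ^^ i) d) ` {..k}"
  proof
    fix y assume "y \<in> orbit n d"
    then show "y \<in> (\<lambda>i. (n ^^ i) d) ` {..k}"
    proof induction
      case base
      show ?case
      proof (cases k)
        case 0 then show ?thesis using assms by auto
      next
        case (Suc j) then show ?thesis by (intro image_eqI[of _ _ 1]) auto
      qed
    next
      case (step y)
      then obtain i where i: "y = (n ^^ i) d" "i \<le> k" by auto
      show ?case
      proof (cases "i = k")
        case True
        then have "n y = d" using i assms by simp
        then show ?thesis by (intro image_eqI[of _ _ 0]) auto
      next
        case False
        then show ?thesis using i by (intro image_eqI[of _ _ "Suc i"]) auto
      qed
    qed
  qed
  have "(n ^^ i) d \<in> orbit n d" for i
    using perm_self_in_orbit[OF finD n_perm, of d] by (induction i) (auto intro: orbit.step)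
  then show "(\<lambda>i. (n ^^ i) d) ` {..k} \<subseteq> orbit n d" by auto
qed

lemma orbit_tri1: "tri1 t \<Longrightarrow> orbit n t = {t, n t, n (n t)}"
  using orbit_cycle[of 2 t] by (auto simp: tri1_def eval_nat_numeral atMost_Suc)

lemma orbit_demanded_quad: "demanded_quad e \<Longrightarrow> orbit n e = {e, n e, n (n e), n (n (n e))}"
  using orbit_cycle[of 3 e] by (auto simp: demanded_quad_def eval_nat_numeral atMost_Suc)

lemma orbit_sym: "x \<in> orbit n d \<Longrightarrow> orbit n x = orbit n d"
  by (rule perm_orbit_eq[OF finD n_perm])

lemma tri1_real: assumes "tri1 x" "y \<in> orbit n d" "x \<in> orbit n d" "rl y" shows "y = x"
proof -
  have "y \<in> orbit n x" using assms orbit_sym by auto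
  then show ?thesis using assms unfolding orbit_tri1[OF assms(1)] by (auto simp: tri1_def)
qed

lemma demanded_quad_real: assumes "demanded_quad x" "y \<in> orbit n d" "x \<in> orbit n d" "rl y" shows "y = x"
proof -
  have "y \<in> orbit n x" using assms orbit_sym by auto
  then show ?thesis using assms unfolding orbit_demanded_quad[OF assms(1)] by (auto simp: demanded_quad_def)
qed

lemma in_orbit: "n d \<in> orbit n d" "n (n d) \<in> orbit n d" "d \<in> orbit n d"
  using perm_self_in_orbit[OF finD n_perm, of d] by (auto intro: orbit.intros)

text \<open>One-vertex triangles and demanded quadrilaterals have exactly one real dart, so any
  single real dart of a face decides whether it gives.\<close>

lemma giver_iff:
  assumes "y \<in> orbit n d" "rl y" shows "giver d \<longleftrightarrow> \<not> tri1 y \<and> \<not> demanded_quad y"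
  unfolding giver_def using tri1_real demanded_quad_real assms by metis

text \<open>The face across \<open>t\<close> lies between \<open>t\<close> and the strip of
  \<open>tw\<close>. Either it gives a token, or it is again a triangle at the same vertex whose
  strip starts with a quadrilateral of that chain. Such a triangle hands tokens on to
  \<open>t\<close>, so the giver is sought behind it, with a chain shorter by one.\<close>

lemma enter_walk:
  assumes "ewalk t t'" "chain tw j b" "n (r (n t)) = b"
    and "\<And>k b. k < j \<Longrightarrow> chain tw k b \<Longrightarrow> dest (r t) \<in> ed b"
  shows "\<exists>z. \<not> rl z \<and> own z (r (n t'))"
  using assms
proof (induction j arbitrary: t b)
  case 0
  have t: "tri1 t" using ewalk_tri1 0(1) by blast
  have tD: "t \<in> D" "\<not> rl (n t)" "rl t" using t by (auto simp: tri1_def)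
  from 0 have tw: "tri1 tw" "b = r (n tw)" by (auto elim: chain.cases)
  then have twD: "tw \<in> D" "rl tw" "n (n (n tw)) = tw" by (auto simp: tri1_def)
  let ?p = "r (n (n tw))"
  have np: "n ?p = r t" using rot4_cross[of t] 0(3) tw tD by simp
  \<comment> \<open>This face has two real darts, \<open>?p\<close> at the vertex of
    \<open>tw\<close> and \<open>n (n ?p)\<close> at the vertex of \<open>t\<close>, so it is
    neither of the two excluded kinds.\<close>
  have "giver ?p"
    using giver_iff[of ?p ?p] giver_iff[of "n (n ?p)" ?p] in_orbit[of ?p] n_n_ne[of ?p]
      tri1_real[of "n (n ?p)" ?p ?p] demanded_quad_real[of "n (n ?p)" ?p ?p] np twD tD by auto
  then have "giver (r t)" unfolding giver_def using orbit_sym[OF in_orbit(1)[of ?p]] np by simp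
  then have "token (r t)" using tD by (auto simp: token_def)
  then have "own (r t) (r (n t'))" using own_enter[of "r t"] 0(1) tD by simp
  then show ?case using tD by (intro exI[of _ "r t"]) simp
next
  case (Suc j)
  have t: "tri1 t" using ewalk_tri1 Suc(2) by blast
  have tD: "t \<in> D" "\<not> rl (n t)" "rl t" using t by (auto simp: tri1_def)
  from Suc(3) obtain c where c: "chain tw j c" "quad0 c" "b = r (n (n c))" by (auto elim: chain.cases)
  then have cD: "c \<in> D" "\<not> rl c" "n (n (n (n c))) = c" "\<not> rl (n (n (n c)))" by (auto simp: quad0_def)
  let ?h = "n (n (n c))" let ?p = "r ?h" let ?t1 = "n (r t)"
  have np: "n ?p = r t" using rot4_cross[of t] Suc(4) c tD by simp
  have uc: "dest (r t) \<in> ed c" using Suc(5)[of j c] c by auto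
  have dt1: "dest (r ?t1) = dest (r t)" using dest_head[of "r t"] tD by simp
  have t1o: "?t1 \<in> orbit n (r t)" by (rule in_orbit)
  show ?case
  proof (cases "tri1 ?t1")
    case True
    then have r3: "n (n (n ?t1)) = ?t1" by (auto simp: tri1_def)
    then have a1: "n (n ?t1) = r t" by simp
    then have a2: "n ?t1 = ?p" using np by (metis n_eq)
    \<comment> \<open>The strip of this triangle starts with the quadrilateral of \<open>c\<close>,
      hence it forwards tokens to \<open>t\<close>.\<close>
    have q: "quad0 (r (n ?t1))" using a2 c(2) by (simp add: quad0_n)
    show ?thesis
    proof (rule Suc.IH[of ?t1 c])
      show "ewalk ?t1 t'" using ewalk.intros(2)[OF True q] a1 Suc(2) by simp
      show "n (r (n ?t1)) = c" using a2 cD by simp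
      show "dest (r ?t1) \<in> ed b" if "k < j" "chain tw k b" for k b
        using Suc(5)[of k b] that dt1 by simp
    qed (rule c(1))
  next
    case False
    \<comment> \<open>In a demanded quadrilateral the side \<open>n ?t1\<close> would lie on the
      transversal \<open>ed c\<close>, which ends at the vertex of \<open>t\<close>; but it crosses
      the edge of \<open>?t1\<close>, which ends there too.\<close>
    have "\<not> demanded_quad ?t1"
    proof
      assume q: "demanded_quad ?t1"
      then have q4: "n (n (n (n ?t1))) = ?t1" "\<not> rl (n ?t1)" by (auto simp: demanded_quad_def)
      then have "n (n (n ?t1)) = r t" by simp
      then have p: "n (n ?t1) = ?p" using np by (metis n_eq)
      have "xe ?p = ed (n ?t1)" using xe_next[of "n ?t1"] p cD tD by simp
      moreover have "xe ?p = ed c" using opp_cross[of ?h] cD by simp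
      ultimately have "dest (r t) \<in> ed (n ?t1)" using uc by simp
      then show False using next_disjoint[of ?t1] dest_in(2)[of ?t1] q4 dt1 tD by auto
    qed
    then have "giver (r t)" using giver_iff[OF t1o] False tD by simp
    then have "token (r t)" using tD by (auto simp: token_def)
    then have "own (r t) (r (n t'))" using own_enter[of "r t"] Suc(2) tD by simp
    then show ?thesis using tD by (intro exI[of _ "r t"]) simp
  qed
qed

text \<open>Let v be the vertex of the quadrilateral, u and w the far ends of the edges of
  \<open>e\<close> and \<open>n (n (n e))\<close>. The chain through \<open>n e\<close> starts at u,
  the one through \<open>n (n e)\<close> at w. A transversal of the first chain crosses the edge of
  \<open>n (n e)\<close>, as does the edge vw, so it contains v or w; v is excluded because it also
  crosses the edge uv. Symmetrically, transversals of the second chain contain u.\<close>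

lemma demanded_quad_facts:
  assumes e: "demanded_quad e" and t: "chain t i (n e)" and t': "chain t' j (n (n e))"
  shows "dest e = dest (r t)" "dest (r (n (n e))) = dest e"
    "dest (n e) = dest (r t')" "dest (r (n (n (n e)))) = dest (n e)" "dest (n (n (n e))) = dest (r e)"
    "chain t k b \<Longrightarrow> dest (n e) \<in> ed b" "chain t' k b \<Longrightarrow> dest e \<in> ed b"
    "chain t k b \<Longrightarrow> ed b \<inter> ed e = {}" "chain t' k b \<Longrightarrow> ed b \<inter> ed (n (n (n e))) = {}"
    "chain t k b \<Longrightarrow> ed (n b) = ed (n (n e))"
    "chain t' k b \<Longrightarrow> ed (n (r b)) = ed (n e)"
proof -
  have D: "e \<in> D" "rl e" "\<not> rl (n e)" "\<not> rl (n (n e))" "\<not> rl (n (n (n e)))" "n (n (n (n e))) = e"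
    using e by (auto simp: demanded_quad_def)
  note f = chain_facts[OF t] note f' = chain_facts[OF t']
  show u: "dest e = dest (r t)" using f dest_straight[of e] D by simp
  show u2: "dest (r (n (n e))) = dest e" using f u by simp
  show w: "dest (n e) = dest (r t')" using f' dest_straight[of "n e"] D by simp
  show w2: "dest (r (n (n (n e)))) = dest (n e)" using f' w by simp
  show v: "dest (n (n (n e))) = dest (r e)" using dest_head[of "n (n (n e))"] D by simp
  have ea: "ed e = {dest e, dest (r e)}" and edd: "ed (n (n (n e))) = {dest (n e), dest (r e)}"
    using ed_eq[of e] ed_eq[of "n (n (n e))"] D v w2 by auto
  have ra: "ed (n (r (n e))) = ed e" using ed_straight[of e] D by simp
  have rb: "ed (n (r (n (n e)))) = ed (n e)" using ed_straight[of "n e"] D by simp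
  { fix k b assume b: "chain t k b"
    note fb = chain_facts[OF b]
    then have nrb: "\<not> rl (n b)" by auto
    show nb: "ed (n b) = ed (n (n e))" using fb f by simp
    have ab: "ed (n (r b)) = ed e" using fb f ra by simp
    show dj: "ed b \<inter> ed e = {}" using cross_disjoint[of b] ed_rot[of b] fb ab by simp
    have "ed b \<inter> ed (n (n (n e))) \<noteq> {}"
      using cross_adjacent[of "n b" "r (n (n e))"] xe_next[of b] opp_cross[of "n (n e)"] nb nrb fb D ed_r[of "n (n e)"] by simp
    then show "dest (n e) \<in> ed b" using dj ea edd by auto }
  { fix k b assume b: "chain t' k b"
    note fb = chain_facts[OF b]
    then have nrb: "\<not> rl (n b)" by auto
    have nb: "ed (n b) = ed (n (n (n e)))" using fb f' by simp
    show ab: "ed (n (r b)) = ed (n e)" using fb f' rb by simp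
    show dj: "ed b \<inter> ed (n (n (n e))) = {}" using next_disjoint[of b] fb nb nrb by auto
    have "xe (n (r b)) = ed b" using xe_rot[of b] fb by simp
    then have "ed b \<inter> ed e \<noteq> {}"
      using cross_adjacent[of "n (r b)" "n e"] xe_next[of e] ab fb D by simp
    then show "dest e \<in> ed b" using dj ea edd by auto }
qed

text \<open>Without a token on \<open>r e\<close> the face across \<open>e\<close> is a one-vertex
  triangle or a second demanded quadrilateral. A longer chain would have a transversal equal to the
  edge of \<open>n (n e)\<close> in the first case, of \<open>n e\<close> in the second.\<close>

lemma bad_left:
  assumes e: "demanded_quad e" and t: "chain t i (n e)" and t': "chain t' j (n (n e))" and nt: "\<not> token (r e)"
  shows "tri1 (n (r e)) \<and> j = 0 \<and> ed (n (r e)) = {dest (r e), dest (n (n e))} \<or>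
         demanded_quad (n (r e)) \<and> i = 0 \<and> ed (n (r e)) = {dest (r e), dest (r (n e))}"
proof -
  have D: "e \<in> D" "rl e" "\<not> rl (n e)" "\<not> rl (n (n e))" "\<not> rl (n (n (n e)))" "n (n (n (n e))) = e"
    using e by (auto simp: demanded_quad_def)
  note F = demanded_quad_facts[OF e t t']
  let ?x = "n (r e)" let ?u = "dest e" let ?v = "dest (r e)" let ?w = "dest (n e)" let ?q = "dest (n (n e))"
  have xv: "dest (r ?x) = ?v" using dest_head[of "r e"] D by simp
  have ec: "ed (n (n e)) = {?u, ?q}" using ed_eq[of "n (n e)"] F D by auto
  have ea: "ed e = {?u, ?v}" using ed_eq[of e] D by auto
  have eb: "ed (n e) = {?w, dest (r (n e))}" using ed_eq[of "n e"] D by auto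
  have edd: "ed (n (n (n e))) = {?w, ?v}" using ed_eq[of "n (n (n e))"] F D by auto
  have vc: "?v \<notin> ed (n (n e))" using next_disjoint[of "n (n e)"] D edd by auto
  have "\<not> giver (r e)" using nt D by (auto simp: token_def)
  then have "tri1 ?x \<or> demanded_quad ?x" using giver_iff[of ?x "r e"] in_orbit[of "r e"] D by auto
  then show ?thesis
  proof
    assume tx: "tri1 ?x"
    then have X: "n (n (n ?x)) = ?x" "\<not> rl (n ?x)" "\<not> rl (n (n ?x))" by (auto simp: tri1_def)
    then have nnx: "n (n ?x) = r e" by simp
    have ex: "ed (n ?x) = ed (n e)" using xe_next[of "n ?x"] opp_cross[of e] nnx D X by simp
    have xx: "xe (n ?x) = ed ?x" using xe_next[of ?x] D X by simp
    have "ed ?x \<inter> ed (n (n e)) \<noteq> {}"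
      using cross_adjacent[of "n ?x" "r (n e)"] opp_cross[of "n e"] ex xx D X ed_r[of "n e"] by simp
    moreover have "?u \<notin> ed ?x"
    proof
      assume "?u \<in> ed ?x"
      then have "ed ?x = ed e" using ea ed_eq[of ?x] xv D dest_ne[of e] by auto
      then have "?x = e" by (intro real_unique) (use D xv in auto)
      then show False using n_ne_r[of "r e"] D by simp
    qed
    ultimately have qx: "?q \<in> ed ?x" using ec by auto
    then have vq: "ed ?x = {?v, ?q}" using vc ec ed_eq[of ?x] xv D by auto
    \<comment> \<open>A further transversal contains \<open>?u\<close> and shares an endpoint with
      the edge of \<open>?x\<close>; since \<open>?v\<close> is excluded this is \<open>?q\<close>,
      so it would be the edge of \<open>n (n e)\<close> itself.\<close>
    have "j = 0"
    proof (rule ccontr)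
      assume "j \<noteq> 0"
      then obtain k where "chain t' (Suc k) (n (n e))" using t' by (cases j) auto
      from chain_crossings[OF this] obtain b where b: "quad0 b" "chain t' k b" "ed b \<noteq> ed (n (n e))" by metis
      note fb = chain_facts[OF b(2)]
      have "xe (n (r b)) = ed b" using xe_rot[of b] fb by simp
      then have "ed ?x \<inter> ed b \<noteq> {}"
        using cross_adjacent[of "n ?x" "n (r b)"] F(11)[OF b(2)] ex xx fb D X by simp
      moreover have "?v \<notin> ed b" using F(9)[OF b(2)] edd by auto
      ultimately have "?q \<in> ed b" using vq by auto
      then have "ed b = ed (n (n e))"
        using ed_same[of b "n (n e)" ?u ?q] F(7)[OF b(2)] F(2) ec dest_ne[of "n (n e)"] fb D by auto
      then show False using b by simp
    qed
    then show ?thesis using tx vq by simp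
  next
    assume qx: "demanded_quad ?x"
    then have X: "n (n (n (n ?x))) = ?x" "\<not> rl (n ?x)" "\<not> rl (n (n ?x))" "\<not> rl (n (n (n ?x)))"
      "demanded (n ?x)" "demanded (n (n ?x))" by (auto simp: demanded_quad_def)
    then have x3: "n (n (n ?x)) = r e" by simp
    from X obtain t1 i1 t2 j1 where ch: "chain t1 i1 (n ?x)" "chain t2 j1 (n (n ?x))" by (auto simp: demanded_def)
    note G = demanded_quad_facts[OF qx ch]
    have ex: "ed (n (n ?x)) = ed (n e)" using xe_next[of "n (n ?x)"] opp_cross[of e] x3 D X by simp
    have "dest (n (n ?x)) = ?w" using dest_straight[of "n (n ?x)"] x3 X D by simp
    then have eb': "ed (n e) = {dest ?x, ?w}" using ex G(2) ed_eq[of "n (n ?x)"] D by auto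
    have p: "dest ?x = dest (r (n e))"
      using eb eb' dest_ne[of "n e"] D by (auto simp: doubleton_eq_iff)
    then have edx: "ed ?x = {?v, dest (r (n e))}" using ed_eq[of ?x] xv D by auto
    have "i = 0"
    proof (rule ccontr)
      assume "i \<noteq> 0"
      then obtain k where "chain t (Suc k) (n e)" using t by (cases i) auto
      from chain_crossings[OF this] obtain b where b: "quad0 b" "chain t k b" "ed b \<noteq> ed (n e)" "n e = r (n (n b))" by metis
      have bD: "b \<in> D" "\<not> rl b" "n (n (n (n b))) = b" "\<not> rl (n (n (n b)))" using b(1) by (auto simp: quad0_def)
      have rd: "r (n e) = n (n b)" using b(4) by simp
      \<comment> \<open>The strips through \<open>n e\<close> and \<open>n (n ?x)\<close> lie on the
        two sides of the edge of \<open>e\<close>, so a transversal of one continues as a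
        transversal of the other and inherits the endpoints known for both.\<close>
      have st: "n (r (n (n (n b)))) = r (n (n ?x))"
        using rot4[of "r (n (n ?x))"] x3 X D rd by simp
      have jc: "\<exists>k'. j1 = Suc k'"
      proof (rule ccontr)
        assume "\<not> ?thesis"
        then have "tri1 t2" "n (n ?x) = r (n t2)" using ch(2) by (cases j1; auto elim: chain.cases)+
        then have "n (r (n (n (n b)))) = n t2" using st by simp
        then have "r (n (n (n b))) = t2" by simp
        moreover have "\<not> rl (r (n (n (n b))))" using bD by simp
        ultimately show False using \<open>tri1 t2\<close> by (simp add: tri1_def)
      qed
      then obtain k' where "chain t2 (Suc k') (n (n ?x))" using ch(2) by auto
      from chain_crossings[OF this] obtain b' where b': "quad0 b'" "chain t2 k' b'" "n (n ?x) = r (n (n b'))" by metis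
      have b'D: "b' \<in> D" "\<not> rl (n b')" using b'(1) by (auto simp: quad0_def)
      have "r (n (n (n b))) = n b'" using st b'(3) by simp
      then have "xe (r (n (n (n b)))) = ed b'" using xe_next[of b'] b'D by simp
      then have eqb: "ed b' = ed b" using opp_cross[of "n (n (n b))"] bD by simp
      have "dest (r (n e)) \<in> ed b" using G(7)[OF b'(2)] eqb p by simp
      then have "ed b = ed (n e)"
        using ed_same[of b "n e" ?w "dest (r (n e))"] F(6)[OF b(2)] eb dest_ne[of "n e"] bD D by auto
      then show False using b by simp
    qed
    then show ?thesis using qx edx by simp
  qed
qed

text \<open>The triangle and the second quadrilateral would abut along a common piece
  (\<open>xt\<close>). Then the edges of \<open>n e\<close> and \<open>n (n e)\<close> would cross
  both at a corner of the face of \<open>e\<close> and at a corner of the face of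
  \<open>n (r e)\<close>, against \<open>cross_once\<close>.\<close>

lemma not_both_bad:
  assumes e: "demanded_quad e" and x: "demanded_quad (n (r e))" and t: "tri1 (r (n (n (n e))))"
    and eq: "ed (n (n (r (n (n (n e)))))) = ed (n (r e))"
  shows False
proof -
  have D: "e \<in> D" "rl e" "\<not> rl (n e)" "\<not> rl (n (n e))" "\<not> rl (n (n (n e)))" "n (n (n (n e))) = e"
    using e by (auto simp: demanded_quad_def)
  let ?x = "n (r e)" let ?t = "r (n (n (n e)))"
  have X: "n (n (n (n ?x))) = ?x" "\<not> rl (n ?x)" "\<not> rl (n (n ?x))" using x by (auto simp: demanded_quad_def)
  then have x3: "n (n (n ?x)) = r e" by simp
  have T: "n (n (n ?t)) = ?t" "rl ?t" "\<not> rl (n ?t)" "\<not> rl (n (n ?t))" using t by (auto simp: tri1_def)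
  have xv: "dest (r ?x) = dest (r e)" using dest_head[of "r e"] D by simp
  have tv: "dest (n (n ?t)) = dest (r e)"
    using tri1_dest[OF t] dest_head[of "n (n (n e))"] D by simp
  have xt: "?x = r (n (n ?t))"
    by (rule real_unique) (use D T eq xv tv ed_r in auto)
  then have "r ?x = n (n ?t)" by (metis r_r)
  then have "xe (r ?x) = ed (n ?t)" using xe_next[of "n ?t"] T D by simp
  then have s: "ed (n ?x) = ed (n ?t)" using opp_cross[of ?x] X D by simp
  have c: "ed (n ?t) = ed (n (n e))"
    using ed_next[of ?t] xe_next[of "n (n e)"] T D by simp
  have ex: "ed (n (n ?x)) = ed (n e)" using xe_next[of "n (n ?x)"] opp_cross[of e] x3 D X by simp
  have "xe (n (n ?x)) = xe (r (n e))" using xe_next[of "n ?x"] opp_cross[of "n e"] s c X D by simp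
  then have "r (n e) = n (n ?x) \<or> r (n e) = n (r (n (r (n (n ?x)))))"
    using cross_once[of "n (n ?x)" "r (n e)"] ex D X ed_r[of "n e"] by simp
  moreover have "n (r (n (n (n ?x)))) = n e" using x3 by simp
  ultimately show False using straight_par[of "n (n ?x)"] x3 D X by simp
qed

text \<open>With chain length 0 the side \<open>d\<close> is the strip side of \<open>t\<close>
  itself and \<open>t\<close> does not forward tokens, so what \<open>enter_walk\<close> finds is
  delivered at \<open>d\<close>.\<close>

lemma right_token:
  assumes d: "chain t 0 d" "\<not> quad0 d" "chain t' j (n d)"
    and u: "\<And>k b. k < j \<Longrightarrow> chain t' k b \<Longrightarrow> dest (r t) \<in> ed b"
  shows "\<exists>z. \<not> rl z \<and> own z d"
proof -
  have t: "tri1 t" "d = r (n t)" using d(1) by (auto elim: chain.cases)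
  have "ewalk t t" using t d(2) by (auto intro: ewalk.intros)
  from enter_walk[OF this d(3) _ u] show ?thesis using t by simp
qed

text \<open>The mirror image of the map; it turns left-hand statements into right-hand ones.\<close>

definition mir :: "'d \<Rightarrow> 'd" where "mir d = r (inv n (r d))"

section \<open>Reflection of the map\<close>

lemma mir_r_n [simp]: "mir (r (n x)) = r x"
  unfolding mir_def using permutes_inverses(2)[OF n_perm] by simp

lemma n_r_mir [simp]: "n (r (mir x)) = r x"
  unfolding mir_def using permutes_inverses(1)[OF n_perm] by simp

lemma mir_perm: "mir permutes D"
proof -
  have "mir = r \<circ> inv n \<circ> r" by (auto simp: mir_def)
  then show ?thesis
    using n_perm r_perm by (metis permutes_compose permutes_inv)
qed

lemma mir_D [simp]: "mir x \<in> D \<longleftrightarrow> x \<in> D"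
  using mir_perm by (rule permutes_in_image)

lemma mir_opp: assumes "d \<in> D" "\<not> rl d" shows "mir (r (mir (r d))) = n (r (n (r d)))"
proof -
  have "mir (r (mir (r (n (r (n (r (n (r (n (r d))))))))))) = n (r (n (r d)))" by simp
  then show ?thesis using rot4[OF assms] by simp
qed

lemma rl_mir: "d \<in> D \<Longrightarrow> rl (mir d) \<longleftrightarrow> rl (r d)"
  using rl_n[of "r (mir d)"] by simp

text \<open>Reflection inverts the rotation at every point but keeps opposite darts opposite, so
  every axiom about edges and crossings is inherited.\<close>

lemma mirror: "planar_map D mir r rl ed xe dest par"
proof
  show "mir permutes D" by (rule mir_perm)
  show "mir d \<noteq> r d" if "d \<in> D" for d
  proof
    assume "mir d = r d"
    then have "n d = r d" using n_r_mir[of d] by simp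
    then show False using n_ne_r that by simp
  qed
  show "dest (r (mir d)) = dest d" if "d \<in> D" "rl (r d)" for d
    using dest_head[of "r (mir d)"] that rl_mir[of d] by simp
  show "mir (r (mir (r (mir (r (mir (r d))))))) = d" if "d \<in> D" "\<not> rl d" for d
    using mir_opp[OF that] mir_opp[of "n (r (n (r d)))"] rot4[OF that] that by simp
  show "ed (mir (r d)) = xe d" if "d \<in> D" "\<not> rl d" for d
    using xe_next[of "r (mir (r d))"] that ed_r by simp
  show "xe (mir (r d)) = ed d" if "d \<in> D" "\<not> rl d" for d
    using opp_cross[of "r (mir (r d))"] that by simp
  have st: "mir (r (mir d)) = n (r (n d))" if "d \<in> D" "\<not> rl (r d)" for d
    using mir_opp[of "r d"] that by simp
  show "dest (mir (r (mir d))) = dest d" if "d \<in> D" "\<not> rl (r d)" for d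
    using dest_straight[of d] that st by simp
  show "par d < par (r d) \<longleftrightarrow> par (mir (r (mir d))) < par (r (mir (r (mir d))))"
    if "d \<in> D" "\<not> rl (r d)" for d
    using par_straight[of d] that st by simp
  show "par (mir (r (mir (r d)))) = par d" if "d \<in> D" "\<not> rl d" for d
    using par_opp[of d] that mir_opp by simp
  show "d' = d \<or> d' = mir (r (mir (r d)))"
    if "d \<in> D" "d' \<in> D" "\<not> rl d" "\<not> rl d'" "ed d = ed d'" "xe d = xe d'" for d d'
    using cross_once[OF that] mir_opp that by simp
qed ((rule finD r_perm r_r rl_mir ed_r ed_eq dest_ne real_unique par_ne cross_disjoint cross_adjacent; assumption)+)

context
begin

interpretation m: planar_map D mir r rl ed xe dest par
  by (rule mirror)

lemma m_quad0: "m.quad0 x \<longleftrightarrow> quad0 (r x)"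
proof
  assume q: "m.quad0 x"
  then have D: "x \<in> D" "mir (mir (mir (mir x))) = x" by (auto simp: m.quad0_def)
  have "n (r x) = r (mir (mir (mir x)))" using n_r_mir[of "mir (mir (mir x))"] D by simp
  then show "quad0 (r x)" using q by (auto simp: quad0_def m.quad0_def simp del: rl_r rl_rot m.rl_rot)
next
  assume q: "quad0 (r x)"
  let ?y = "r x"
  have D: "?y \<in> D" "n (n (n (n ?y))) = ?y" using q by (auto simp: quad0_def)
  have "mir x = r (n (n (n ?y)))" using mir_r_n[of "n (n (n ?y))"] D by simp
  then show "m.quad0 x" using q D by (auto simp: quad0_def m.quad0_def)
qed

lemma m_tri1_turn:
  assumes "m.tri1 t" shows "n (n (r t)) = r (mir t)" "r (mir (mir t)) = n (r t)"
proof -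
  have "mir (mir (mir t)) = t" using assms by (auto simp: m.tri1_def)
  then have "n (r t) = r (mir (mir t))" using n_r_mir[of "mir (mir t)"] by simp
  then show "n (n (r t)) = r (mir t)" "r (mir (mir t)) = n (r t)" by simp_all
qed

text \<open>A face of the mirror image is an old face with all darts reversed and read backwards.
  Its dart leaving the vertex is the reversal of the one that entered it, whence the shift to
  \<open>n (r t)\<close>.\<close>

lemma m_tri1: "m.tri1 t \<longleftrightarrow> tri1 (n (r t))"
proof
  assume t: "m.tri1 t"
  then show "tri1 (n (r t))" using m_tri1_turn[OF t] by (auto simp: tri1_def m.tri1_def simp del: rl_r m.rl_rot)
next
  assume t: "tri1 (n (r t))"
  let ?T = "n (r t)"
  have D: "t \<in> D" "n (n (n ?T)) = ?T" using t by (auto simp: tri1_def)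
  then have "n (n ?T) = r t" by simp
  then have 1: "mir t = r (n ?T)" using mir_r_n[of "n ?T"] by simp
  then have "mir (mir t) = r ?T" by simp
  then show "m.tri1 t" using t D 1 by (auto simp: tri1_def m.tri1_def)
qed

lemma m_chain: "m.chain t i b \<Longrightarrow> chain (n (r t)) i (r b)"
proof (induction rule: m.chain.induct)
  case (chain_0 t)
  then show ?case using chain.chain_0[of "n (r t)"] m_tri1[of t] m_tri1_turn[of t] by simp
next
  case (chain_Suc t i b)
  then have "mir (mir (mir (mir b))) = b" by (auto simp: m.quad0_def)
  then have "n (n (r b)) = r (mir (mir b))" using n_r_mir[of "mir (mir (mir b))"] by simp
  then show ?case using chain.chain_Suc[OF chain_Suc.IH] m_quad0[of b] chain_Suc(2) by simp
qed

lemma chain_m: "chain t i b \<Longrightarrow> m.chain (mir (r t)) i (r b)"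
proof (induction rule: chain.induct)
  case (chain_0 t)
  have t3: "n (n (n t)) = t" using chain_0 by (auto simp: tri1_def)
  have "mir (r t) = r (n (n t))" using mir_r_n[of "n (n t)"] t3 by simp
  then show ?case using m.chain.chain_0[of "mir (r t)"] m_tri1[of "mir (r t)"] chain_0 t3 by simp
next
  case (chain_Suc t i b)
  then have "n (n (n (n b))) = b" by (auto simp: quad0_def)
  then have "mir (mir (r b)) = r (n (n b))" using mir_r_n[of "n (n (n b))"] by simp
  then show ?case using m.chain.chain_Suc[OF chain_Suc.IH] m_quad0[of "r b"] chain_Suc(2) by simp
qed

lemma m_demanded: "m.demanded d \<longleftrightarrow> demanded (r d)"
  unfolding m.demanded_def demanded_def m_quad0 using m_chain[of _ _ d] chain_m[of _ _ "r d"] by (metis r_r)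

lemma m_demanded_quad: "m.demanded_quad e \<longleftrightarrow> demanded_quad (n (r e))"
proof
  assume q: "m.demanded_quad e"
  then have D: "e \<in> D" "mir (mir (mir (mir e))) = e" by (auto simp: m.demanded_quad_def)
  have "n (r e) = r (mir (mir (mir e)))" using n_r_mir[of "mir (mir (mir e))"] D by simp
  then show "demanded_quad (n (r e))" using q unfolding demanded_quad_def m.demanded_quad_def m_demanded by (auto simp del: rl_r m.rl_rot)
next
  assume q: "demanded_quad (n (r e))"
  let ?y = "n (r e)"
  have D: "?y \<in> D" "n (n (n (n ?y))) = ?y" using q by (auto simp: demanded_quad_def)
  then have "n (n (n ?y)) = r e" by simp
  then have 1: "mir e = r (n (n ?y))" using mir_r_n[of "n (n ?y)"] by simp
  then have 2: "mir (mir e) = r (n ?y)" "mir (mir (mir e)) = r ?y" by simp_all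
  show "m.demanded_quad e" using q D 1 2 unfolding demanded_quad_def m.demanded_quad_def m_demanded by auto
qed

lemma m_orbit: "y \<in> orbit mir d \<longleftrightarrow> r y \<in> orbit n (r d)"
proof
  assume "y \<in> orbit mir d"
  then show "r y \<in> orbit n (r d)"
  proof induction
    case base
    show ?case using orbit_sym[OF in_orbit(1)[of "r (mir d)"]] in_orbit(3)[of "r (mir d)"] by simp
  next
    case (step y)
    have "r (mir y) \<in> orbit n (r y)"
      using orbit_sym[OF in_orbit(1)[of "r (mir y)"]] in_orbit(3)[of "r (mir y)"] by simp
    then show ?case using orbit_sym[OF step.IH] by simp
  qed
next
  have "r y \<in> orbit mir (r d)" if "y \<in> orbit n d" for y d
    using that
  proof induction
    case base
    show ?case using m.orbit_sym[OF m.in_orbit(1)[of "r (n d)"]] m.in_orbit(3)[of "r (n d)"] by simp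
  next
    case (step y)
    have "r (n y) \<in> orbit mir (r y)"
      using m.orbit_sym[OF m.in_orbit(1)[of "r (n y)"]] m.in_orbit(3)[of "r (n y)"] by simp
    then show ?case using m.orbit_sym[OF step.IH] by simp
  qed
  from this[of "r y" "r d"] show "r y \<in> orbit n (r d) \<Longrightarrow> y \<in> orbit mir d" by simp
qed

lemma m_giver: assumes "d \<in> D" shows "m.giver d \<longleftrightarrow> giver (r d)"
proof -
  have D: "x \<in> D" if "x \<in> orbit mir d" for x
    using that permutes_orbit_subset[OF mir_perm assms] by blast
  have 1: "n (r x) \<in> orbit n (r d)" if "x \<in> orbit mir d" for x
    using that m_orbit orbit.step by metis
  have 2: "\<exists>x. x \<in> orbit mir d \<and> y = n (r x)" if "y \<in> orbit n (r d)" for y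
    using orbit.step[of "r y" mir d] m_orbit[of "r y" d] that by (intro exI[of _ "mir (r y)"]) simp
  have "(\<exists>x\<in>orbit mir d. rl x) \<longleftrightarrow> (\<exists>x\<in>orbit n (r d). rl x)"
    using 1 2 D by (metis rl_rot)
  moreover have "(\<forall>x\<in>orbit mir d. \<not> m.tri1 x \<and> \<not> m.demanded_quad x) \<longleftrightarrow> (\<forall>x\<in>orbit n (r d). \<not> tri1 x \<and> \<not> demanded_quad x)"
    unfolding m_tri1 m_demanded_quad using 1 2 by metis
  ultimately show ?thesis unfolding giver_def m.giver_def by simp
qed

lemma m_token: "m.token d \<longleftrightarrow> token (r d)"
  unfolding token_def m.token_def using m_giver[of d] rl_mir[of d] by auto

lemma m_ewalk: "m.ewalk t t' \<Longrightarrow> lwalk (n (r t)) (n (r t'))"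
proof (induction rule: m.ewalk.induct)
  case (1 t)
  then show ?case
    using lwalk.intros(1)[of "n (r t)"] m_tri1[of t] m_tri1_turn[of t] m_quad0[of "r (mir t)"] by simp
next
  case (2 t t')
  then show ?case
    using lwalk.intros(2)[of "n (r t)"] m_tri1[of t] m_tri1_turn[of t] m_quad0[of "r (mir t)"] by simp
qed

lemma m_own_enter: assumes "m.own z x" "\<not> rl z" shows "own (r z) (r x)"
  using assms(1)
proof cases
  case own_quad
  then show ?thesis using own.own_quad[of "r z"] m_token[of z] m_demanded_quad[of "r z"] m_demanded_quad[of "mir (r z)"] by auto
next
  case (own_enter t)
  have t: "m.tri1 t" using own_enter m.ewalk_tri1 by blast
  have "rl (r z)" using own_enter rl_mir[of z] by (auto simp: m.token_def)
  then show ?thesis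
    using own.own_leave[of "r z" "n (r t)"] own_enter m_token[of z] m_ewalk[of "r z" t] m_tri1_turn[OF t] by simp
qed (use assms in auto)

lemma left_token:
  assumes d: "chain t' 0 (n d)" "\<not> quad0 (n d)" "chain t j d"
    and u: "\<And>k b. k < j \<Longrightarrow> chain t k b \<Longrightarrow> dest (r t') \<in> ed b"
  shows "\<exists>z. rl z \<and> own z (n d)"
proof -
  have t': "tri1 t'" using chain_tri1[OF d(1)] .
  then have tD: "t' \<in> D" "rl t'" by (auto simp: tri1_def)
  have de: "dest (r (mir (r t'))) = dest (r t')"
    using m.dest_head[of "r t'"] tD by simp
  have "\<exists>z. \<not> rl z \<and> m.own z (r (n d))"
  proof (rule m.right_token)
    show "m.chain (mir (r t')) 0 (r (n d))" using chain_m[OF d(1)] .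
    show "\<not> m.quad0 (r (n d))" using d(2) m_quad0 by simp
    show "m.chain (mir (r t)) j (mir (r (n d)))" using chain_m[OF d(3)] by simp
    show "dest (r (mir (r t'))) \<in> ed b" if "k < j" "m.chain (mir (r t)) k b" for k b
    proof -
      have "chain t k (r b)" using m_chain[OF that(2)] by simp
      then show ?thesis using u[OF that(1)] de ed_r[of b] chain_facts[of t k "r b"] by auto
    qed
  qed
  then obtain z where z: "\<not> rl z" "m.own z (r (n d))" by blast
  have "z \<in> D" "rl z \<noteq> rl (mir z)" using m.own_token[OF z(2)] by (auto simp: m.token_def)
  then have "rl (r z)" using z(1) rl_mir[of z] by auto
  then show ?thesis using m_own_enter[OF z(2,1)] by (intro exI[of _ "r z"]) simp
qed

lemma m_demanded_quad_transfer:
  assumes e: "demanded_quad e"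
  shows "m.demanded_quad (r (n (n (n e))))" "mir (r (n (n (n e)))) = r (n (n e))" "mir (r (n (n e))) = r (n e)"
    "mir (r (n e)) = r e" "mir (r e) = r (n (n (n e)))"
proof -
  have q: "n (n (n (n e))) = e" using e by (auto simp: demanded_quad_def)
  show "m.demanded_quad (r (n (n (n e))))" unfolding m_demanded_quad using e q by simp
  show "mir (r e) = r (n (n (n e)))" using mir_r_n[of "n (n (n e))"] q by simp
qed simp_all

text \<open>This is \<open>bad_left\<close> in the mirror image, where the two chains exchange their
  roles.\<close>

lemma bad_right:
  assumes e: "demanded_quad e" and t: "chain t i (n e)" and t': "chain t' j (n (n e))"
    and nt: "\<not> token (r (n (n (n e))))"
  shows "tri1 (r (n (n (n e)))) \<and> i = 0 \<and> ed (n (n (r (n (n (n e)))))) = {dest (r e), dest (r (n e))} \<or> j = 0"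
proof -
  let ?e = "r (n (n (n e)))"
  note T = m_demanded_quad_transfer[OF e]
  have D: "e \<in> D" "rl e" "n (n (n (n e))) = e" using e by (auto simp: demanded_quad_def)
  have "m.chain (mir (r t')) j (mir ?e)" "m.chain (mir (r t)) i (mir (mir ?e))"
    using chain_m[OF t] chain_m[OF t'] T by simp_all
  moreover have rre: "r ?e = n (n (n e))" by simp
  then have "\<not> m.token (r ?e)" using m_token[of "r ?e"] nt by simp
  ultimately have *: "m.tri1 (mir (r ?e)) \<and> i = 0 \<and> ed (mir (r ?e)) = {dest (r ?e), dest (mir (mir ?e))} \<or> j = 0"
    using m.bad_left[OF T(1)] by blast
  have 1: "m.tri1 (mir (r ?e)) \<longleftrightarrow> tri1 ?e" using m_tri1[of "mir (r ?e)"] by simp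
  have 2: "ed (mir (r ?e)) = ed (n (n ?e))" if "tri1 ?e"
  proof -
    have "mir (r ?e) = r (n (n ?e))" using that by (metis mir_r_n tri1_def)
    then show ?thesis using ed_r[of "n (n ?e)"] D by simp
  qed
  have 3: "dest (r ?e) = dest (r e)" using dest_head[of "n (n (n e))"] D by simp
  show ?thesis using * 1 2 3 T by auto
qed

text \<open>If both sides at the vertex lacked a token, \<open>bad_left\<close> and
  \<open>bad_right\<close> would leave only the configuration excluded by
  \<open>not_both_bad\<close>.\<close>

lemma one_good:
  assumes e: "demanded_quad e" and t: "chain t 0 (n e)" and t': "chain t' (Suc j) (n (n e))"
  shows "token (r e) \<or> token (r (n (n (n e))))"
  using bad_left[OF e t t'] bad_right[OF e t t'] not_both_bad[OF e] by (auto simp: insert_commute)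

end

context
begin

interpretation m: planar_map D mir r rl ed xe dest par
  by (rule mirror)

lemma some_good:
  assumes e: "demanded_quad e" and t: "chain t i (n e)" and t': "chain t' j (n (n e))" and ne: "i \<noteq> 0 \<or> j \<noteq> 0"
  shows "token (r e) \<or> token (r (n (n (n e))))"
proof (cases "i = 0")
  case True
  then show ?thesis using one_good[OF e] t t' ne by (cases j) auto
next
  case i: False
  show ?thesis
  proof (cases "j = 0")
    case True
    let ?e = "r (n (n (n e)))"
    note T = m_demanded_quad_transfer[OF e]
    obtain k where "i = Suc k" using i by (cases i) auto
    then have "m.chain (mir (r t')) 0 (mir ?e)" "m.chain (mir (r t)) (Suc k) (mir (mir ?e))"
      using chain_m[OF t] chain_m[OF t'] T True by simp_all
    then have "m.token (r ?e) \<or> m.token (r (mir (mir (mir ?e))))" by (rule m.one_good[OF T(1)])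
    then show ?thesis unfolding m_token using T by auto
  next
    case False
    then show ?thesis using bad_left[OF e t t'] i by auto
  qed
qed

end

text \<open>A chain of length 0 brings a token to the side where it ends. If exactly one chain is
  that short, \<open>some_good\<close> supplies the second token at the vertex; if none is, both
  sides at the vertex carry one.\<close>

lemma two_tokens:
  assumes e: "demanded_quad e"
  shows "\<exists>y z x x'. own y x \<and> own z x' \<and> y \<noteq> z \<and> x \<in> orbit n e \<and> x' \<in> orbit n e"
proof -
  have D: "e \<in> D" "rl e" "\<not> rl (n e)" "\<not> rl (n (n e))" "\<not> rl (n (n (n e)))" "n (n (n (n e))) = e"
    "demanded (n e)" "demanded (n (n e))"
    using e by (auto simp: demanded_quad_def)
  then obtain t i t' j where ch: "chain t i (n e)" "chain t' j (n (n e))" "\<not> quad0 (n e)" "\<not> quad0 (n (n e))"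
    by (auto simp: demanded_def)
  note F = demanded_quad_facts[OF e ch(1,2)]
  note orb = orbit_demanded_quad[OF e]
  have ne: "n e \<noteq> n (n e)" "n e \<noteq> e" "n e \<noteq> n (n (n e))" "e \<noteq> n (n e)" "n (n e) \<noteq> n (n (n e))" "e \<noteq> n (n (n e))"
    using D n_ne[of e] n_ne[of "n e"] n_n_ne[of e] by auto
  have L: "own (r e) e" if "token (r e)" using own_quad[OF that] e by simp
  have R: "own (r (n (n (n e)))) (n (n (n e)))" if "token (r (n (n (n e))))"
    using own_quad[OF that] e D by simp
  have A: "\<exists>z. own z (n e)" if "i = 0"
    using right_token[of t "n e" t' j] ch that F(1,7) by auto
  have B: "\<exists>z. own z (n (n e))" if "j = 0"
    using left_token[of t' "n e" t i] ch that F(3,6) by auto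
  have "\<exists>y z x x'. own y x \<and> own z x' \<and> x \<noteq> x' \<and> x \<in> orbit n e \<and> x' \<in> orbit n e"
  proof -
    consider "i = 0" "j = 0" | "i = 0" "j \<noteq> 0" | "i \<noteq> 0" "j = 0" | "i \<noteq> 0" "j \<noteq> 0" by blast
    then show ?thesis
    proof cases
      case 1 then show ?thesis using A B ne unfolding orb by blast
    next
      case 2 then show ?thesis using A some_good[OF e ch(1,2)] L R ne unfolding orb by blast
    next
      case 3 then show ?thesis using B some_good[OF e ch(1,2)] L R ne unfolding orb by blast
    next
      case 4
      have "token (r e)" using bad_left[OF e ch(1,2)] 4 by auto
      moreover have "token (r (n (n (n e))))" using bad_right[OF e ch(1,2)] 4 by auto
      ultimately show ?thesis using L R ne unfolding orb by blast
    qed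
  qed
  then show ?thesis using own_fun by metis
qed

section \<open>Weights and the balance of every face\<close>

definition weight :: "'d \<Rightarrow> int" where
  "weight d = 10 + (if rl d then 6 else 0) - (if demanded d then 4 else 0) - (if token d then 1 else 0)
     + int (card {z. own z d})"

lemma finite_orbit_n: "d \<in> D \<Longrightarrow> finite (orbit n d)" "d \<in> D \<Longrightarrow> orbit n d \<subseteq> D"
  using permutes_orbit_subset[OF n_perm, of d] finite_subset[OF _ finD, of "orbit n d"] by auto

lemma finite_own: "finite {z. own z d}"
  by (rule finite_subset[OF _ finD]) (use own_token in \<open>auto simp: token_def\<close>)

lemma orbit_size:
  assumes "d \<in> D"
  shows "(n ^^ card (orbit n d)) d = d"
proof -
  have d: "d \<in> orbit n d" by (rule in_orbit)
  let ?k = "funpow_dist1 n d d"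
  have "orbit n d = (\<lambda>i. (n ^^ i) d) ` {0..<?k}" "inj_on (\<lambda>i. (n ^^ i) d) {0..<?k}"
    using d by (rule orbit_conv_funpow_dist1, rule inj_on_funpow_dist1)
  then have "card (orbit n d) = ?k" by (simp add: card_image)
  then show ?thesis using funpow_dist1_prop[OF d] by simp
qed

lemma orbit_size_ge3: assumes "d \<in> D" shows "card (orbit n d) \<ge> 3"
proof -
  have "card {d, n d, n (n d)} = 3"
    using n_ne[of d] n_ne[of "n d"] n_n_ne[of d] assms by (simp add: card_insert_if)
  moreover have "{d, n d, n (n d)} \<subseteq> orbit n d" using in_orbit by auto
  ultimately show ?thesis using card_mono[OF finite_orbit_n(1)[OF assms]] by metis
qed

lemma orbit_reindex: "bij_betw n (orbit n d) (orbit n d)"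
proof -
  have "n ` orbit n d = orbit n d"
  proof
    show "n ` orbit n d \<subseteq> orbit n d" by (auto intro: orbit.step)
    show "orbit n d \<subseteq> n ` orbit n d"
    proof
      fix y assume "y \<in> orbit n d"
      then show "y \<in> n ` orbit n d" by cases (use in_orbit in auto)
    qed
  qed
  then show ?thesis by (auto simp: bij_betw_def inj_on_def)
qed

lemma card_orbit_shift: "card {x \<in> orbit n d. Q (n x)} = card {x \<in> orbit n d. Q x}"
proof -
  have "n ` {x \<in> orbit n d. Q (n x)} = {x \<in> orbit n d. Q x}"
    using orbit_reindex[of d] unfolding bij_betw_def by auto
  then show ?thesis by (metis (no_types, lifting) card_image inj_on_def n_eq)
qed

lemma face_tri1: assumes "tri1 t" shows "(\<Sum>x\<in>orbit n t. weight x) \<ge> 36"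
proof -
  have t: "t \<in> D" "rl t" "n (n (n t)) = t" "\<not> rl (n t)" "\<not> rl (n (n t))" using assms by (auto simp: tri1_def)
  have ntok: "\<not> token x" if "x \<in> orbit n t" for x
    using that orbit_sym[OF that] in_orbit(3)[of t] assms by (auto simp: token_def giver_def)
  have "\<not> demanded (n t)" using chain_not_triangle[of _ _ "n t"] t by (auto simp: demanded_def)
  moreover have "\<not> demanded t" "\<not> demanded (n (n t))" using demanded_D t by fastforce+
  ultimately have "weight t \<ge> 16" "weight (n t) \<ge> 10" "weight (n (n t)) \<ge> 10"
    using ntok t in_orbit by (auto simp: weight_def)
  then show ?thesis using n_ne[of t] n_ne[of "n t"] n_n_ne[of t] t
    unfolding orbit_tri1[OF assms] by auto
qed

text \<open>The face holds 46 and pays 8; \<open>two_tokens\<close> supplies the missing two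
  units.\<close>

lemma face_demanded_quad: assumes "demanded_quad e" shows "(\<Sum>x\<in>orbit n e. weight x) \<ge> 40"
proof -
  have e: "e \<in> D" "rl e" "\<not> rl (n e)" "\<not> rl (n (n e))" "\<not> rl (n (n (n e)))" "n (n (n (n e))) = e"
    using assms by (auto simp: demanded_quad_def)
  let ?P = "orbit n e"
  have fP: "finite ?P" using finite_orbit_n e by blast
  have ntok: "\<not> token x" if "x \<in> ?P" for x
    using that orbit_sym[OF that] in_orbit(3)[of e] assms by (auto simp: token_def giver_def)
  obtain y z x x' where yz: "own y x" "own z x'" "y \<noteq> z" "x \<in> ?P" "x' \<in> ?P"
    using two_tokens[OF assms] by blast
  define g where "g x = 10 + (if rl x then 6 else 0) - (if demanded x then 4 else 0 :: int)" for x
  have "(\<Sum>x\<in>?P. weight x) = (\<Sum>x\<in>?P. g x) + int (\<Sum>x\<in>?P. card {z. own z x})"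
    unfolding of_nat_sum sum.distrib[symmetric] by (rule sum.cong) (auto simp: weight_def g_def ntok)
  moreover have "(\<Sum>x\<in>?P. card {z. own z x}) = card (\<Union>x\<in>?P. {z. own z x})"
    by (rule card_UN_disjoint[symmetric]) (use fP finite_own own_fun in auto)
  moreover have "card {y, z} \<le> card (\<Union>x\<in>?P. {z. own z x})"
    by (rule card_mono) (use fP finite_own yz in auto)
  moreover have "card {y, z} = 2" using yz by simp
  moreover have "(\<Sum>x\<in>?P. g x) \<ge> 38"
  proof -
    have "\<not> demanded e" "\<not> demanded (n (n (n e)))" using demanded_D e by fastforce+
    then show ?thesis unfolding orbit_demanded_quad[OF assms]
      using n_ne[of e] n_ne[of "n e"] n_ne[of "n (n e)"] n_ne[of "n (n (n e))"] n_n_ne[of e] n_n_ne[of "n e"] e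
      by (auto simp: g_def)
  qed
  ultimately show ?thesis by linarith
qed

text \<open>Sides are classified by which of their ends are real. Two vertices, or one vertex and at
  least five sides, suffice after all payments; a quadrilateral with one vertex meets at most one
  demand here. Faces with darts in \<open>I\<close> have at least three vertices, which leaves 8 per
  such dart.\<close>

lemma face_real:
  assumes d: "d \<in> D" and P: "P = orbit n d" and v: "v \<in> P" "rl v"
    and no: "\<And>x. x \<in> P \<Longrightarrow> \<not> tri1 x \<and> \<not> demanded_quad x"
    and I: "\<And>i. i \<in> I \<Longrightarrow> rl i \<and> rl (n i) \<and> n i \<notin> I" "\<And>i. i \<in> D \<Longrightarrow> n i \<in> I \<Longrightarrow> rl i"
  shows "(\<Sum>x\<in>P. weight x) \<ge> 40 + 8 * int (card (P \<inter> I))"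
proof -
  have fP: "finite P" and PD: "P \<subseteq> D" using finite_orbit_n d P by auto
  have PP: "P = orbit n x" if "x \<in> P" for x using P orbit_sym[of x d] that by simp
  have cl: "n x \<in> P" if "x \<in> P" for x using P that by (simp add: orbit.step)
  let ?V = "{x \<in> P. rl x}" let ?A = "{x \<in> P. rl x \<and> \<not> rl (n x)}" let ?B = "{x \<in> P. \<not> rl x \<and> rl (n x)}"
  let ?C = "{x \<in> P. \<not> rl x \<and> \<not> rl (n x)}" let ?C' = "{x \<in> P. \<not> rl x \<and> \<not> rl (n x) \<and> \<not> demanded x}"
  \<comment> \<open>Adding the sides with two real ends to either set gives the darts with real
    origin or with real head, and these are equally many along a closed face.\<close>
  have AB: "card ?A = card ?B"
  proof -
    let ?W = "{x \<in> P. rl x \<and> rl (n x)}"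
    have "card (?A \<union> ?W) = card ?A + card ?W" "card (?B \<union> ?W) = card ?B + card ?W"
      by (rule card_Un_disjoint; use fP in force)+
    moreover have "?A \<union> ?W = ?V" "?B \<union> ?W = {x \<in> P. rl (n x)}" by auto
    ultimately show ?thesis using card_orbit_shift[of d rl] P by simp
  qed
  have cP: "card P = card ?V + card ?B + card ?C"
  proof -
    have "P = ?V \<union> (?B \<union> ?C)" by auto
    then have "card P = card ?V + card (?B \<union> ?C)"
      using fP card_Un_disjoint[of ?V "?B \<union> ?C"] by auto
    then show ?thesis using fP card_Un_disjoint[of ?B ?C] by auto
  qed
  \<comment> \<open>A vertex counts 16; a side with one real end may give a token, hence -1 and 9; a
    side between crossings keeps 6, or 10 if not demanded. As \<open>?A\<close> and
    \<open>?B\<close> have equal size, each pair of sides yields 8.\<close>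
  have sumg: "(\<Sum>x\<in>P. weight x) \<ge> 16 * int (card ?V) + 8 * int (card ?A) + 6 * int (card ?C) + 4 * int (card ?C')"
  proof -
    have ind: "(\<Sum>x\<in>P. if Q x then c else 0) = c * int (card {x \<in> P. Q x})" for Q and c :: int
      using fP by (simp add: sum.If_cases Int_def mult.commute)
    have "(\<Sum>x\<in>P. weight x) \<ge> (\<Sum>x\<in>P. (if rl x then 16 else 0) + (if rl x \<and> \<not> rl (n x) then -1 else 0)
       + (if \<not> rl x \<and> rl (n x) then 9 else 0) + (if \<not> rl x \<and> \<not> rl (n x) then 6 else 0)
       + (if \<not> rl x \<and> \<not> rl (n x) \<and> \<not> demanded x then 4 else (0::int)))"
    proof (rule sum_mono)
      fix x assume "x \<in> P"
      then have "token x \<Longrightarrow> rl x \<noteq> rl (n x)" "demanded x \<Longrightarrow> \<not> rl x \<and> \<not> rl (n x)"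
        using demanded_D by (auto simp: token_def)
      then show "(if rl x then 16 else 0) + (if rl x \<and> \<not> rl (n x) then -1 else 0)
       + (if \<not> rl x \<and> rl (n x) then 9 else 0) + (if \<not> rl x \<and> \<not> rl (n x) then 6 else 0)
       + (if \<not> rl x \<and> \<not> rl (n x) \<and> \<not> demanded x then 4 else (0::int)) \<le> weight x"
        unfolding weight_def by (cases "rl x"; cases "rl (n x)"; cases "demanded x"; cases "token x"; simp)
    qed
    then show ?thesis unfolding sum.distrib ind using AB by simp
  qed
  let ?J = "P \<inter> I"
  \<comment> \<open>Every dart of \<open>I\<close> is followed by a real dart outside
    \<open>I\<close>.\<close>
  have J2: "2 * card ?J \<le> card ?V"
  proof -
    have "card (n ` ?J) = card ?J" by (rule card_image) (simp add: inj_on_def)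
    moreover have "card (?J \<union> n ` ?J) \<le> card ?V"
      by (rule card_mono) (use fP I cl in auto)
    moreover have "card (?J \<union> n ` ?J) = card ?J + card (n ` ?J)"
      by (rule card_Un_disjoint) (use fP I in auto)
    ultimately show ?thesis by simp
  qed
  have J3: "card ?V \<ge> 3" if Jne: "?J \<noteq> {}"
  proof -
    obtain i where i: "i \<in> P" "i \<in> I" using Jne by auto
    obtain m where m: "m \<in> P" "n m = i" using orbit_reindex[of d] i P unfolding bij_betw_def by (metis imageE)
    have "card {m, i, n i} = 3"
      using n_ne[of m] n_ne[of i] n_n_ne[of m] m PD by (auto simp: card_insert_if)
    moreover have "{m, i, n i} \<subseteq> ?V" using m i I cl PD by auto
    ultimately show ?thesis using card_mono[of ?V "{m, i, n i}"] fP by simp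
  qed
  have v1: "card ?V \<ge> 1" using v fP by (simp add: Suc_le_eq card_gt_0_iff) blast
  have c3: "card P \<ge> 3" using orbit_size_ge3 d P by simp
  show ?thesis
  proof (cases "card ?A = 0")
    case True
    then have A0: "?A = {}" using fP by simp
    have "orbit n v \<subseteq> ?V"
    proof
      fix y assume "y \<in> orbit n v"
      then show "y \<in> ?V" by induction (use A0 v cl in auto)
    qed
    then have "?V = P" using PP[OF v(1)] by auto
    then have "card ?V \<ge> 3" using c3 by simp
    then have "40 + 8 * card ?J \<le> 16 * card ?V" using J2 by presburger
    then show ?thesis using sumg by linarith
  next
    case a: False
    show ?thesis
    proof (cases "card ?V \<ge> 2")
      case True
      show ?thesis
      proof (cases "?J = {}")
        case False
        then show ?thesis using J3 J2 sumg a by linarith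
      next
        case J: True
        then show ?thesis using True sumg a by simp
      qed
    next
      case False
      then have V1: "card ?V = 1" using v1 by simp
      then have J: "?J = {}" using J3 by fastforce
      obtain y where y: "?V = {y}" using V1 card_1_singletonE by blast
      have "v \<in> {y}" unfolding y[symmetric] using v by simp
      then have Vv: "?V = {v}" using y by simp
      have Vset: "x = v" if "x \<in> P" "rl x" for x
      proof -
        have "x \<in> {v}" unfolding Vv[symmetric] using that by simp
        then show ?thesis by simp
      qed
      have A1: "card ?A = 1"
      proof -
        have "card ?A \<le> card ?V" by (rule card_mono) (use fP in auto)
        then show ?thesis using a V1 by linarith
      qed
      have vD: "v \<in> D" using v PD by auto
      have nv: "n v \<in> P" "n (n v) \<in> P" "n (n (n v)) \<in> P" using v cl by auto
      have nr: "\<not> rl (n v)" "\<not> rl (n (n v))"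
        using Vset[OF nv(1)] Vset[OF nv(2)] n_ne[OF vD] n_n_ne[OF vD] by auto
      have k: "(n ^^ card P) v = v" using orbit_size[OF vD] PP[OF v(1)] by simp
      have "card P \<noteq> 3"
      proof
        assume "card P = 3"
        then have "n (n (n v)) = v" using k by (simp add: eval_nat_numeral)
        then show False using no[OF v(1)] nr v vD by (simp add: tri1_def)
      qed
      moreover have ?thesis if c4: "card P = 4"
      proof -
        have q: "n (n (n (n v))) = v" using k c4 by (simp add: eval_nat_numeral)
        have "n (n (n v)) \<noteq> v" using q n_ne[OF vD] by metis
        then have "\<not> rl (n (n (n v)))" using Vset[OF nv(3)] by auto
        then have "\<not> demanded (n v) \<or> \<not> demanded (n (n v))" using no[OF v(1)] nr q v vD by (simp add: demanded_quad_def)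
        then have "?C' \<noteq> {}" using nv nr \<open>\<not> rl (n (n (n v)))\<close> by auto
        then have "card ?C' \<ge> 1" using fP by (simp add: Suc_le_eq card_gt_0_iff)
        moreover have "card ?C = 2" using cP AB A1 V1 c4 by simp
        ultimately show ?thesis using sumg A1 V1 J by simp
      qed
      moreover have ?thesis if "card P \<ge> 5"
      proof -
        have "card ?C \<ge> 3" using cP AB A1 V1 that by simp
        then show ?thesis using sumg A1 V1 J by simp
      qed
      ultimately show ?thesis using c3 by linarith
    qed
  qed
qed

text \<open>Three sides are excluded by \<open>no_tri0\<close>, four sides only forward demands, and
  from seven sides on 6 per side is enough. Six sides with at most five demands keep 60 - 20.
  Otherwise all chains are direct, and then tokens arrive.\<close>

lemma face_unreal:
  assumes d: "d \<in> D" and P: "P = orbit n d" and no: "\<And>x. x \<in> P \<Longrightarrow> \<not> rl x"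
  shows "(\<Sum>x\<in>P. weight x) \<ge> 40"
proof -
  have fP: "finite P" and PD: "P \<subseteq> D" using finite_orbit_n d P by auto
  have PP: "P = orbit n x" if "x \<in> P" for x using P orbit_sym[of x d] that by simp
  have cl: "n x \<in> P" if "x \<in> P" for x using P that by (simp add: orbit.step)
  have dP: "d \<in> P" using P in_orbit by simp
  let ?S = "{x \<in> P. demanded x}" and ?Q = "{x \<in> P. demanded x \<and> demanded (n x)}"
  define h where "h x = card {z. own z x}" for x
  have eq: "(\<Sum>x\<in>P. weight x) = 10 * int (card P) - 4 * int (card ?S) + int (\<Sum>x\<in>P. h x)"
  proof -
    have "(\<Sum>x\<in>P. weight x) = (\<Sum>x\<in>P. 10 - (if demanded x then 4 else 0) + int (h x))"
      by (rule sum.cong) (use no cl in \<open>auto simp: weight_def h_def token_def\<close>)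
    then show ?thesis using fP by (simp add: sum.distrib sum_subtractf sum.If_cases Int_def)
  qed
  have SP: "card ?S \<le> card P" using fP by (simp add: card_mono)
  have k: "(n ^^ card P) x = x" if "x \<in> P" for x using orbit_size[of x] PP[OF that] that PD by auto
  have c3: "card P \<ge> 3" using orbit_size_ge3 d P by simp
  \<comment> \<open>Each pair of consecutive demanded sides receives two tokens, an entering one at
    the first side and a leaving one at the second; the split by \<open>rl z\<close> prevents double
    counting. There are at least \<open>2 * card ?S - card P\<close> such pairs.\<close>
  have all0: "4 * card ?S \<le> (\<Sum>x\<in>P. h x) + 2 * card P"
    if ch0: "\<And>x t i. x \<in> P \<Longrightarrow> chain t i x \<Longrightarrow> i = 0"
  proof -
    have tk: "(\<exists>z. \<not> rl z \<and> own z x) \<and> (\<exists>z. rl z \<and> own z (n x))" if x: "x \<in> ?Q" for x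
    proof -
      obtain t t' i j where t: "chain t i x" "chain t' j (n x)" "\<not> quad0 x" "\<not> quad0 (n x)"
        using x by (auto simp: demanded_def)
      then have "i = 0" "j = 0" using ch0 x cl by auto
      then show ?thesis using right_token[of t x t' 0] left_token[of t' x t 0] t by auto
    qed
    define h1 where "h1 x = card {z. \<not> rl z \<and> own z x}" for x
    define h2 where "h2 x = card {z. rl z \<and> own z x}" for x
    have fo: "finite {z. \<not> rl z \<and> own z x}" "finite {z. rl z \<and> own z x}" for x
      by (rule finite_subset[OF _ finite_own[of x]]; auto)+
    have hh: "h x = h1 x + h2 x" for x
    proof -
      have 1: "{z. own z x} = {z. \<not> rl z \<and> own z x} \<union> {z. rl z \<and> own z x}" by auto
      have "card ({z. \<not> rl z \<and> own z x} \<union> {z. rl z \<and> own z x}) = h1 x + h2 x"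
        unfolding h1_def h2_def by (rule card_Un_disjoint[OF fo]) auto
      then show ?thesis unfolding h_def using arg_cong[OF 1, of card] by (rule trans[rotated])
    qed
    have c: "card ?Q = (\<Sum>x\<in>P. if demanded x \<and> demanded (n x) then 1 else 0)"
      using fP by (simp add: sum.If_cases Int_def)
    have 1: "card ?Q \<le> (\<Sum>x\<in>P. h1 x)"
      unfolding c by (rule sum_mono) (use tk fo in \<open>fastforce simp: h1_def Suc_le_eq card_gt_0_iff\<close>)
    have "(\<Sum>x\<in>P. h2 x) = (\<Sum>x\<in>P. h2 (n x))"
      using sum.reindex_bij_betw[OF orbit_reindex[of d], of h2] P by simp
    moreover have "card ?Q \<le> (\<Sum>x\<in>P. h2 (n x))"
      unfolding c by (rule sum_mono) (use tk fo in \<open>fastforce simp: h2_def Suc_le_eq card_gt_0_iff\<close>)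
    ultimately have 2: "2 * card ?Q \<le> (\<Sum>x\<in>P. h x)" using 1 by (simp add: hh sum.distrib)
    have "card ?S = card {x \<in> P. demanded (n x)}" using card_orbit_shift[of d demanded] P by simp
    moreover have "card ?S + card {x \<in> P. demanded (n x)} = card (?S \<union> {x \<in> P. demanded (n x)}) + card (?S \<inter> {x \<in> P. demanded (n x)})"
      using fP by (intro card_Un_Int) auto
    moreover have "card (?S \<inter> {x \<in> P. demanded (n x)}) = card ?Q"
      by (rule arg_cong[where f = card]) auto
    moreover have "card (?S \<union> {x \<in> P. demanded (n x)}) \<le> card P" using fP by (intro card_mono) auto
    ultimately show ?thesis using 2 by linarith
  qed
  consider "card P = 3" | "card P = 4" | "card P = 5" | "card P = 6" | "card P \<ge> 7" using c3 by linarith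
  then show ?thesis
  proof cases
    case 1
    then have "n (n (n d)) = d" using k[OF dP] by (simp add: eval_nat_numeral)
    then show ?thesis using no_tri0[OF d] no dP cl by blast
  next
    case 2
    have "quad0 x" if "x \<in> P" for x
      using k[OF that] no cl that PD by (auto simp: quad0_def 2 eval_nat_numeral)
    then have "?S = {}" by (auto simp: demanded_def)
    then have "card ?S = 0" by (metis card.empty)
    then show ?thesis using eq 2 by linarith
  next
    case 3
    have z: "i = 0" if "x \<in> P" "chain t i x" for x t i
    proof (rule pentagon_chain_0[OF _ _ _ _ _ _ _ that(2)])
      show "n (n (n (n (n x)))) = x" using k[OF that(1)] 3 by (simp add: eval_nat_numeral)
    qed (use no cl PD that in auto)
    have "4 * card ?S \<le> (\<Sum>x\<in>P. h x) + 2 * card P" by (rule all0) (rule z)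
    then show ?thesis using eq 3 by linarith
  next
    case 4
    show ?thesis
    proof (cases "?S = P")
      case True
      have it: "(n ^^ j) x \<in> P" if "x \<in> P" for x j using that cl by (induction j) auto
      have z: "i = 0" if "x \<in> P" "chain t i x" for x t i
      proof (rule hexagon_chain_0[OF _ _ _ that(2)])
        show "n (n (n (n (n (n x))))) = x" using k[OF that(1)] 4 by (simp add: eval_nat_numeral)
        show "demanded ((n ^^ j) x)" for j using it[OF that(1)] True by blast
      qed (use PD that in auto)
      have "4 * card ?S \<le> (\<Sum>x\<in>P. h x) + 2 * card P" by (rule all0) (rule z)
      moreover have "card ?S = card P" using True by metis
      ultimately show ?thesis using eq 4 by linarith
    next
      case False
      then have "card ?S < card P" using fP by (intro psubset_card_mono) auto
      then show ?thesis using eq 4 by linarith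
    qed
  next
    case 5
    then show ?thesis using eq SP by linarith
  qed
qed

text \<open>
  The set I marks the darts leaving a vertex all of whose edges are uncrossed.
\<close>

theorem charge_bound:
  assumes I: "I \<subseteq> D" "\<And>i. i \<in> I \<Longrightarrow> rl i \<and> rl (n i) \<and> n i \<notin> I" "\<And>i. i \<in> D \<Longrightarrow> n i \<in> I \<Longrightarrow> rl i"
  shows "40 * card (orbs n D) + 8 * card I \<le> 10 * card D + 6 * card {d \<in> D. rl d}"
proof -
  let ?F = "orbs n D"
  have fF: "finite ?F" by (simp add: orbs_def finD)
  \<comment> \<open>A triangle may fall short by 4; the demand it places makes up for this in the
    total.\<close>
  have face: "(\<Sum>x\<in>P. weight x) \<ge> 40 + 8 * int (card (P \<inter> I)) - 4 * int (card {x \<in> P. tri1 x})" if PF: "P \<in> ?F" for P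
  proof -
    obtain d where d: "d \<in> D" "P = orbit n d" using PF by (auto simp: orbs_def)
    have dP: "x \<in> P \<Longrightarrow> P = orbit n x" for x using d orbit_sym by simp
    have fP: "finite P" using finite_orbit_n d by simp
    consider t where "t \<in> P" "tri1 t" | e where "e \<in> P" "demanded_quad e" "\<And>x. x \<in> P \<Longrightarrow> \<not> tri1 x"
      | v where "v \<in> P" "rl v" "\<And>x. x \<in> P \<Longrightarrow> \<not> tri1 x \<and> \<not> demanded_quad x"
      | "\<And>x. x \<in> P \<Longrightarrow> \<not> rl x" "\<And>x. x \<in> P \<Longrightarrow> \<not> tri1 x" using tri1_def by blast
    then show ?thesis
    proof cases
      case (1 t)
      have "P \<inter> I = {}" using I orbit_tri1[OF 1(2)] dP[OF 1(1)] 1(2) by (auto simp: tri1_def)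
      moreover have "x = t" if "x \<in> P" "tri1 x" for x
        by (rule tri1_real[OF 1(2), of x d]) (use 1(1) d that in \<open>auto simp: tri1_def\<close>)
      then have "{x \<in> P. tri1 x} = {t}" using 1 by blast
      ultimately show ?thesis using face_tri1[OF 1(2)] dP[OF 1(1)] by simp
    next
      case (2 e)
      have "P \<inter> I = {}" using I orbit_demanded_quad[OF 2(2)] dP[OF 2(1)] 2(2) by (auto simp: demanded_quad_def)
      then show ?thesis using face_demanded_quad[OF 2(2)] dP[OF 2(1)] 2(3) by simp
    next
      case (3 v)
      then show ?thesis using face_real[OF d 3(1,2,3) I(2,3)] by simp
    next
      case 4
      have "P \<inter> I = {}" using I 4 by auto
      then show ?thesis using face_unreal[OF d 4(1)] 4(2) by simp
    qed
  qed
  have cnt: "(\<Sum>P\<in>?F. card (P \<inter> X)) = card X" if "X \<subseteq> D" for X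
  proof -
    have "card X = (\<Sum>d\<in>D. if d \<in> X then 1 else 0)"
      using finD that by (simp add: sum.If_cases Int_absorb1)
    also have "\<dots> = (\<Sum>P\<in>?F. \<Sum>d\<in>P. if d \<in> X then 1 else 0)" by (rule sum_orbs[OF finD n_perm])
    also have "\<dots> = (\<Sum>P\<in>?F. card (P \<inter> X))"
    proof (rule sum.cong)
      fix P assume "P \<in> ?F"
      then have "finite P" using finite_orbit_n by (auto simp: orbs_def)
      then show "(\<Sum>d\<in>P. if d \<in> X then 1 else 0) = card (P \<inter> X)" by (simp add: sum.If_cases)
    qed simp
    finally show ?thesis by simp
  qed
  let ?T = "{t \<in> D. tri1 t}"
  have "(\<Sum>P\<in>?F. card {x \<in> P. tri1 x}) = (\<Sum>P\<in>?F. card (P \<inter> ?T))"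
  proof (rule sum.cong)
    fix P assume "P \<in> ?F"
    then have "P \<subseteq> D" using finite_orbit_n by (auto simp: orbs_def)
    then have "{x \<in> P. tri1 x} = P \<inter> ?T" by auto
    then show "card {x \<in> P. tri1 x} = card (P \<inter> ?T)" by simp
  qed simp
  then have T: "(\<Sum>P\<in>?F. card {x \<in> P. tri1 x}) = card ?T" using cnt[of ?T] by simp
  have "(\<Sum>d\<in>D. weight d) = (\<Sum>P\<in>?F. \<Sum>x\<in>P. weight x)" by (rule sum_orbs[OF finD n_perm])
  also have "\<dots> \<ge> (\<Sum>P\<in>?F. 40 + 8 * int (card (P \<inter> I)) - 4 * int (card {x \<in> P. tri1 x}))"
    by (rule sum_mono) (rule face)
  also have "(\<Sum>P\<in>?F. 40 + 8 * int (card (P \<inter> I)) - 4 * int (card {x \<in> P. tri1 x}))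
      = 40 * int (card ?F) + 8 * int (card I) - 4 * int (card ?T)"
    unfolding T[symmetric] cnt[OF I(1), symmetric]
    by (simp add: sum.distrib sum_subtractf sum_distrib_left)
  finally have lower: "40 * int (card ?F) + 8 * int (card I) - 4 * int (card ?T) \<le> (\<Sum>d\<in>D. weight d)" .
  have "(\<Sum>d\<in>D. weight d) = 10 * int (card D) + 6 * int (card {d \<in> D. rl d}) - 4 * int (card {d \<in> D. demanded d})
      - int (card {d \<in> D. token d}) + int (\<Sum>d\<in>D. card {z. own z d})"
    using finD by (simp add: weight_def sum.distrib sum_subtractf sum.If_cases Int_def)
  moreover have "(\<Sum>d\<in>D. card {z. own z d}) \<le> card {d \<in> D. token d}"
  proof -
    have "(\<Sum>d\<in>D. card {z. own z d}) = card (\<Union>d\<in>D. {z. own z d})"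
      by (rule card_UN_disjoint[symmetric]) (use finD finite_own own_fun in auto)
    also have "\<dots> \<le> card {d \<in> D. token d}"
      by (rule card_mono) (use finD own_token in \<open>auto simp: token_def\<close>)
    finally show ?thesis .
  qed
  \<comment> \<open>The chain of each triangle ends at a demanded side of its own, so the amounts
    taken by demands cover all deficits.\<close>
  moreover have "card ?T \<le> card {d \<in> D. demanded d}"
  proof -
    have "\<exists>b. \<exists>i. chain t i b \<and> \<not> quad0 b" if "tri1 t" for t using chain_end[OF that] by blast
    then obtain f where f: "\<And>t. tri1 t \<Longrightarrow> \<exists>i. chain t i (f t) \<and> \<not> quad0 (f t)" by metis
    have "inj_on f ?T" using f chain_unique by (intro inj_onI) (metis mem_Collect_eq)
    moreover have "f ` ?T \<subseteq> {d \<in> D. demanded d}" using f demanded_D unfolding demanded_def by blast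
    moreover have "finite {d \<in> D. demanded d}" using finD by simp
    ultimately show ?thesis by (rule card_inj_on_le)
  qed
  ultimately have "40 * int (card ?F) + 8 * int (card I) \<le> 10 * int (card D) + 6 * int (card {d \<in> D. rl d})"
    using lower by linarith
  then show ?thesis by linarith
qed

end

section \<open>Removal of touching points\<close>

text \<open>
  Here two edges may also touch at an inner point, so the continuation opp d of a dart on its own
  edge need not be opposite to d in the rotation.
\<close>

locale touch_map =
  fixes D :: "'d set" and n r opp :: "'d \<Rightarrow> 'd" and rl :: "'d \<Rightarrow> bool"
    and ed xe :: "'d \<Rightarrow> 'v set" and dest :: "'d \<Rightarrow> 'v" and par :: "'d \<Rightarrow> real"
  assumes finD: "finite D"
    and n_perm: "n permutes D" and r_perm: "r permutes D"
    and r_r [simp]: "r (r d) = d"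
    and rl_rot: "d \<in> D \<Longrightarrow> rl (n (r d)) \<longleftrightarrow> rl d"
    and rot_ne: "d \<in> D \<Longrightarrow> n (r d) \<noteq> d"
    and ed_r: "d \<in> D \<Longrightarrow> ed (r d) = ed d"
    and ed_eq: "d \<in> D \<Longrightarrow> ed d = {dest d, dest (r d)}"
    and dest_ne: "d \<in> D \<Longrightarrow> dest d \<noteq> dest (r d)"
    and dest_rot: "d \<in> D \<Longrightarrow> rl d \<Longrightarrow> dest (r (n (r d))) = dest (r d)"
    and real_unique: "\<lbrakk>d \<in> D; d' \<in> D; rl d; rl d'; ed d = ed d'; dest (r d) = dest (r d')\<rbrakk> \<Longrightarrow> d = d'"
    and rot4: "d \<in> D \<Longrightarrow> \<not> rl d \<Longrightarrow> n (r (n (r (n (r (n (r d))))))) = d"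
    and rot_distinct: "d \<in> D \<Longrightarrow> \<not> rl d \<Longrightarrow> n (r (n (r d))) \<noteq> d"
    and opp_rot: "d \<in> D \<Longrightarrow> \<not> rl d \<Longrightarrow> opp d \<in> {n (r d), n (r (n (r d))), n (r (n (r (n (r d)))))}"
    and opp_opp: "d \<in> D \<Longrightarrow> \<not> rl d \<Longrightarrow> opp (opp d) = d"
    and ed_opp: "d \<in> D \<Longrightarrow> \<not> rl d \<Longrightarrow> ed (opp d) = ed d \<and> xe (opp d) = xe d"
    and ed_other: "\<lbrakk>d \<in> D; \<not> rl d; y \<in> {n (r d), n (r (n (r d))), n (r (n (r (n (r d)))))}; y \<noteq> opp d\<rbrakk>
       \<Longrightarrow> ed y = xe d \<and> xe y = ed d"
    and dest_opp: "d \<in> D \<Longrightarrow> \<not> rl d \<Longrightarrow> dest (opp d) = dest (r d)"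
    and par_ne: "d \<in> D \<Longrightarrow> par d \<noteq> par (r d)"
    and par_opp: "d \<in> D \<Longrightarrow> \<not> rl d \<Longrightarrow> par (opp d) = par d"
    and par_straight: "d \<in> D \<Longrightarrow> \<not> rl d \<Longrightarrow> par (r d) < par d \<longleftrightarrow> par (opp d) < par (r (opp d))"
    and cross_disjoint: "d \<in> D \<Longrightarrow> \<not> rl d \<Longrightarrow> ed d \<inter> xe d = {}"
    and cross_once: "\<lbrakk>d \<in> D; d' \<in> D; \<not> rl d; \<not> rl d'; ed d = ed d'; xe d = xe d'\<rbrakk>
          \<Longrightarrow> d' = d \<or> d' = opp d"
    and cross_adjacent: "\<lbrakk>d \<in> D; d' \<in> D; \<not> rl d; \<not> rl d'; ed d = ed d'\<rbrakk> \<Longrightarrow> xe d \<inter> xe d' \<noteq> {}"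
begin

lemma n_D [simp]: "n d \<in> D \<longleftrightarrow> d \<in> D"
  using n_perm by (rule permutes_in_image)

lemma r_D [simp]: "r d \<in> D \<longleftrightarrow> d \<in> D"
  using r_perm by (rule permutes_in_image)

lemma n_eq [simp]: "n x = n y \<longleftrightarrow> x = y"
  using permutes_inj[OF n_perm] by (auto dest: injD)

lemma r_eq [simp]: "r x = r y \<longleftrightarrow> x = y"
  by (metis r_r)

lemma opp_D: "d \<in> D \<Longrightarrow> \<not> rl d \<Longrightarrow> opp d \<in> D \<and> \<not> rl (opp d)"
  using opp_rot[of d] rl_rot by fastforce

lemma planar_if_no_touch:
  assumes nt: "\<And>d. d \<in> D \<Longrightarrow> \<not> rl d \<Longrightarrow> opp d = n (r (n (r d)))"
  shows "planar_map D n r rl ed xe dest par"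
proof
  have ne: "n (r d) \<noteq> opp d" if "d \<in> D" "\<not> rl d" for d
    using nt[OF that] rot_ne[of "n (r d)"] that by auto
  have eo: "ed (n (r d)) = xe d \<and> xe (n (r d)) = ed d" if "d \<in> D" "\<not> rl d" for d
    by (rule ed_other[OF that _ ne[OF that]]) simp
  have R: "rl (r d) \<longleftrightarrow> rl (n d)" if "d \<in> D" for d using rl_rot[of "r d"] that by simp
  show "rl (n d) \<longleftrightarrow> rl (r d)" if "d \<in> D" for d using R that by simp
  show "n d \<noteq> r d" if "d \<in> D" for d using rot_ne[of "r d"] that by simp
  show "dest (r (n d)) = dest d" if "d \<in> D" "rl (r d)" for d using dest_rot[of "r d"] that by simp
  show "ed (n (r d)) = xe d" "xe (n (r d)) = ed d" if "d \<in> D" "\<not> rl d" for d using eo[OF that] by auto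
  show "dest (n (r (n d))) = dest d" if "d \<in> D" "\<not> rl (r d)" for d
    using dest_opp[of "r d"] nt[of "r d"] that by simp
  show "par (n (r (n (r d)))) = par d" if "d \<in> D" "\<not> rl d" for d
    using par_opp[OF that] nt[OF that] by simp
  show "par d < par (r d) \<longleftrightarrow> par (n (r (n d))) < par (r (n (r (n d))))" if "d \<in> D" "\<not> rl (r d)" for d
    using par_straight[of "r d"] nt[of "r d"] that by simp
  show "d' = d \<or> d' = n (r (n (r d)))"
    if "d \<in> D" "d' \<in> D" "\<not> rl d" "\<not> rl d'" "ed d = ed d'" "xe d = xe d'" for d d'
    using cross_once[OF that] nt[OF that(1,3)] by simp
qed ((rule finD n_perm r_perm r_r ed_r ed_eq dest_ne real_unique rot4 par_ne cross_disjoint cross_adjacent; assumption)+)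

text \<open>
  At a touching point the four darts are two neighbouring pairs; merging the two pieces of each
  edge removes four darts and at most one face.
\<close>

lemma untouch:
  assumes d1: "d1 \<in> D" "\<not> rl d1" "opp d1 = n (r d1)"
  shows "\<exists>D' n' r'. touch_map D' n' r' opp rl ed xe dest par \<and> D' \<subseteq> D \<and> card D = card D' + 4 \<and>
     (\<forall>d\<in>D. rl d \<longrightarrow> d \<in> D') \<and> card (orbs n D) \<le> card (orbs n' D') + 1 \<and>
     (\<forall>d\<in>D'. dest (r' d) = dest (r d) \<and> (rl (r d) \<longrightarrow> r' d = r d))"
proof -
  let ?s = "\<lambda>x. n (r x)"
  define o2 where "o2 = ?s d1"
  define o3 where "o3 = ?s o2"
  define o4 where "o4 = ?s o3"
  have s4: "?s o4 = d1" using rot4[OF d1(1,2)] by (simp add: o2_def o3_def o4_def)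
  have sq: "?s d1 = o2" "?s o2 = o3" "?s o3 = o4" "?s o4 = d1"
    using s4 by (simp_all add: o2_def o3_def o4_def)
  have oD: "d1 \<in> D" "o2 \<in> D" "o3 \<in> D" "o4 \<in> D" using d1 by (auto simp: o2_def o3_def o4_def)
  have orl: "\<not> rl d1" "\<not> rl o2" "\<not> rl o3" "\<not> rl o4"
    using d1 rl_rot by (auto simp: o2_def o3_def o4_def)
  have dist: "d1 \<noteq> o2" "o2 \<noteq> o3" "o3 \<noteq> o4" "o4 \<noteq> d1" "d1 \<noteq> o3" "o2 \<noteq> o4"
    using rot_ne[OF oD(1)] rot_ne[OF oD(2)] rot_ne[OF oD(3)] rot_ne[OF oD(4)] s4
      rot_distinct[OF oD(1) orl(1)] rot_distinct[OF oD(2) orl(2)]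
    unfolding o2_def[symmetric] o3_def[symmetric] o4_def[symmetric] by auto
  have op1: "opp d1 = o2" using d1 by (simp add: o2_def)
  then have op2: "opp o2 = d1" using opp_opp[OF d1(1,2)] by simp
  have op3: "opp o3 = o4"
  proof -
    have "opp o3 \<in> {o4, d1, o2}"
      using opp_rot[OF oD(3) orl(3)] s4 unfolding o4_def[symmetric] by (auto simp: o2_def)
    then show ?thesis using op1 op2 opp_opp[OF oD(3) orl(3)] dist by auto
  qed
  then have op4: "opp o4 = o3" using opp_opp[OF oD(3) orl(3)] by simp
  define Q where "Q = {d1, o2, o3, o4}"
  have OD: "q \<in> D" "\<not> rl q" "opp q \<in> Q" "?s q \<in> Q" if "q \<in> Q" for q
  proof -
    have "q = d1 \<or> q = o2 \<or> q = o3 \<or> q = o4" using that by (simp add: Q_def)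
    then show "q \<in> D" "\<not> rl q" "opp q \<in> Q" "?s q \<in> Q"
      using oD orl by (elim disjE; simp add: op1 op2 op3 op4 sq Q_def)+
  qed
  have cO: "card Q = 4" using dist by (simp add: Q_def)
  have sO: "y \<in> Q" if "?s y \<in> Q" for y
  proof -
    from that consider "?s y = ?s o4" | "?s y = ?s d1" | "?s y = ?s o2" | "?s y = ?s o3"
      unfolding sq Q_def by blast
    then show ?thesis by cases (auto simp: Q_def)
  qed
  have rO: "r q \<notin> Q" if "q \<in> Q" for q
  proof
    assume ro: "r q \<in> Q"
    note q = OD[OF that]
    have "r q \<noteq> q" using par_ne[OF q(1)] by metis
    moreover have "r q \<noteq> opp q" using par_ne[OF q(1)] par_opp[OF q(1,2)] by metis
    moreover have "y = q \<or> y \<in> {?s q, ?s (?s q), ?s (?s (?s q))}" if "y \<in> Q" for y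
    proof -
      have "q = d1 \<or> q = o2 \<or> q = o3 \<or> q = o4" using \<open>q \<in> Q\<close> by (simp add: Q_def)
      moreover have "y = d1 \<or> y = o2 \<or> y = o3 \<or> y = o4" using that by (simp add: Q_def)
      ultimately show ?thesis by (elim disjE) (simp_all add: sq)
    qed
    ultimately have "ed (r q) = xe q" using ed_other[OF q(1,2), of "r q"] ro by auto
    then show False using ed_r[OF q(1)] cross_disjoint[OF q(1,2)] ed_eq[OF q(1)] by auto
  qed
  define D' where "D' = D - Q"
  \<comment> \<open>A reversal that would start at the deleted point runs on along the same edge to
    the next point.\<close>
  define r' where "r' x = (if x \<in> Q then x else if r x \<in> Q then r (opp (r x)) else r x)" for x
  \<comment> \<open>Chosen so that \<open>n' (r' x) = n (r x)\<close> off \<open>Q\<close>: the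
    rotation at all other points is unchanged.\<close>
  define n' where "n' x = (if x \<in> Q then x else if r x \<in> Q then n (opp (r x)) else n x)" for x
  have nO: "n x \<in> Q \<Longrightarrow> r x \<in> Q" for x using sO[of "r x"] by simp
  have oo: "opp (opp q) = q" if "q \<in> Q" for q using opp_opp OD[OF that] by simp
  have r'D: "r' x \<in> D'" if "x \<in> D'" for x
  proof (cases "r x \<in> Q")
    case True
    then have "opp (r x) \<in> Q" using OD by blast
    then show ?thesis using that True rO OD by (auto simp: r'_def D'_def)
  qed (use that in \<open>auto simp: r'_def D'_def\<close>)
  have r'r': "r' (r' x) = x" for x
  proof (cases "x \<in> Q \<or> r x \<notin> Q")
    case True
    then show ?thesis by (auto simp: r'_def)
  next
    case False
    then have "opp (r x) \<in> Q" using OD by blast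
    moreover have "r (opp (r x)) \<notin> Q" using rO calculation by blast
    ultimately show ?thesis using False oo by (auto simp: r'_def)
  qed
  have s': "n' (r' x) = ?s x" if "x \<notin> Q" for x
  proof (cases "r x \<in> Q")
    case True
    then have "opp (r x) \<in> Q" using OD by blast
    moreover have "r (opp (r x)) \<notin> Q" using rO calculation by blast
    ultimately show ?thesis using True oo that by (auto simp: r'_def n'_def)
  next
    case False
    then show ?thesis using that by (simp add: r'_def n'_def)
  qed
  have r'out: "r' x = x" if "x \<notin> D'" for x
  proof (cases "x \<in> Q")
    case False
    then have "x \<notin> D" using that by (simp add: D'_def)
    then show ?thesis using False OD r_D r_perm by (auto simp: r'_def permutes_def)
  qed (simp add: r'_def)
  have r'perm: "r' permutes D'"
    by (rule bij_imp_permutes[OF bij_betw_byWitness[where f' = r']]) (use r'r' r'D r'out in auto)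
  have n'eq: "n' x = ?s (r' x)" if "x \<in> D'" for x
    using s'[of "r' x"] r'D[OF that] r'r'[of x] by (simp add: D'_def)
  have sD: "?s x \<in> D'" if "x \<in> D'" for x using that sO by (auto simp: D'_def)
  have n'perm: "n' permutes D'"
  proof (rule bij_imp_permutes)
    have "inj_on n' D'"
    proof
      fix x y assume "x \<in> D'" "y \<in> D'" "n' x = n' y"
      then have "r' x = r' y" using n'eq by simp
      then show "x = y" using r'r' by metis
    qed
    moreover have "n' ` D' \<subseteq> D'" using n'eq sD r'D by auto
    ultimately show "bij_betw n' D' D'"
      by (simp add: D'_def finD bij_betw_def endo_inj_surj)
    show "n' x = x" if "x \<notin> D'" for x
    proof (cases "x \<in> Q")
      case False
      then have "x \<notin> D" using that by (simp add: D'_def)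
      moreover from this have "r x \<notin> Q" using OD(1)[of "r x"] by auto
      ultimately show ?thesis using False n_perm by (auto simp: n'_def permutes_def)
    qed (simp add: n'_def)
  qed
  have dr: "dest (r' x) = dest (r x)" if "x \<in> D'" for x
  proof (cases "r x \<in> Q")
    case True
    note q = OD[OF True]
    have "dest (r (opp (r x))) = dest (opp (opp (r x)))" using dest_opp OD[OF q(3)] by metis
    then show ?thesis using True oo[OF True] that by (simp add: r'_def D'_def)
  qed (use that in \<open>auto simp: r'_def D'_def\<close>)
  have up: "par x \<noteq> par (r' x) \<and> (par x < par (r' x) \<longleftrightarrow> par x < par (r x))" if "x \<in> D'" for x
  proof (cases "r x \<in> Q")
    case True
    note q = OD[OF True]
    have "par x < par (r x) \<longleftrightarrow> par (r x) < par (r (opp (r x)))"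
      using par_straight[OF q(1,2)] par_opp[OF q(1,2)] by simp
    moreover have "par (r x) \<noteq> par (r (opp (r x)))"
      using par_ne[OF OD(1)[OF q(3)]] par_opp[OF q(1,2)] by simp
    moreover have "par x \<noteq> par (r x)" using par_ne[OF q(1)] by simp
    ultimately have "par x \<noteq> par (r (opp (r x))) \<and> (par x < par (r (opp (r x))) \<longleftrightarrow> par x < par (r x))" by linarith
    then show ?thesis using True that by (simp add: r'_def D'_def)
  qed (use that par_ne in \<open>auto simp: r'_def D'_def\<close>)
  have D'D: "x \<in> D" "x \<notin> Q" if "x \<in> D'" for x using that by (auto simp: D'_def)
  have oppD': "opp x \<in> D'" if "x \<in> D'" "\<not> rl x" for x
    using opp_D[OF D'D(1)[OF that(1)] that(2)] D'D[OF that(1)] OD(3)[of "opp x"] opp_opp[OF D'D(1)[OF that(1)] that(2)]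
    by (auto simp: D'_def)
  have ss: "n' (r' x) = ?s x" if "x \<in> D'" for x using s' D'D(2)[OF that] .
  have "touch_map D' n' r' opp rl ed xe dest par"
  proof
    show "finite D'" using finD by (simp add: D'_def)
    show "rl (n' (r' d)) \<longleftrightarrow> rl d" if "d \<in> D'" for d using ss[OF that] rl_rot D'D(1)[OF that] by simp
    show "n' (r' d) \<noteq> d" if "d \<in> D'" for d using ss[OF that] rot_ne D'D(1)[OF that] by simp
    show "ed (r' d) = ed d" if "d \<in> D'" for d
    proof (cases "r d \<in> Q")
      case True
      have "ed (r (opp (r d))) = ed d"
        using ed_r[OF OD(1)[OF OD(3)[OF True]]] ed_opp[OF OD(1,2)[OF True]] ed_r[OF D'D(1)[OF that]] by simp
      then show ?thesis using True D'D(2)[OF that] by (simp add: r'_def)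
    next
      case False
      then show ?thesis using ed_r[OF D'D(1)[OF that]] D'D(2)[OF that] by (simp add: r'_def)
    qed
    show "ed d = {dest d, dest (r' d)}" "dest d \<noteq> dest (r' d)" if "d \<in> D'" for d
      using dr[OF that] ed_eq dest_ne D'D(1)[OF that] by auto
    show "dest (r' (n' (r' d))) = dest (r' d)" if "d \<in> D'" "rl d" for d
      using dr[OF that(1)] dr[OF sD[OF that(1)]] ss[OF that(1)] dest_rot[OF D'D(1)[OF that(1)] that(2)] by simp
    show "d = d'" if "d \<in> D'" "d' \<in> D'" "rl d" "rl d'" "ed d = ed d'" "dest (r' d) = dest (r' d')" for d d'
      using real_unique D'D that dr by simp
    have s3: "n' (r' (n' (r' d))) = ?s (?s d)" "n' (r' (n' (r' (n' (r' d))))) = ?s (?s (?s d))"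
      "n' (r' (n' (r' (n' (r' (n' (r' d))))))) = ?s (?s (?s (?s d)))" if "d \<in> D'" for d
      using ss[OF that] ss[OF sD[OF that]] ss[OF sD[OF sD[OF that]]] ss[OF sD[OF sD[OF sD[OF that]]]] by simp_all
    show "n' (r' (n' (r' (n' (r' (n' (r' d))))))) = d" if "d \<in> D'" "\<not> rl d" for d
      using s3[OF that(1)] rot4 D'D(1)[OF that(1)] that by simp
    show "n' (r' (n' (r' d))) \<noteq> d" if "d \<in> D'" "\<not> rl d" for d
      using s3[OF that(1)] rot_distinct D'D(1)[OF that(1)] that by simp
    show "opp d \<in> {n' (r' d), n' (r' (n' (r' d))), n' (r' (n' (r' (n' (r' d)))))}" if "d \<in> D'" "\<not> rl d" for d
      using s3[OF that(1)] ss[OF that(1)] opp_rot D'D(1)[OF that(1)] that by simp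
    show "ed y = xe d \<and> xe y = ed d"
      if "d \<in> D'" "\<not> rl d" "y \<in> {n' (r' d), n' (r' (n' (r' d))), n' (r' (n' (r' (n' (r' d)))))}" "y \<noteq> opp d" for d y
      using s3[OF that(1)] ss[OF that(1)] ed_other[OF D'D(1)[OF that(1)] that(2) _ that(4)] that by simp
    show "dest (opp d) = dest (r' d)" if "d \<in> D'" "\<not> rl d" for d
      using dest_opp dr that D'D by simp
    show "par d \<noteq> par (r' d)" if "d \<in> D'" for d using up[OF that] by simp
    show "par (r' d) < par d \<longleftrightarrow> par (opp d) < par (r' (opp d))" if "d \<in> D'" "\<not> rl d" for d
      using up[OF that(1)] up[OF oppD'[OF that]] par_straight[OF D'D(1)[OF that(1)] that(2)]
        par_ne[OF D'D(1)[OF that(1)]] by linarith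
  qed (rule n'perm r'perm r'r' opp_opp ed_opp par_opp cross_disjoint cross_once cross_adjacent;
      (assumption | erule D'D(1))+)+
  moreover have "card D = card D' + 4"
    using card_Diff_subset[of Q D] OD(1) finD cO card_mono[of D Q] by (auto simp: D'_def Q_def)
  moreover have "\<forall>d\<in>D. rl d \<longrightarrow> d \<in> D'" using OD(2) by (auto simp: D'_def)
  moreover have "\<forall>d\<in>D'. dest (r' d) = dest (r d) \<and> (rl (r d) \<longrightarrow> r' d = r d)"
    using dr OD(2) D'D(2) by (auto simp: r'_def)
  moreover have "card (orbs n D) \<le> card (orbs n' D') + 1"
  proof -
    \<comment> \<open>Exchanging the values at \<open>r o2\<close> and \<open>r o4\<close> splits
      the point into two points of degree two, with rotations \<open>d1\<close>, \<open>o2\<close>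
      and \<open>o3\<close>, \<open>o4\<close>. This costs at most one face; suppressing points of
      degree two then costs none.\<close>
    let ?m = "n \<circ> Transposition.transpose (r o2) (r o4)"
    have rd: "r o2 \<in> D" "r o4 \<in> D" using oD by auto
    have mp: "?m permutes D" using permutes_compose[OF permutes_swap_id[OF rd] n_perm] .
    have rne: "r x \<noteq> y" if "x \<in> Q" "y \<in> Q" for x y using rO[OF that(1)] that(2) by auto
    have inO: "d1 \<in> Q" "o2 \<in> Q" "o3 \<in> Q" "o4 \<in> Q" by (auto simp: Q_def)
    have mo: "?m x = n x" if "x \<noteq> r o2" "x \<noteq> r o4" for x using that by simp
    have m1: "?m (r o2) = d1" "?m (r o4) = o3" using s4 by (simp_all add: o3_def)
    have m2: "?m (r d1) = o2" "?m (r o3) = o4"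
      using mo[of "r d1"] mo[of "r o3"] dist by (simp_all add: o2_def o4_def)
    have m3: "?m q = n q" if "q \<in> Q" for q
      using mo[of q] rne[OF inO(2) that] rne[OF inO(4) that] by auto
    have "card (orbs n D) \<le> card (orbs ?m D) + 1" by (rule card_orbs_swap[OF finD n_perm rd])
    moreover have "card (orbs ?m D) \<le> card (orbs n' D')"
    proof (rule card_orbs_le_if_finer[OF finD mp _ n'perm])
      show "finite D'" "D' \<subseteq> D" using finD by (auto simp: D'_def)
      show "n' x \<in> orbit ?m x" if x: "x \<in> D'" for x
      proof (cases "r x \<in> Q")
        case True
        have "?m x = opp (r x)"
        proof -
          from True consider "x = r d1" | "x = r o2" | "x = r o3" | "x = r o4"
            unfolding Q_def by (metis insertE r_r singletonD)
          then show ?thesis using m1 m2 op1 op2 op3 op4 by cases simp_all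
        qed
        moreover have "?m (opp (r x)) = n (opp (r x))" using m3 OD(3)[OF True] by blast
        ultimately have "?m (?m x) = n' x" using True D'D(2)[OF x] by (simp add: n'_def)
        then show ?thesis by (metis orbit.base orbit.step)
      next
        case False
        then have "x \<noteq> r o2" "x \<noteq> r o4" using inO by auto
        then have "?m x = n' x" using mo False D'D(2)[OF x] by (simp add: n'_def)
        then show ?thesis by (metis orbit.base)
      qed
      show "orbit ?m x \<inter> D' \<noteq> {}" if x: "x \<in> D" for x
      proof (cases "x \<in> Q")
        case True
        have "n x \<notin> Q" using nO rO[OF True] by blast
        then have "?m x \<in> D'" using m3[OF True] x by (simp add: D'_def)
        then show ?thesis using orbit.base[of ?m x] by blast
      next
        case False
        then show ?thesis using x perm_self_in_orbit[OF finD mp] by (auto simp: D'_def)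
      qed
    qed
    ultimately show ?thesis by linarith
  qed
  moreover have "D' \<subseteq> D" by (auto simp: D'_def)
  ultimately show ?thesis by blast
qed

end

text \<open>Dissolving a touching point removes four darts, all starting there, and at most one
  face. The left side of the inequality drops by 8, the right side by at most 4 + 4.\<close>

lemma touch_removal:
  assumes "touch_map D n r opp rl ed xe dest par"
    and "2 * card D + 8 \<le> 4 * card (orbs n D) + card {d \<in> D. \<not> rl d} + 4 * N"
  shows "\<exists>D' n' r'. planar_map D' n' r' rl ed xe dest par \<and> D' \<subseteq> D \<and> (\<forall>d\<in>D. rl d \<longrightarrow> d \<in> D') \<and>
     2 * card D' + 8 \<le> 4 * card (orbs n' D') + card {d \<in> D'. \<not> rl d} + 4 * N \<and>
     (\<forall>d\<in>D'. dest (r' d) = dest (r d) \<and> (rl (r d) \<longrightarrow> r' d = r d))"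
  using assms
proof (induction "card D" arbitrary: D n r rule: less_induct)
  case less
  interpret touch_map D n r opp rl ed xe dest par by (rule less(2))
  show ?case
  proof (cases "\<forall>d\<in>D. \<not> rl d \<longrightarrow> opp d = n (r (n (r d)))")
    case True
    then have "planar_map D n r rl ed xe dest par" using planar_if_no_touch by blast
    then show ?thesis using less(3) by (intro exI[of _ D] exI[of _ n] exI[of _ r]) simp
  next
    case False
    then obtain d where d: "d \<in> D" "\<not> rl d" "opp d \<noteq> n (r (n (r d)))" by blast
    \<comment> \<open>The partner \<open>opp d\<close> is the next or the previous dart of the
      rotation; in the second case \<open>opp d\<close> has its own partner next.\<close>
    have "\<exists>d1\<in>D. \<not> rl d1 \<and> opp d1 = n (r d1)"
    proof (cases "opp d = n (r d)")
      case False
      then have "opp d = n (r (n (r (n (r d)))))" using opp_rot[OF d(1,2)] d(3) by blast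
      then have "n (r (opp d)) = opp (opp d)" using rot4[OF d(1,2)] opp_opp[OF d(1,2)] by simp
      then show ?thesis using opp_D[OF d(1,2)] by metis
    qed (use d in blast)
    then obtain d1 where "d1 \<in> D" "\<not> rl d1" "opp d1 = n (r d1)" by blast
    from untouch[OF this] obtain D' n' r' where u: "touch_map D' n' r' opp rl ed xe dest par" "D' \<subseteq> D"
      "card D = card D' + 4" "\<forall>d\<in>D. rl d \<longrightarrow> d \<in> D'" "card (orbs n D) \<le> card (orbs n' D') + 1"
      "\<forall>d\<in>D'. dest (r' d) = dest (r d) \<and> (rl (r d) \<longrightarrow> r' d = r d)" by blast
    have fD': "finite D'" using u(2) finD finite_subset by blast
    have rp: "rl (r d) \<longrightarrow> rl (r' d)" if "d \<in> D'" for d using u(6) that by simp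
    have "card D = card {d \<in> D. rl d} + card {d \<in> D. \<not> rl d}"
      using finD by (subst card_Un_disjoint[symmetric]) (auto intro: arg_cong[where f = card])
    moreover have "card D' = card {d \<in> D'. rl d} + card {d \<in> D'. \<not> rl d}"
      using fD' by (subst card_Un_disjoint[symmetric]) (auto intro: arg_cong[where f = card])
    moreover have "{d \<in> D. rl d} = {d \<in> D'. rl d}" using u(2,4) by auto
    ultimately have "card {d \<in> D. \<not> rl d} = card {d \<in> D'. \<not> rl d} + 4" using u(3) by simp
    then have "2 * card D' + 8 \<le> 4 * card (orbs n' D') + card {d \<in> D'. \<not> rl d} + 4 * N"
      using less(3) u(3,5) by linarith
    from less(1)[OF _ u(1) this] u(3) obtain D'' n'' r'' where v: "planar_map D'' n'' r'' rl ed xe dest par"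
      "D'' \<subseteq> D'" "\<forall>d\<in>D'. rl d \<longrightarrow> d \<in> D''"
      "2 * card D'' + 8 \<le> 4 * card (orbs n'' D'') + card {d \<in> D''. \<not> rl d} + 4 * N"
      "\<forall>d\<in>D''. dest (r'' d) = dest (r' d) \<and> (rl (r' d) \<longrightarrow> r'' d = r' d)" by auto
    show ?thesis
    proof (intro exI conjI)
      show "\<forall>d\<in>D''. dest (r'' d) = dest (r d) \<and> (rl (r d) \<longrightarrow> r'' d = r d)"
        using v(2,5) u(6) by (metis subsetD)
    qed (use u v in auto)
  qed
qed

text \<open>Ten times \<open>euler\<close> and \<open>charge_bound\<close> together eliminate the
  number of faces; the darts at crossings cancel and eight times the claim is left. The marked darts
  are those at \<open>z\<close>, whose edges consist of a single piece by the last
  hypothesis.\<close>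

theorem edge_bound:
  assumes tm: "touch_map D n r opp rl ed xe dest par"
    and euler: "2 * card D + 8 \<le> 4 * card (orbs n D) + card {d \<in> D. \<not> rl d} + 4 * N"
    and real: "card {d \<in> D. rl d} = 2 * m"
    and z: "\<And>d. d \<in> D \<Longrightarrow> rl d \<Longrightarrow> dest (r d) = z \<Longrightarrow> rl (r d)"
  shows "m + 10 + card {d \<in> D. rl d \<and> dest (r d) = z} \<le> 5 * N"
proof -
  obtain D' n' r' where u: "planar_map D' n' r' rl ed xe dest par" "D' \<subseteq> D" "\<forall>d\<in>D. rl d \<longrightarrow> d \<in> D'"
     "2 * card D' + 8 \<le> 4 * card (orbs n' D') + card {d \<in> D'. \<not> rl d} + 4 * N"
     "\<forall>d\<in>D'. dest (r' d) = dest (r d) \<and> (rl (r d) \<longrightarrow> r' d = r d)"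
    using touch_removal[OF tm euler] by blast
  interpret planar_map D' n' r' rl ed xe dest par by (rule u(1))
  let ?I = "{d \<in> D'. rl d \<and> dest (r' d) = z}"
  have I: "?I = {d \<in> D. rl d \<and> dest (r d) = z}" using u(2,3,5) by auto
  have rI: "rl (n' i)" if "i \<in> ?I" for i
  proof -
    have "i \<in> D" "dest (r i) = z" using that I by auto
    then have "rl (r i)" using z that by auto
    then show ?thesis using u(5) that rl_r[of i] by auto
  qed
  have "40 * card (orbs n' D') + 8 * card ?I \<le> 10 * card D' + 6 * card {d \<in> D'. rl d}"
  proof (rule charge_bound)
    show "rl i \<and> rl (n' i) \<and> n' i \<notin> ?I" if i: "i \<in> ?I" for i
      using rI[OF i] i dest_head[of i] dest_ne[of i] by auto
    show "rl i" if i: "i \<in> D'" "n' i \<in> ?I" for i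
    proof -
      have "r' i \<in> ?I" using i dest_head[of i] by auto
      then show ?thesis using rI i by fastforce
    qed
  qed auto
  moreover have "card D' = card {d \<in> D'. rl d} + card {d \<in> D'. \<not> rl d}"
    using finD by (subst card_Un_disjoint[symmetric]) (auto intro: arg_cong[where f = card])
  moreover have "{d \<in> D'. rl d} = {d \<in> D. rl d}" using u(2,3) by auto
  ultimately show ?thesis using u(4) real I by simp
qed

section \<open>Regions of a theta curve\<close>

definition loop_set :: "complex set \<Rightarrow> bool" where
  "loop_set K \<longleftrightarrow> (\<exists>g. simple_path g \<and> pathfinish g = pathstart g \<and> path_image g = K)"

definition arc_set :: "complex set \<Rightarrow> complex \<Rightarrow> complex \<Rightarrow> bool" where
  "arc_set A x y \<longleftrightarrow> (\<exists>g. arc g \<and> path_image g = A \<and> pathstart g = x \<and> pathfinish g = y)"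

lemma arc_set_rev: "arc_set A x y \<Longrightarrow> arc_set A y x"
  unfolding arc_set_def by (metis arc_reversepath path_image_reversepath pathfinish_reversepath pathstart_reversepath)

lemma arc_set_ends: "arc_set A x y \<Longrightarrow> x \<in> A \<and> y \<in> A \<and> x \<noteq> y"
  unfolding arc_set_def using arc_distinct_ends by fastforce

lemma arc_set_compact: "arc_set A x y \<Longrightarrow> compact A \<and> connected A \<and> closed A"
  unfolding arc_set_def by (metis arc_imp_path closed_path_image compact_path_image connected_path_image)

lemma arc_set_join:
  assumes "arc_set A x y" "arc_set B y z" "A \<inter> B \<subseteq> {y}" shows "arc_set (A \<union> B) x z"
proof -
  obtain g h where g: "arc g" "path_image g = A" "pathstart g = x" "pathfinish g = y"
    and h: "arc h" "path_image h = B" "pathstart h = y" "pathfinish h = z"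
    using assms unfolding arc_set_def by metis
  have "arc (g +++ h)" by (rule arc_join) (use g h assms in auto)
  then show ?thesis unfolding arc_set_def
    using g h path_image_join[of g h] by (intro exI[of _ "g +++ h"]) auto
qed

lemma loop_set_join:
  assumes "arc_set A x y" "arc_set B y x" "A \<inter> B \<subseteq> {x, y}" shows "loop_set (A \<union> B)"
proof -
  obtain g h where g: "arc g" "path_image g = A" "pathstart g = x" "pathfinish g = y"
    and h: "arc h" "path_image h = B" "pathstart h = y" "pathfinish h = x"
    using assms unfolding arc_set_def by metis
  have "simple_path (g +++ h)" by (rule simple_path_join_loop) (use g h assms in auto)
  then show ?thesis unfolding loop_set_def
    using g h path_image_join[of g h] by (intro exI[of _ "g +++ h"]) auto
qed

lemma arc_set_interior:
  assumes "arc_set A x y"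
  shows "connected (A - {x, y})" "A - {x, y} \<noteq> {}" "x \<in> closure (A - {x, y})"
proof -
  obtain g where g: "arc g" "path_image g = A" "pathstart g = x" "pathfinish g = y"
    using assms unfolding arc_set_def by metis
  show c: "connected (A - {x, y})"
    using connected_simple_path_endless[OF arc_imp_simple_path[OF g(1)]] g by simp
  show ne: "A - {x, y} \<noteq> {}"
    using nonempty_simple_path_endless[OF arc_imp_simple_path[OF g(1)]] g by simp
  show "x \<in> closure (A - {x, y})"
  proof (rule ccontr)
    let ?Z = "closure (A - {x, y}) \<union> {y}"
    assume "x \<notin> closure (A - {x, y})"
    then have "{x} \<inter> ?Z \<inter> A = {}" using arc_set_ends[OF assms] by auto
    moreover have "A \<subseteq> {x} \<union> ?Z" using closure_subset[of "A - {x, y}"] by auto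
    moreover have "closed {x}" "closed ?Z" by auto
    moreover have "{x} \<inter> A \<noteq> {}" "?Z \<inter> A \<noteq> {}" using arc_set_ends[OF assms] by auto
    moreover have "connected A" using arc_set_compact[OF assms] by simp
    ultimately show False unfolding connected_closed by metis
  qed
qed

text \<open>A larger connected set avoiding \<open>K\<close> would have to meet the frontier of
  \<open>S\<close>, which lies in \<open>K\<close>.\<close>

lemma component_if_frontier:
  assumes "connected S" "S \<noteq> {}" "S \<inter> K = {}" "frontier S \<subseteq> K"
  shows "S \<in> components (- K)"
proof -
  obtain a where a: "a \<in> S" using assms by blast
  let ?T = "connected_component_set (- K) a"
  have "S \<subseteq> ?T" using assms a by (intro connected_component_maximal) auto
  moreover have "?T \<subseteq> S"
  proof (rule ccontr)
    assume "\<not> ?T \<subseteq> S"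
    then have "?T \<inter> frontier S \<noteq> {}"
      using a \<open>S \<subseteq> ?T\<close> by (intro connected_Int_frontier) auto
    then show False using assms connected_component_subset[of "- K" a] by blast
  qed
  ultimately have "?T = S" by simp
  moreover have "a \<in> - K" using a assms by auto
  ultimately show ?thesis by (metis componentsI)
qed

lemma loop_components:
  assumes "loop_set K"
  obtains I J where "components (- K) = {I, J}" "I \<noteq> J" "I \<inter> J = {}" "frontier I = K" "frontier J = K"
proof -
  obtain c where c: "simple_path c" "pathfinish c = pathstart c" "path_image c = K"
    using assms unfolding loop_set_def by metis
  note J = Jordan_inside_outside[OF c(1,2), unfolded c(3)]
  have I: "inside K \<in> components (- K)" "outside K \<in> components (- K)"
    by (rule component_if_frontier; use J in auto)+
  moreover have "S = inside K \<or> S = outside K" if S: "S \<in> components (- K)" for S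
  proof -
    have "S \<subseteq> inside K \<union> outside K" "S \<noteq> {}"
      using in_components_subset[OF S] in_components_nonempty[OF S] J by auto
    then have "S \<inter> inside K \<noteq> {} \<or> S \<inter> outside K \<noteq> {}" by blast
    then show ?thesis using components_nonoverlap[OF S I(1)] components_nonoverlap[OF S I(2)] by blast
  qed
  ultimately have "components (- K) = {inside K, outside K}" by blast
  then show ?thesis using J by (intro that[of "inside K" "outside K"]) auto
qed

text \<open>
  Otherwise S and the region on the other side of the loop can be joined while avoiding either
  of the two cycles through A, and Janiszewski's theorem joins them while avoiding both.
\<close>

lemma theta_frontier:
  assumes loop: "loop_set (c1 \<union> c2)" and c: "compact c1" "compact c2" "c1 \<inter> c2 = {x, y}"
    and R: "R \<in> components (- (c1 \<union> c2))"
    and A: "arc_set A x y" "A - {x, y} \<subseteq> R"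
    and S: "S \<in> components (- (c1 \<union> c2 \<union> A))" "S \<subseteq> R"
  shows "frontier S \<subseteq> c1 \<union> A \<or> frontier S \<subseteq> c2 \<union> A"
proof (rule ccontr)
  assume not: "\<not> ?thesis"
  have cA: "compact A" "connected A" using arc_set_compact[OF A(1)] by auto
  have xy: "x \<in> A" "y \<in> A" using arc_set_ends[OF A(1)] by auto
  have "closed (c1 \<union> c2 \<union> A)" using c cA by (intro compact_imp_closed compact_Un)
  then have fS: "frontier S \<subseteq> c1 \<union> c2 \<union> A"
    using frontier_of_components_closed_complement[OF _ S(1)] by blast
  from not obtain p q where p: "p \<in> frontier S" "p \<notin> c2 \<union> A" and q: "q \<in> frontier S" "q \<notin> c1 \<union> A" by blast
  then have pc: "p \<in> c1" and qc: "q \<in> c2" using fS by auto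
  obtain I J where IJ: "components (- (c1 \<union> c2)) = {I, J}" "I \<noteq> J" "I \<inter> J = {}"
    "frontier I = c1 \<union> c2" "frontier J = c1 \<union> c2" using loop_components[OF loop] .
  obtain R' where R': "R' \<in> components (- (c1 \<union> c2))" "R' \<inter> R = {}" "frontier R' = c1 \<union> c2"
    using R IJ by (metis Int_commute insert_iff singletonD)
  have R'C: "R' \<inter> (c1 \<union> c2) = {}" using in_components_subset[OF R'(1)] by auto
  have R'A: "R' \<inter> A = {}" using R'C R'(2) A(2) c(3) by blast
  obtain a b where a: "a \<in> S" and b: "b \<in> R'"
    using in_components_nonempty[OF S(1)] in_components_nonempty[OF R'(1)] by blast
  have S0: "S \<inter> (c1 \<union> c2 \<union> A) = {}" using in_components_subset[OF S(1)] by auto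
  \<comment> \<open>The point \<open>z\<close> also lies on the frontier of \<open>R'\<close>, the
    far side of the loop, so \<open>S\<close> and \<open>R'\<close> are linked through
    \<open>z\<close>.\<close>
  have bridge: "connected_component (- X) a b"
    if z: "z \<in> frontier S" "z \<in> c1 \<union> c2" "z \<notin> X" and X: "X \<subseteq> c1 \<union> c2 \<union> A" for z X
  proof -
    have "z \<in> closure S" "z \<in> closure R'" using z R'(3) by (auto simp: frontier_def)
    then have "connected (insert z S)" "connected (insert z R')"
      using connected_intermediate_closure[of S "insert z S"] connected_intermediate_closure[of R' "insert z R'"]
        in_components_connected[OF S(1)] in_components_connected[OF R'(1)] closure_subset by (blast, blast)
    then have "connected (insert z S \<union> insert z R')" by (rule connected_Un) auto
    moreover have "insert z S \<union> insert z R' \<subseteq> - X" using z X S0 R'C R'A by blast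
    ultimately show ?thesis unfolding connected_component_def using a b by blast
  qed
  have 1: "connected_component (- (c2 \<union> A)) a b" by (rule bridge[of p]) (use p pc in auto)
  have 2: "connected_component (- (c1 \<union> A)) a b" by (rule bridge[of q]) (use q qc in auto)
  have 3: "(c2 \<union> A) \<inter> (c1 \<union> A) = A" using c(3) xy by auto
  have "connected_component (- ((c2 \<union> A) \<union> (c1 \<union> A))) a b"
    by (rule Janiszewski[OF _ _ _ 1 2]) (use c cA 3 in \<open>simp_all add: compact_Un compact_imp_closed closed_Un\<close>)
  moreover have "(c2 \<union> A) \<union> (c1 \<union> A) = c1 \<union> c2 \<union> A" by blast
  ultimately have "connected_component (- (c1 \<union> c2 \<union> A)) a b" by simp
  then have "b \<in> S" using S(1) a
    by (metis (no_types, lifting) components_iff connected_component_eq mem_Collect_eq)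
  then show False using b S(2) R'(2) by blast
qed

text \<open>Both regions would be components of the complement of the loop
  \<open>c1 \<union> A\<close>, hence all of it by the Jordan curve theorem. But the far side of
  \<open>c1 \<union> c2\<close> also avoids that loop and is disjoint from \<open>R\<close>.\<close>

lemma theta_unique:
  assumes loop: "loop_set (c1 \<union> c2)" "loop_set (c1 \<union> A)" and c3: "c1 \<inter> c2 = {x, y}"
    and R: "R \<in> components (- (c1 \<union> c2))" and A: "A - {x, y} \<subseteq> R"
    and S1: "S1 \<in> components (- (c1 \<union> c2 \<union> A))" "S1 \<subseteq> R" "frontier S1 \<subseteq> c1 \<union> A"
    and S2: "S2 \<in> components (- (c1 \<union> c2 \<union> A))" "S2 \<subseteq> R" "frontier S2 \<subseteq> c1 \<union> A"
  shows "S1 = S2"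
proof (rule ccontr)
  assume ne: "S1 \<noteq> S2"
  have comp: "S \<in> components (- (c1 \<union> A))"
    if "S \<in> components (- (c1 \<union> c2 \<union> A))" "frontier S \<subseteq> c1 \<union> A" for S
    using that in_components_subset[OF that(1)]
    by (intro component_if_frontier in_components_connected[OF that(1)] in_components_nonempty[OF that(1)]) auto
  obtain I J where IJ: "components (- (c1 \<union> A)) = {I, J}" "I \<inter> J = {}"
    using loop_components[OF loop(2)] by metis
  have "S1 \<in> {I, J}" "S2 \<in> {I, J}" using comp[OF S1(1,3)] comp[OF S2(1,3)] IJ by auto
  then have "{S1, S2} = {I, J}" using ne by auto
  then have "\<Union>(components (- (c1 \<union> A))) = S1 \<union> S2" using IJ by auto
  then have un: "- (c1 \<union> A) = S1 \<union> S2" by simp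
  obtain I' J' where IJ': "components (- (c1 \<union> c2)) = {I', J'}" "I' \<noteq> J'" "I' \<inter> J' = {}"
    using loop_components[OF loop(1)] by metis
  obtain R' where R': "R' \<in> components (- (c1 \<union> c2))" "R' \<inter> R = {}"
    using R IJ' by (metis Int_commute insert_iff singletonD)
  have "R' \<inter> (c1 \<union> c2) = {}" "R' \<noteq> {}"
    using in_components_subset[OF R'(1)] in_components_nonempty[OF R'(1)] by auto
  moreover from this have "R' \<inter> A = {}" using R'(2) A c3 by blast
  ultimately have "R' \<subseteq> S1 \<union> S2" using un by auto
  then show False using \<open>R' \<noteq> {}\<close> S1(2) S2(2) R'(2) by blast
qed

section \<open>Combinatorial maps of plane arcs\<close>

definition steps :: "'a list \<Rightarrow> ('a \<times> 'a) set" where "steps xs = set (zip xs (tl xs))"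

definition cyclic_steps :: "'a list \<Rightarrow> ('a \<times> 'a) set" where "cyclic_steps xs = insert (last xs, hd xs) (steps xs)"

lemma steps_Nil [simp]: "steps [] = {}" and steps_single [simp]: "steps [x] = {}"
  and steps_Cons: "xs \<noteq> [] \<Longrightarrow> steps (x # xs) = insert (x, hd xs) (steps xs)"
  by (auto simp: steps_def neq_Nil_conv)

lemma steps_append: "xs \<noteq> [] \<Longrightarrow> ys \<noteq> [] \<Longrightarrow> steps (xs @ ys) = insert (last xs, hd ys) (steps xs \<union> steps ys)"
proof (induction xs)
  case (Cons x xs)
  then show ?case by (cases "xs = []") (auto simp: steps_Cons)
qed simp

lemma cyclic_steps_append: "xs \<noteq> [] \<Longrightarrow> ys \<noteq> [] \<Longrightarrow>
    cyclic_steps (xs @ ys) = steps xs \<union> steps ys \<union> {(last xs, hd ys), (last ys, hd xs)}"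
  by (auto simp: cyclic_steps_def steps_append)

lemma steps_nth: "(a, b) \<in> steps xs \<longleftrightarrow> (\<exists>i. Suc i < length xs \<and> a = xs ! i \<and> b = xs ! Suc i)"
proof -
  have "(a, b) \<in> steps xs \<longleftrightarrow> (\<exists>i. i < length xs - 1 \<and> a = xs ! i \<and> b = tl xs ! i)"
    unfolding steps_def in_set_zip by auto
  also have "\<dots> \<longleftrightarrow> (\<exists>i. Suc i < length xs \<and> a = xs ! i \<and> b = xs ! Suc i)"
    by (metis Nitpick.size_list_simp(2) length_tl less_diff_conv2 nth_tl One_nat_def Suc_leI Suc_less_eq
        length_greater_0_conv less_diff_conv not_less_zero plus_1_eq_Suc add.commute)
  finally show ?thesis .
qed

lemma steps_set: "(a, b) \<in> steps xs \<Longrightarrow> a \<in> set xs \<and> b \<in> set (tl xs)"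
  unfolding steps_def by (meson set_zip_leftD set_zip_rightD)

lemma steps_set': "(a, b) \<in> steps xs \<Longrightarrow> a \<in> set xs \<and> b \<in> set xs"
  using steps_set list.set_sel(2) by (metis empty_iff list.set(1) tl_Nil)

lemma steps_asym: "distinct xs \<Longrightarrow> (a, b) \<in> steps xs \<Longrightarrow> (b, a) \<notin> steps xs"
  unfolding steps_nth by (auto simp: nth_eq_iff_index_eq)

lemma steps_rev_map: "steps (rev (map f xs)) = {(f b, f a) | a b. (a, b) \<in> steps xs}"
proof (induction xs)
  case (Cons x xs)
  show ?case
  proof (cases "xs = []")
    case False
    then have "last (rev (map f xs)) = f (hd xs)" by (simp add: last_rev hd_map)
    then show ?thesis using False Cons by (auto simp: steps_append steps_Cons)
  qed simp
qed simp

lemma steps_succ: "a \<in> set xs \<Longrightarrow> a = last xs \<or> (\<exists>b. (a, b) \<in> steps xs)"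
proof (induction xs)
  case (Cons x xs)
  then show ?case by (cases "xs = []") (auto simp: steps_Cons)
qed simp

lemma cyclic_steps_rotate: "xs \<noteq> [] \<Longrightarrow> ys \<noteq> [] \<Longrightarrow> cyclic_steps (xs @ ys) = cyclic_steps (ys @ xs)"
  by (auto simp: cyclic_steps_append)

lemma cyclic_steps_perm:
  assumes "distinct xs" "xs \<noteq> []"
  obtains f where "bij_betw f (set xs) (set xs)" "\<And>a b. (a, b) \<in> cyclic_steps xs \<longleftrightarrow> a \<in> set xs \<and> b = f a"
proof -
  let ?n = "length xs"
  have cyclic_steps: "(a, b) \<in> cyclic_steps xs \<longleftrightarrow> (\<exists>i<?n. a = xs ! i \<and> b = rotate1 xs ! i)" for a b
  proof -
    obtain y ys where xs: "xs = y # ys" using assms(2) by (cases xs) auto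
    have bl: "length (butlast xs) = length ys" "butlast xs @ [last xs] = xs" using xs by simp_all
    have "zip (butlast xs @ [last xs]) (ys @ [y]) = zip (butlast xs) ys @ [(last xs, y)]"
      by (subst zip_append[OF bl(1)]) simp
    moreover have "rotate1 xs = ys @ [y]" using xs by simp
    ultimately have "zip xs (rotate1 xs) = zip (butlast xs) ys @ [(last xs, y)]" unfolding bl(2) by simp
    then have z: "set (zip xs (rotate1 xs)) = insert (last xs, y) (set (zip (butlast xs) ys))" by simp
    have "zip (butlast xs @ [last xs]) (ys @ []) = zip (butlast xs) ys"
      by (subst zip_append[OF bl(1)]) simp
    then have "zip xs ys = zip (butlast xs) ys" unfolding bl(2) by simp
    then have "cyclic_steps xs = set (zip xs (rotate1 xs))" unfolding z cyclic_steps_def steps_def using xs by simp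
    then show ?thesis by (auto simp: in_set_zip)
  qed
  define f where "f a = rotate1 xs ! (THE i. i < ?n \<and> xs ! i = a)" for a
  have idx: "(THE j. j < ?n \<and> xs ! j = xs ! i) = i" if "i < ?n" for i
    using that assms(1) by (intro the_equality) (auto simp: nth_eq_iff_index_eq)
  have fi: "f (xs ! i) = rotate1 xs ! i" if "i < ?n" for i using idx[OF that] by (simp add: f_def)
  have 2: "(a, b) \<in> cyclic_steps xs \<longleftrightarrow> a \<in> set xs \<and> b = f a" for a b
    unfolding cyclic_steps in_set_conv_nth using fi by auto
  have "inj_on f (set xs)"
  proof
    fix a b assume ab: "a \<in> set xs" "b \<in> set xs" "f a = f b"
    then obtain i j where "i < ?n" "j < ?n" "a = xs ! i" "b = xs ! j" by (auto simp: in_set_conv_nth)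
    moreover have "distinct (rotate1 xs)" using assms by simp
    ultimately show "a = b" using ab fi by (simp add: nth_eq_iff_index_eq)
  qed
  moreover have "f ` set xs \<subseteq> set xs"
    using fi by (auto simp: in_set_conv_nth[of _ xs]) (metis length_rotate1 nth_mem set_rotate1 in_set_conv_nth)
  ultimately have "bij_betw f (set xs) (set xs)" by (simp add: bij_betw_def endo_inj_surj)
  then show ?thesis using 2 by (rule that)
qed

section \<open>Plane pieces, ears and the splitting of a face\<close>

locale plane_darts =
  fixes D0 :: "'d set" and org :: "'d \<Rightarrow> complex" and rv :: "'d \<Rightarrow> 'd" and im :: "'d \<Rightarrow> complex set"
  assumes finite_D0: "finite D0"
    and rv_rv [simp]: "rv (rv d) = d" and rv_D0: "d \<in> D0 \<Longrightarrow> rv d \<in> D0"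
    and im_rv: "im (rv d) = im d"
    and im_arc: "d \<in> D0 \<Longrightarrow> arc_set (im d) (org d) (org (rv d))"
    and im_disj: "\<lbrakk>d \<in> D0; d' \<in> D0; d' \<noteq> d; d' \<noteq> rv d\<rbrakk>
       \<Longrightarrow> im d \<inter> im d' \<subseteq> {org d, org (rv d)} \<inter> {org d', org (rv d')}"
begin

lemma org_ne: "d \<in> D0 \<Longrightarrow> org d \<noteq> org (rv d)"
  using arc_set_ends im_arc by blast

lemma rv_ne: "d \<in> D0 \<Longrightarrow> rv d \<noteq> d"
  using org_ne by metis

definition walk :: "'d list \<Rightarrow> bool" where
  "walk xs \<longleftrightarrow> (\<forall>(a, b) \<in> steps xs. org b = org (rv a))"

definition U :: "'d set \<Rightarrow> complex set" where "U X = \<Union>(im ` X)"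

lemma walk_heads:
  "walk xs \<Longrightarrow> xs \<noteq> [] \<Longrightarrow> map (\<lambda>a. org (rv a)) xs = tl (map org xs) @ [org (rv (last xs))]"
proof (induction xs)
  case (Cons x xs)
  show ?case
  proof (cases "xs = []")
    case False
    then have "walk xs" "org (hd xs) = org (rv x)" using Cons(2) by (auto simp: walk_def steps_Cons)
    then show ?thesis using Cons(1) False by (cases xs) auto
  qed simp
qed simp

lemma walk_rev: "walk xs \<Longrightarrow> walk (rev (map rv xs))"
  unfolding walk_def steps_rev_map by fastforce

lemma path_arc:
  "xs \<noteq> [] \<Longrightarrow> set xs \<subseteq> D0 \<Longrightarrow> walk xs \<Longrightarrow> distinct (map org xs @ [org (rv (last xs))]) \<Longrightarrow>
   arc_set (U (set xs)) (org (hd xs)) (org (rv (last xs)))"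
proof (induction xs)
  case (Cons x xs)
  show ?case
  proof (cases "xs = []")
    case True
    then show ?thesis using Cons im_arc by (auto simp: U_def)
  next
    case False
    have w: "walk xs" "org (hd xs) = org (rv x)" using Cons(4) False by (auto simp: walk_def steps_Cons)
    have IH: "arc_set (U (set xs)) (org (rv x)) (org (rv (last xs)))"
      using Cons w False by simp
    have "im x \<inter> U (set xs) \<subseteq> {org (rv x)}"
    proof
      fix z assume "z \<in> im x \<inter> U (set xs)"
      then obtain d where d: "d \<in> set xs" "z \<in> im x" "z \<in> im d" by (auto simp: U_def)
      have "org x \<notin> set (map org xs)" "org x \<noteq> org (rv (last xs))" using Cons(5) False by auto
      moreover have "org (rv d) \<in> set (map (\<lambda>a. org (rv a)) xs)" using d by auto
      then have "org (rv d) \<in> set (tl (map org xs)) \<union> {org (rv (last xs))}"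
        unfolding walk_heads[OF w(1) False] by simp
      moreover have "set (tl (map org xs)) \<subseteq> set (map org xs)" using False by (auto dest: list.set_sel(2)[rotated])
      ultimately have ne: "org x \<noteq> org d" "org x \<noteq> org (rv d)" using d by auto
      then have "d \<noteq> x" "d \<noteq> rv x" by auto
      then have "z \<in> {org x, org (rv x)} \<inter> {org d, org (rv d)}"
        using im_disj[of x d] d Cons(3) by auto
      then show "z \<in> {org (rv x)}" using ne by auto
    qed
    then have "arc_set (im x \<union> U (set xs)) (org x) (org (rv (last xs)))"
      using arc_set_join[OF im_arc IH] Cons(3) by auto
    then show ?thesis using False by (simp add: U_def)
  qed
qed simp

text \<open>Membership of \<open>x\<close> and \<open>y\<close> in the points of \<open>H\<close> is
  left to the users, because \<open>ear_exists\<close> grows open paths of this kind that still end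
  off \<open>H\<close>.\<close>

definition ear :: "'d set \<Rightarrow> complex \<Rightarrow> 'd list \<Rightarrow> complex \<Rightarrow> bool" where
  "ear H x as y \<longleftrightarrow> as \<noteq> [] \<and> set as \<subseteq> D0 - H \<and> walk as \<and> org (hd as) = x \<and> org (rv (last as)) = y
     \<and> distinct (map org as @ [y]) \<and> (\<forall>a\<in>set (tl as). org a \<notin> org ` H)"

text \<open>A step of the rotation at a point: \<open>rv d\<close> arrives there along a face and
  \<open>d'\<close> is the dart by which this face leaves.\<close>

definition turn :: "'d list set \<Rightarrow> ('d \<times> 'd) set" where
  "turn Fs = {(d, d'). \<exists>f\<in>Fs. (rv d, d') \<in> cyclic_steps f}"

abbreviation turn_related :: "'d list set \<Rightarrow> ('d \<times> 'd) set" where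
  "turn_related Fs \<equiv> (turn Fs \<union> (turn Fs)\<inverse>)\<^sup>*"

lemma turn_related_sym: "(a, b) \<in> turn_related Fs \<Longrightarrow> (b, a) \<in> turn_related Fs"
  by (metis converse_Un converse_converse rtrancl_converseI sup_commute)

text \<open>
  Faces are listed as cyclic sequences of darts with distinct origins. The last two conjuncts say
  that the rotation at a point is one cycle and that Euler's inequality holds.
\<close>

definition facial :: "'d set \<Rightarrow> 'd list set \<Rightarrow> bool" where
  "facial H Fs \<longleftrightarrow> H \<subseteq> D0 \<and> rv ` H \<subseteq> H \<and> finite Fs \<and> \<Union>(set ` Fs) = H
   \<and> (\<forall>f\<in>Fs. f \<noteq> [] \<and> distinct (map org f) \<and> (\<forall>(a, b)\<in>cyclic_steps f. org b = org (rv a)))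
   \<and> (\<forall>f\<in>Fs. \<forall>g\<in>Fs. f \<noteq> g \<longrightarrow> set f \<inter> set g = {})
   \<and> (\<forall>d\<in>H. \<forall>d'\<in>H. org d = org d' \<longrightarrow> (d, d') \<in> turn_related Fs)
   \<and> card H + 4 \<le> 2 * card Fs + 2 * card (org ` H)"

lemma ear_facts:
  assumes "ear H x as y"
  shows "distinct as" "set as \<inter> rv ` set as = {}"
    "org ` rv ` set as = insert y (org ` set (tl as))" "org ` set as = insert x (org ` set (tl as))"
    "a \<in> set as \<Longrightarrow> org a = x \<Longrightarrow> a = hd as" "x \<noteq> y"
    "a \<in> set as \<Longrightarrow> org (rv a) = y \<Longrightarrow> a = last as"
proof -
  have e: "as \<noteq> []" "walk as" "org (hd as) = x" "org (rv (last as)) = y" "distinct (map org as @ [y])"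
    using assms by (auto simp: ear_def)
  show da: "distinct as" using e(5) by (simp add: distinct_map)
  have inj: "inj_on org (set as)" using e(5) by (simp add: distinct_map)
  have yas: "y \<notin> org ` set as" using e(5) by auto
  show "set as \<inter> rv ` set as = {}"
  proof (rule ccontr)
    assume "\<not> ?thesis"
    then obtain a where a: "a \<in> set as" "rv a \<in> set as" by auto
    have step: "(c, rv c) \<in> steps as" if c: "c \<in> set as" "rv c \<in> set as" for c
    proof -
      have "c \<noteq> last as" using c e(4) yas by auto
      then obtain b where b: "(c, b) \<in> steps as" using steps_succ[OF c(1)] by auto
      then have "org b = org (rv c)" using e(2) by (auto simp: walk_def)
      then have "b = rv c" using inj c(2) steps_set'[OF b] by (auto dest: inj_onD)
      then show ?thesis using b by simp
    qed
    show False using steps_asym[OF da step[OF a]] step[of "rv a"] a by simp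
  qed
  have "set (map (\<lambda>a. org (rv a)) as) = insert y (set (tl (map org as)))"
    using walk_heads[OF e(2,1)] e(4) by simp
  then show "org ` rv ` set as = insert y (org ` set (tl as))"
    by (simp add: image_image map_tl[symmetric])
  show "org ` set as = insert x (org ` set (tl as))"
    using e(1,3) by (cases as) auto
  show "a = hd as" if "a \<in> set as" "org a = x" using inj that e(1,3) by (auto dest: inj_onD)
  show "x \<noteq> y" using yas e(1,3) by auto
  show "a = last as" if a: "a \<in> set as" "org (rv a) = y"
  proof (rule ccontr)
    assume "a \<noteq> last as"
    then obtain b where b: "(a, b) \<in> steps as" using steps_succ[OF a(1)] by auto
    then have "org b = y" using e(2) a(2) by (auto simp: walk_def)
    then show False using yas steps_set'[OF b] by auto
  qed
qed

text \<open>An ear of k pieces adds 2k darts, k - 1 points and one face, which keeps Euler's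
  inequality. The two halves of the old face are closed up by the ear, traversed once in each
  direction.\<close>

lemma facial_step:
  assumes cb: "facial H Fs" and f: "f \<in> Fs" and xy: "xs \<noteq> []" "ys \<noteq> []" "set (xs @ ys) = set f"
    "cyclic_steps (xs @ ys) = cyclic_steps f" "distinct (map org (xs @ ys))" "org (hd xs) = x" "org (hd ys) = y"
    and ear: "ear H x as y"
  defines "bs \<equiv> rev (map rv as)"
  shows "facial (H \<union> set as \<union> rv ` set as) (insert (xs @ bs) (insert (ys @ as) (Fs - {f})))"
proof -
  have C1: "H \<subseteq> D0" and C2: "rv ` H \<subseteq> H" and C3: "finite Fs" and C4: "\<Union>(set ` Fs) = H"
    and C5: "\<And>f. f \<in> Fs \<Longrightarrow> f \<noteq> [] \<and> distinct (map org f) \<and> (\<forall>(a, b)\<in>cyclic_steps f. org b = org (rv a))"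
    and C6: "\<And>f g. f \<in> Fs \<Longrightarrow> g \<in> Fs \<Longrightarrow> f \<noteq> g \<Longrightarrow> set f \<inter> set g = {}"
    and C7: "\<And>d d'. d \<in> H \<Longrightarrow> d' \<in> H \<Longrightarrow> org d = org d' \<Longrightarrow> (d, d') \<in> turn_related Fs"
    and C8: "card H + 4 \<le> 2 * card Fs + 2 * card (org ` H)"
    using cb unfolding facial_def by simp_all
  have e: "as \<noteq> []" "walk as" "org (hd as) = x" "org (rv (last as)) = y" "distinct (map org as @ [y])"
    "set as \<subseteq> D0" "set as \<inter> H = {}" "\<And>a. a \<in> set (tl as) \<Longrightarrow> org a \<notin> org ` H"
    using ear by (auto simp: ear_def)
  note ef = ear_facts[OF ear]
  let ?H = "H \<union> set as \<union> rv ` set as" and ?Fs = "insert (xs @ bs) (insert (ys @ as) (Fs - {f}))"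
  have bs: "bs \<noteq> []" "set bs = rv ` set as" "hd bs = rv (last as)" "last bs = rv (hd as)" "walk bs"
    using e walk_rev by (auto simp: bs_def hd_rev last_rev last_map hd_map)
  have bsH: "set bs \<inter> H = {}"
  proof -
    have "a \<in> H" if "rv a \<in> H" for a using C2 that rv_rv by (metis image_eqI subsetD)
    then show ?thesis using e(7) bs(2) by auto
  qed
  have fH: "set f \<subseteq> H" using C4 f by auto
  have xsH: "set xs \<subseteq> H" "set ys \<subseteq> H" using fH xy(3) by auto
  have xH: "x \<in> org ` H" "y \<in> org ` H" using xy xsH by (metis hd_in_set image_eqI subsetD)+
  have csf: "\<forall>(a, b)\<in>cyclic_steps f. org b = org (rv a)" using C5[OF f] by blast
  have csxy: "cyclic_steps f = steps xs \<union> steps ys \<union> {(last xs, hd ys), (last ys, hd xs)}"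
    using cyclic_steps_append[OF xy(1,2)] xy(4) by simp
  have ends: "org (rv (last xs)) = y" "org (rv (last ys)) = x"
    using csf csxy xy(6,7) by auto
  have wf: "org b = org (rv a)" if "(a, b) \<in> steps xs \<union> steps ys" for a b
    using csf csxy that by fastforce
  have wa: "org b = org (rv a)" if "(a, b) \<in> steps as \<union> steps bs" for a b
    using e(2) bs(5) that unfolding walk_def by fastforce
  have w1: "\<forall>(a, b)\<in>cyclic_steps (xs @ bs). org b = org (rv a)"
    unfolding cyclic_steps_append[OF xy(1) bs(1)] using wf wa ends(1) bs(3,4) e(3,4) xy(6) by auto
  have w2: "\<forall>(a, b)\<in>cyclic_steps (ys @ as). org b = org (rv a)"
    unfolding cyclic_steps_append[OF xy(2) e(1)] using wf wa ends(2) e(3,4) xy(7) by auto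
  have tlH: "org ` set (tl as) \<inter> org ` H = {}" using e(8) by auto
  have d1: "distinct (map org (xs @ bs))"
  proof -
    have "map org bs = rev (map (\<lambda>a. org (rv a)) as)" by (simp add: bs_def rev_map o_def)
    also have "map (\<lambda>a. org (rv a)) as = tl (map org as) @ [y]" using walk_heads[OF e(2,1)] e(4) by simp
    finally have m: "map org bs = rev (tl (map org as) @ [y])" .
    have "distinct (tl (map org as) @ [y])" using e(5,1) by (cases as) auto
    then have "distinct (map org bs)" using m by simp
    moreover have "org ` set bs \<inter> org ` set xs = {}"
    proof -
      have "org ` set bs = insert y (org ` set (tl as))" using ef(3) bs(2) by simp
      moreover have "y \<notin> org ` set xs" using xy(2,5,7) by (auto dest: hd_in_set)
      moreover have "org ` set (tl as) \<inter> org ` set xs = {}" using tlH xsH by auto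
      ultimately show ?thesis by auto
    qed
    ultimately show ?thesis using xy(5) by auto
  qed
  have d2: "distinct (map org (ys @ as))"
  proof -
    have "x \<notin> org ` set ys" using xy(1,5,6) by (auto dest: hd_in_set)
    moreover have "org ` set (tl as) \<inter> org ` set ys = {}" using tlH xsH by auto
    ultimately have "org ` set as \<inter> org ` set ys = {}" using ef(4) by auto
    then show ?thesis using xy(5) e(5) by auto
  qed
  have disj: "set xs \<inter> set ys = {}" using xy(5) by (auto simp: distinct_map)
  have un: "\<Union>(set ` ?Fs) = ?H"
  proof -
    have "H = \<Union>(set ` (Fs - {f})) \<union> set f" using C4 f by auto
    then show ?thesis using xy(3) bs(2) by auto
  qed
  have dj: "\<forall>g\<in>?Fs. \<forall>h\<in>?Fs. g \<noteq> h \<longrightarrow> set g \<inter> set h = {}"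
  proof -
    have o: "set g \<inter> set h = {}" if "g \<in> Fs - {f}" "h \<in> Fs - {f}" "g \<noteq> h" for g h using C6 that by auto
    have 1: "set g \<inter> set (xs @ bs) = {}" "set g \<inter> set (ys @ as) = {}" if "g \<in> Fs - {f}" for g
    proof -
      have "set g \<inter> set f = {}" "set g \<subseteq> H" using C4 C6[of g f] f that by auto
      then show "set g \<inter> set (xs @ bs) = {}" "set g \<inter> set (ys @ as) = {}"
        using xy(3) bsH e(7) by auto
    qed
    have 2: "set (xs @ bs) \<inter> set (ys @ as) = {}"
      using disj xsH bsH e(7) ef(2) bs(2) by auto
    show ?thesis using o 1 2 by (auto simp: Int_commute)
  qed
  have in1: "(rv a, b) \<in> cyclic_steps (xs @ bs) \<Longrightarrow> (a, b) \<in> turn_related ?Fs" "(rv a, b) \<in> cyclic_steps (ys @ as) \<Longrightarrow> (a, b) \<in> turn_related ?Fs"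
    "g \<in> Fs - {f} \<Longrightarrow> (rv a, b) \<in> cyclic_steps g \<Longrightarrow> (a, b) \<in> turn_related ?Fs" for a b g
    unfolding turn_def by (rule r_into_rtrancl; force)+
  \<comment> \<open>At \<open>y\<close> the old turn from \<open>rv (last xs)\<close> to
    \<open>hd ys\<close> is replaced by two turns through the new dart \<open>hd bs\<close>;
    \<open>c2\<close> does the same at \<open>x\<close> with \<open>hd as\<close>.\<close>
  have c1: "(rv (last xs), hd bs) \<in> turn_related ?Fs" "(hd bs, hd ys) \<in> turn_related ?Fs"
    using in1(1)[of "rv (last xs)" "hd bs"] in1(2)[of "hd bs" "hd ys"] bs(3)
    by (auto simp: cyclic_steps_append xy(1,2) bs(1) e(1))
  have c2: "(rv (last ys), hd as) \<in> turn_related ?Fs" "(hd as, hd xs) \<in> turn_related ?Fs"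
    using in1(2)[of "rv (last ys)" "hd as"] in1(1)[of "hd as" "hd xs"] bs(4)
    by (auto simp: cyclic_steps_append xy(1,2) bs(1) e(1))
  have old: "(a, b) \<in> turn_related ?Fs" if "(a, b) \<in> turn_related Fs" for a b
  proof -
    have st: "(a, b) \<in> turn_related ?Fs" if ab: "(a, b) \<in> turn Fs" for a b
    proof -
      obtain g where g: "g \<in> Fs" "(rv a, b) \<in> cyclic_steps g" using ab by (auto simp: turn_def)
      show ?thesis
      proof (cases "g = f")
        case False then show ?thesis using in1(3) g by auto
      next
        case True
        then consider "(rv a, b) \<in> steps xs" | "(rv a, b) \<in> steps ys" | "rv a = last xs" "b = hd ys" | "rv a = last ys" "b = hd xs"
          using g(2) csxy by auto
        then show ?thesis
        proof cases
          case 1 then show ?thesis using in1(1) by (auto simp: cyclic_steps_append xy bs)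
        next
          case 2 then show ?thesis using in1(2) by (auto simp: cyclic_steps_append xy e)
        next
          case 3
          then have "a = rv (last xs)" by (metis rv_rv)
          then show ?thesis using c1 3 rtrancl_trans by metis
        next
          case 4
          then have "a = rv (last ys)" by (metis rv_rv)
          then show ?thesis using c2 4 rtrancl_trans by metis
        qed
      qed
    qed
    from that show ?thesis
    proof induction
      case (step b c)
      then have "(b, c) \<in> turn_related ?Fs" using st turn_related_sym by blast
      then show ?case using step by (metis rtrancl_trans)
    qed simp
  qed
  have toH: "\<exists>h\<in>H. org h = org d \<and> (d, h) \<in> turn_related ?Fs" if "d \<in> ?H" "org d \<in> org ` H" for d
  proof -
    consider "d \<in> H" | "d \<in> set as" | a where "a \<in> set as" "d = rv a" using \<open>d \<in> ?H\<close> by auto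
    then show ?thesis
    proof cases
      case 1 then show ?thesis by auto
    next
      case 2
      then have "org d \<in> insert x (org ` set (tl as))" using ef(4) by blast
      then have "org d = x" using tlH that(2) by blast
      then have "d = hd as" using ef(5) 2 by simp
      moreover have "hd xs \<in> H" using xsH xy(1) by auto
      ultimately show ?thesis using c2(2) xy(6) \<open>org d = x\<close> by auto
    next
      case (3 a)
      then have "org d \<in> insert y (org ` set (tl as))" using ef(3) by blast
      then have "org d = y" using tlH that(2) by blast
      then have "d = hd bs" using ef(7)[OF 3(1)] 3 bs(3) by simp
      moreover have "hd ys \<in> H" using xsH xy(2) by auto
      ultimately show ?thesis using c1(2) xy(7) \<open>org d = y\<close> by auto
    qed
  qed
  have toas: "\<exists>b\<in>set as. org b = org d \<and> (d, b) \<in> turn_related ?Fs" if d: "d \<in> ?H" "org d \<notin> org ` H" for d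
  proof -
    consider "d \<in> set as" | a where "a \<in> set as" "d = rv a" using d by auto
    then show ?thesis
    proof cases
      case 1 then show ?thesis by auto
    next
      case (2 a)
      have "a \<noteq> last as" using 2 e(4) xH d by auto
      then obtain b where b: "(a, b) \<in> steps as" using steps_succ[OF 2(1)] by auto
      then have "org b = org d" using e(2) 2 by (auto simp: walk_def)
      moreover have "(d, b) \<in> turn_related ?Fs" using in1(2)[of d b] b 2 by (auto simp: cyclic_steps_append xy(2) e(1))
      ultimately show ?thesis using steps_set'[OF b] by auto
    qed
  qed
  have trans: "(d, d') \<in> turn_related ?Fs" if d: "d \<in> ?H" "d' \<in> ?H" "org d = org d'" for d d'
  proof (cases "org d \<in> org ` H")
    case True
    then obtain h h' where h: "h \<in> H" "org h = org d" "(d, h) \<in> turn_related ?Fs" "h' \<in> H" "org h' = org d'" "(d', h') \<in> turn_related ?Fs"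
      using toH[of d] toH[of d'] d by auto
    have "(h, h') \<in> turn_related ?Fs" by (rule old, rule C7) (use h d in auto)
    then show ?thesis using h(3) turn_related_sym[OF h(6)] by (meson rtrancl_trans)
  next
    case False
    then obtain b b' where b: "b \<in> set as" "org b = org d" "(d, b) \<in> turn_related ?Fs" "b' \<in> set as" "org b' = org d'" "(d', b') \<in> turn_related ?Fs"
      using toas[of d] toas[of d'] d by auto
    have "inj_on org (set as)" using e(5) by (simp add: distinct_map)
    then have "b = b'" using b d(3) by (metis inj_onD)
    then show ?thesis using b(3) turn_related_sym[OF b(6)] by (meson rtrancl_trans)
  qed
  have finH: "finite H" using C1 finite_D0 finite_subset by auto
  have cH: "card ?H = card H + 2 * length as"
  proof -
    have "card (rv ` set as) = card (set as)" by (rule card_image) (metis inj_onI rv_rv)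
    moreover have "card (set as) = length as" using ef(1) by (rule distinct_card)
    moreover have "card (H \<union> set as) = card H + card (set as)"
      by (rule card_Un_disjoint) (use finH e(7) in auto)
    moreover have "card ?H = card (H \<union> set as) + card (rv ` set as)"
      by (rule card_Un_disjoint) (use finH ef(2) bsH bs(2) in auto)
    ultimately show ?thesis by simp
  qed
  have cO: "card (org ` ?H) = card (org ` H) + (length as - 1)"
  proof -
    have "org ` ?H = org ` H \<union> org ` set (tl as)" using ef(3,4) xH by (auto simp: image_Un)
    moreover have "card (org ` H \<union> org ` set (tl as)) = card (org ` H) + card (org ` set (tl as))"
      by (rule card_Un_disjoint) (use finH tlH in \<open>simp_all add: Int_commute\<close>)
    moreover have "card (org ` set (tl as)) = length as - 1"
    proof -
      have "distinct (map org (tl as))" using e(5,1) by (cases as) auto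
      then have "card (set (map org (tl as))) = length (map org (tl as))" by (rule distinct_card)
      then show ?thesis by simp
    qed
    ultimately show ?thesis by simp
  qed
  have cF: "card ?Fs = card Fs + 1"
  proof -
    have sub: "g \<in> Fs \<Longrightarrow> set g \<subseteq> H" for g using C4 by auto
    have "xs @ bs \<notin> Fs" using sub[of "xs @ bs"] bsH hd_in_set[OF bs(1)] by auto
    moreover have "ys @ as \<notin> Fs" using sub[of "ys @ as"] e(7) hd_in_set[OF e(1)] by auto
    moreover have "xs @ bs \<noteq> ys @ as" using disj xy(1,2) by (cases xs; cases ys; auto)
    moreover have "finite Fs" "card Fs \<ge> 1" using C3 f by (auto simp: Suc_le_eq card_gt_0_iff)
    ultimately show ?thesis using f by simp
  qed
  have euler: "card ?H + 4 \<le> 2 * card ?Fs + 2 * card (org ` ?H)"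
  proof -
    have "card H + 4 \<le> 2 * card Fs + 2 * card (org ` H)" by (rule C8)
    moreover obtain k where "length as = Suc k" using e(1) by (cases as) auto
    ultimately show ?thesis unfolding cH cO cF by simp
  qed
  have sub: "?H \<subseteq> D0" "rv ` ?H \<subseteq> ?H" "finite ?Fs" using C1 C2 C3 e(6) rv_D0 by auto
  have faces: "g \<noteq> [] \<and> distinct (map org g) \<and> (\<forall>(a, b)\<in>cyclic_steps g. org b = org (rv a))" if gF: "g \<in> ?Fs" for g
  proof -
    consider "g = xs @ bs" | "g = ys @ as" | "g \<in> Fs" using gF by blast
    then show ?thesis
    proof cases
      case 1 show ?thesis unfolding 1 using w1 d1 xy(1) by (intro conjI) simp_all
    next
      case 2 show ?thesis unfolding 2 using w2 d2 xy(2) by (intro conjI) simp_all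
    next
      case 3 then show ?thesis by (rule C5)
    qed
  qed
  show ?thesis unfolding facial_def
  proof (intro conjI)
    show "\<forall>g\<in>?Fs. g \<noteq> [] \<and> distinct (map org g) \<and> (\<forall>(a, b)\<in>cyclic_steps g. org b = org (rv a))"
      by (rule ballI) (rule faces)
    show "\<forall>d\<in>?H. \<forall>d'\<in>?H. org d = org d' \<longrightarrow> (d, d') \<in> turn_related ?Fs"
      by (intro ballI impI) (rule trans)
  qed (rule sub un dj euler)+
qed

text \<open>Together with distinct origins this makes the boundary of a face a simple closed curve.
  The face \<open>[d0, rv d0]\<close> of a single piece is the kind that it rules out.\<close>

definition rvfree :: "'d list \<Rightarrow> bool" where
  "rvfree f \<longleftrightarrow> (\<forall>d\<in>set f. rv d \<notin> set f)"

text \<open>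
  Distinct regions of the plane are assigned distinct faces. Only this injection is needed to
  find, for a new ear, the face that it splits; that it is onto never matters.
\<close>

definition regional :: "'d set \<Rightarrow> 'd list set \<Rightarrow> bool" where
  "regional H Fs \<longleftrightarrow> (\<forall>f\<in>Fs. rvfree f) \<and>
     (\<exists>\<kappa>. inj_on \<kappa> (components (- U H)) \<and>
        (\<forall>R\<in>components (- U H). \<kappa> R \<in> Fs \<and> frontier R \<subseteq> U (set (\<kappa> R))))"

section \<open>Regions of the plane against facial lists\<close>

lemma U_Un: "U (X \<union> Y) = U X \<union> U Y" by (auto simp: U_def)

lemma U_rv: "U (rv ` X) = U X" by (auto simp: U_def im_rv)

lemma U_mono: "X \<subseteq> Y \<Longrightarrow> U X \<subseteq> U Y" by (auto simp: U_def)

lemma org_in_im: "d \<in> D0 \<Longrightarrow> org d \<in> im d" "d \<in> D0 \<Longrightarrow> org (rv d) \<in> im d"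
  using arc_set_ends im_arc by blast+

lemma closed_U: "H \<subseteq> D0 \<Longrightarrow> closed (U H)"
  unfolding U_def
  by (rule closed_UN) (use finite_subset[OF _ finite_D0] arc_set_compact[OF im_arc] in auto)

lemma ear_arc: "ear H x as y \<Longrightarrow> arc_set (U (set as)) x y"
  using path_arc[of as] unfolding ear_def by auto

lemma ear_meets:
  assumes "ear H x as y" "H \<subseteq> D0" "rv ` H \<subseteq> H"
  shows "U (set as) \<inter> U H \<subseteq> {x, y}"
proof
  fix z assume "z \<in> U (set as) \<inter> U H"
  then obtain a h where a: "a \<in> set as" "h \<in> H" "z \<in> im a" "z \<in> im h" by (auto simp: U_def)
  have as: "set as \<subseteq> D0 - H" "\<forall>a\<in>set (tl as). org a \<notin> org ` H" using assms(1) by (auto simp: ear_def)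
  have "a \<noteq> rv h" using a as assms(3) by auto
  then have "z \<in> {org a, org (rv a)} \<inter> {org h, org (rv h)}"
    using im_disj[of h a] a as assms(2) by auto
  moreover have "org (rv h) \<in> org ` H" using a assms(3) by auto
  ultimately have "z \<in> org ` H" "z \<in> org ` set as \<union> org ` rv ` set as" using a by auto
  moreover have "org ` set (tl as) \<inter> org ` H = {}" using as(2) by auto
  ultimately show "z \<in> {x, y}" unfolding ear_facts(3,4)[OF assms(1)] by blast
qed

lemma face_split:
  assumes "p \<in> set f" "q \<in> set f" "p \<noteq> q"
  obtains xs ys where "xs \<noteq> []" "ys \<noteq> []" "set (xs @ ys) = set f" "cyclic_steps (xs @ ys) = cyclic_steps f"
    "hd xs = p" "hd ys = q" "mset (xs @ ys) = mset f"
proof -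
  obtain A1 B1 where f: "f = A1 @ p # B1" using assms(1) by (meson split_list)
  have "q \<in> set (B1 @ A1)" using assms f by auto
  then obtain C1 C2 where C: "B1 @ A1 = C1 @ q # C2" by (meson split_list)
  have e: "(p # C1) @ (q # C2) = (p # B1) @ A1" using C by simp
  have "cyclic_steps ((p # B1) @ A1) = cyclic_steps f"
    using cyclic_steps_rotate[of "p # B1" A1] f by (cases "A1 = []") auto
  then show ?thesis
    by (intro that[of "p # C1" "q # C2"]) (use e f in \<open>auto simp del: append_Cons\<close>)
qed

lemma split_arcs:
  assumes f: "set (xs @ ys) \<subseteq> D0" "xs \<noteq> []" "ys \<noteq> []" "distinct (map org (xs @ ys))"
    "\<And>a b. (a, b) \<in> cyclic_steps (xs @ ys) \<Longrightarrow> org b = org (rv a)"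
    and rf: "rvfree (xs @ ys)"
    and xy: "org (hd xs) = x" "org (hd ys) = y"
  shows "arc_set (U (set xs)) x y" "arc_set (U (set ys)) y x" "U (set xs) \<inter> U (set ys) = {x, y}"
proof -
  have w: "walk xs" "walk ys" "org (rv (last xs)) = y" "org (rv (last ys)) = x"
    using f(5)[of "last xs" "hd ys"] f(5)[of "last ys" "hd xs"] f(5) xy
    unfolding cyclic_steps_append[OF f(2,3)] by (auto simp: walk_def)
  have d: "distinct (map org xs @ [y])" "distinct (map org ys @ [x])"
    using f(2,3,4) xy by (auto dest: hd_in_set)
  show 1: "arc_set (U (set xs)) x y" using path_arc[of xs] f(1,2) w d xy by simp
  show 2: "arc_set (U (set ys)) y x" using path_arc[of ys] f(1,3) w d xy by simp
  have ears: "ear {} x xs y" "ear {} y ys x"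
    unfolding ear_def using f(1,2,3) w d xy by simp_all
  have "set (tl xs) \<subseteq> set xs" "set (tl ys) \<subseteq> set ys" using f(2,3) by (meson list.set_sel(2) subsetI)+
  then have hx: "org ` rv ` set xs \<subseteq> insert y (org ` set xs)" "org ` rv ` set ys \<subseteq> insert x (org ` set ys)"
    unfolding ear_facts(3)[OF ears(1)] ear_facts(3)[OF ears(2)] by blast+
  show "U (set xs) \<inter> U (set ys) = {x, y}"
  proof
    show "{x, y} \<subseteq> U (set xs) \<inter> U (set ys)" using arc_set_ends[OF 1] arc_set_ends[OF 2] by auto
    show "U (set xs) \<inter> U (set ys) \<subseteq> {x, y}"
    proof
      fix z assume "z \<in> U (set xs) \<inter> U (set ys)"
      then obtain a b where a: "a \<in> set xs" "z \<in> im a" "b \<in> set ys" "z \<in> im b" by (auto simp: U_def)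
      have "a \<noteq> b" using f(4) a by (auto simp: distinct_map)
      moreover have "b \<noteq> rv a" using rf a by (auto simp: rvfree_def)
      ultimately have "z \<in> {org a, org (rv a)} \<inter> {org b, org (rv b)}"
        using im_disj[of a b] a f(1) by auto
      then have "z \<in> org ` set xs \<union> org ` rv ` set xs" "z \<in> org ` set ys \<union> org ` rv ` set ys" using a by auto
      moreover have "x \<in> org ` set xs" "y \<in> org ` set ys" using xy f(2,3) by (metis hd_in_set image_eqI)+
      ultimately have "z \<in> insert y (org ` set xs)" "z \<in> insert x (org ` set ys)" using hx by blast+
      then show "z \<in> {x, y}" using f(4) by auto
    qed
  qed
qed

text \<open>The interior of the ear is connected, so it lies in one region \<open>?R\<close>, and
  its ends are on the frontier of that region. Hence \<open>x\<close> and \<open>y\<close> are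
  corners of the face assigned to \<open>?R\<close>, and this face is split; the other regions keep
  theirs.\<close>

lemma regional_step:
  assumes cb: "facial H Fs" and tp: "regional H Fs" and ear: "ear H x as y" and xyH: "x \<in> org ` H" "y \<in> org ` H"
  shows "\<exists>Fs'. facial (H \<union> set as \<union> rv ` set as) Fs' \<and> regional (H \<union> set as \<union> rv ` set as) Fs'"
proof -
  have C1: "H \<subseteq> D0" and C2: "rv ` H \<subseteq> H" and C4: "\<Union>(set ` Fs) = H"
    and C5: "\<And>f. f \<in> Fs \<Longrightarrow> f \<noteq> [] \<and> distinct (map org f) \<and> (\<forall>(a, b)\<in>cyclic_steps f. org b = org (rv a))"
    using cb unfolding facial_def by simp_all
  obtain \<kappa> where chi: "inj_on \<kappa> (components (- U H))"
    "\<And>R. R \<in> components (- U H) \<Longrightarrow> \<kappa> R \<in> Fs \<and> frontier R \<subseteq> U (set (\<kappa> R))"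
    and rf: "\<And>f. f \<in> Fs \<Longrightarrow> rvfree f" using tp unfolding regional_def by blast
  let ?A = "U (set as)" let ?H = "H \<union> set as \<union> rv ` set as"
  have asD: "as \<noteq> []" "set as \<subseteq> D0 - H" using ear by (auto simp: ear_def)
  have arcA: "arc_set ?A x y" using ear_arc[OF ear] .
  have AH: "?A \<inter> U H \<subseteq> {x, y}" using ear_meets[OF ear C1 C2] .
  have oU: "org h \<in> U H" if "h \<in> H" for h using org_in_im(1) that C1 by (auto simp: U_def)
  have xyU: "x \<in> U H" "y \<in> U H" using xyH oU by auto
  note intA = arc_set_interior[OF arcA] and intA' = arc_set_interior[OF arc_set_rev[OF arcA]]
  obtain a0 where a0: "a0 \<in> ?A - {x, y}" using intA(2) by blast
  let ?R = "connected_component_set (- U H) a0"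
  have A0: "?A - {x, y} \<subseteq> - U H" using AH by auto
  have R: "?R \<in> components (- U H)" using a0 A0 by (intro componentsI) auto
  have AR: "?A - {x, y} \<subseteq> ?R" by (rule connected_component_maximal[OF a0 intA(1) A0])
  define f where "f = \<kappa> ?R"
  have f: "f \<in> Fs" "frontier ?R \<subseteq> U (set f)" using chi(2)[OF R] by (auto simp: f_def)
  have fH: "set f \<subseteq> H" using f(1) C4 by auto
  note f5 = C5[OF f(1)]
  have RU: "?R \<inter> U H = {}" using connected_component_subset[of "- U H" a0] by auto
  have xyfr: "x \<in> frontier ?R" "y \<in> frontier ?R"
    using closure_mono[OF AR] intA(3) intA'(3) xyU RU interior_subset[of ?R]
    by (auto simp: frontier_def insert_commute)
  \<comment> \<open>A frontier point on the ear lies on a piece of \<open>f\<close>, and pieces of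
    the ear meet old pieces only in end points.\<close>
  have onf: "z \<in> org ` set f" if z: "z \<in> frontier ?R" "a \<in> set as" "z \<in> im a" for z a
  proof -
    obtain d where d: "d \<in> set f" "z \<in> im d" using z f(2) by (auto simp: U_def)
    have "d \<in> H" using d fH by auto
    then have "rv d \<in> H" using C2 by auto
    then have "a \<noteq> d" "a \<noteq> rv d" using \<open>d \<in> H\<close> z(2) asD by auto
    then have "z = org d \<or> z = org (rv d)"
      using im_disj[of d a] d z \<open>d \<in> H\<close> C1 asD by auto
    moreover have "org (rv d) \<in> org ` set f"
    proof -
      obtain p where p: "bij_betw p (set f) (set f)" "\<And>a b. (a, b) \<in> cyclic_steps f \<longleftrightarrow> a \<in> set f \<and> b = p a"
        using cyclic_steps_perm[of f] f5 by (auto simp: distinct_map)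
      then have "(d, p d) \<in> cyclic_steps f" "p d \<in> set f" using d by (auto simp: bij_betw_def)
      moreover from this have "org (p d) = org (rv d)" using f5 by auto
      ultimately show ?thesis by (metis imageI)
    qed
    ultimately show ?thesis using d by auto
  qed
  have hl: "hd as \<in> set as" "last as \<in> set as" "org (hd as) = x" "org (rv (last as)) = y" "x \<noteq> y"
    using ear asD arc_set_ends[OF arcA] by (auto simp: ear_def)
  have xim: "x \<in> im (hd as)" "y \<in> im (last as)"
  proof -
    have "hd as \<in> D0" "last as \<in> D0" using hl(1,2) asD(2) by blast+
    then show "x \<in> im (hd as)" "y \<in> im (last as)"
      using org_in_im(1)[of "hd as"] org_in_im(2)[of "last as"] hl(3,4) by simp_all
  qed
  obtain p q where pq: "p \<in> set f" "org p = x" "q \<in> set f" "org q = y"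
    using onf[OF xyfr(1) hl(1) xim(1)] onf[OF xyfr(2) hl(2) xim(2)] by auto
  have "p \<noteq> q" using pq hl by auto
  from face_split[OF pq(1,3) this] obtain xs ys where xs: "xs \<noteq> []" "ys \<noteq> []" "set (xs @ ys) = set f"
    "cyclic_steps (xs @ ys) = cyclic_steps f" "hd xs = p" "hd ys = q" "mset (xs @ ys) = mset f" .
  have ho: "org (hd xs) = x" "org (hd ys) = y" using xs pq by auto
  have dxy: "distinct (map org (xs @ ys))"
    using f5 xs(7) by (metis mset_eq_imp_distinct_iff mset_map)
  have rfxy: "rvfree (xs @ ys)" using rf[OF f(1)] xs(3) by (simp add: rvfree_def)
  let ?c1 = "U (set xs)" and ?c2 = "U (set ys)" let ?bs = "rev (map rv as)"
  have xyD: "set (xs @ ys) \<subseteq> D0" using xs(3) fH C1 by auto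
  have csf: "org b = org (rv a)" if "(a, b) \<in> cyclic_steps (xs @ ys)" for a b using f5 xs(4) that by auto
  note arcs = split_arcs[OF xyD xs(1,2) dxy csf rfxy ho]
  let ?Fs = "insert (xs @ ?bs) (insert (ys @ as) (Fs - {f}))"
  have comb': "facial ?H ?Fs" by (rule facial_step[OF cb f(1) xs(1-4) dxy ho ear])
  have cf: "U (set f) = ?c1 \<union> ?c2" using xs(3) U_Un by (metis set_append)
  have cH: "?c1 \<union> ?c2 \<subseteq> U H" using U_mono[OF fH] cf by simp
  have loop: "loop_set (?c1 \<union> ?c2)" by (rule loop_set_join[OF arcs(1,2)]) (use arcs in auto)
  have loop1: "loop_set (?c1 \<union> ?A)"
    by (rule loop_set_join[OF arcs(1) arc_set_rev[OF arcA]]) (use cH AH in auto)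
  have loop2: "loop_set (?c2 \<union> ?A)"
    by (rule loop_set_join[OF arcs(2) arcA]) (use cH AH in auto)
  have UH: "U ?H = U H \<union> ?A" by (simp add: U_Un U_rv)
  have ls: "U (set (xs @ ?bs)) = ?c1 \<union> ?A" "U (set (ys @ as)) = ?c2 \<union> ?A"
    by (simp_all add: U_Un U_rv)
  have clH: "closed (U H)" "closed (U H \<union> ?A)"
    using closed_U[OF C1] arc_set_compact[OF arcA] by auto
  have RC: "?R \<in> components (- (?c1 \<union> ?c2))"
    by (rule component_if_frontier)
      (use f(2) cf cH RU a0 AR in \<open>auto simp: connected_connected_component\<close>)
  \<comment> \<open>A new region lies in \<open>?R\<close> and is bounded by the theta curve formed
    by the boundary of \<open>f\<close> and the ear, so the lemmas on theta curves apply to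
    it.\<close>
  have other: "S \<subseteq> ?R \<and> S \<in> components (- (?c1 \<union> ?c2 \<union> ?A))"
    if S: "S \<in> components (- U ?H)" "S \<notin> components (- U H)" for S
  proof -
    have S0: "S \<inter> (U H \<union> ?A) = {}" "S \<noteq> {}" "connected S"
      using in_components_subset[OF S(1)] in_components_nonempty[OF S(1)] in_components_connected[OF S(1)] UH
      by auto
    then obtain s where s: "s \<in> S" by auto
    let ?T = "connected_component_set (- U H) s"
    have ST: "S \<subseteq> ?T" by (rule connected_component_maximal[OF s S0(3)]) (use S0 in auto)
    have T: "?T \<in> components (- U H)" using s S0 by (intro componentsI) auto
    have "?T = ?R"
    proof (rule ccontr)
      assume ne: "?T \<noteq> ?R"
      have "?T \<inter> ?R = {}" using components_nonoverlap[OF T R] ne by simp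
      then have "?T \<inter> ?A = {}" using AR xyU in_components_subset[OF T] by blast
      then have "?T \<subseteq> - U ?H" using in_components_subset[OF T] UH by auto
      then have "?T \<subseteq> S"
        using components_maximal[OF S(1) in_components_connected[OF T]] s ST by blast
      then show False using S(2) T ST by simp
    qed
    then have SR: "S \<subseteq> ?R" using ST by simp
    have "frontier S \<subseteq> U H \<union> ?A"
      using frontier_of_components_closed_complement[OF clH(2)] S(1) UH by auto
    moreover have "frontier S \<subseteq> ?R \<union> (?c1 \<union> ?c2)"
    proof -
      have "frontier S \<subseteq> closure ?R" using closure_mono[OF SR] by (auto simp: frontier_def)
      also have "\<dots> \<subseteq> ?R \<union> frontier ?R"
        using interior_subset[of ?R] by (auto simp: frontier_def)
      finally show ?thesis using f(2) cf by auto
    qed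
    ultimately have "frontier S \<subseteq> ?c1 \<union> ?c2 \<union> ?A" using RU by blast
    then have "S \<in> components (- (?c1 \<union> ?c2 \<union> ?A))"
      by (intro component_if_frontier) (use S0 cH in auto)
    then show ?thesis using SR by simp
  qed
  have front: "frontier S \<subseteq> ?c1 \<union> ?A \<or> frontier S \<subseteq> ?c2 \<union> ?A"
    if S: "S \<in> components (- U ?H)" "S \<notin> components (- U H)" for S
    by (rule theta_frontier[OF loop _ _ arcs(3) RC arcA AR])
      (use other[OF S] arc_set_compact[OF arcs(1)] arc_set_compact[OF arcs(2)] in auto)
  have uniq1: "S1 = S2"
    if S: "S1 \<in> components (- U ?H)" "S1 \<notin> components (- U H)" "S2 \<in> components (- U ?H)" "S2 \<notin> components (- U H)"
      "frontier S1 \<subseteq> ?c1 \<union> ?A" "frontier S2 \<subseteq> ?c1 \<union> ?A" for S1 S2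
    by (rule theta_unique[OF loop loop1 arcs(3) RC AR]) (use other S in auto)
  have uniq2: "S1 = S2"
    if S: "S1 \<in> components (- U ?H)" "S1 \<notin> components (- U H)" "S2 \<in> components (- U ?H)" "S2 \<notin> components (- U H)"
      "frontier S1 \<subseteq> ?c2 \<union> ?A" "frontier S2 \<subseteq> ?c2 \<union> ?A" for S1 S2
  proof -
    have comm: "?c2 \<union> ?c1 = ?c1 \<union> ?c2" "?c2 \<inter> ?c1 = {x, y}" using arcs(3) by auto
    show ?thesis
      by (rule theta_unique[of ?c2 ?c1 ?A x y ?R], unfold comm(1))
        (use other S loop loop2 RC AR comm(2) in auto)
  qed
  \<comment> \<open>If both inclusions of \<open>front\<close> hold, \<open>ys @ as\<close> is
    chosen; \<open>uniq1\<close> and \<open>uniq2\<close> still give injectivity.\<close>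
  define chi' where "chi' S = (if S \<in> components (- U H) then \<kappa> S
     else if frontier S \<subseteq> ?c2 \<union> ?A then ys @ as else xs @ ?bs)" for S
  have sub: "g \<in> Fs \<Longrightarrow> set g \<subseteq> H" for g using C4 by auto
  have asH: "a \<in> set as \<Longrightarrow> rv a \<notin> H" for a using asD C2 by (metis DiffD2 image_eqI rv_rv subsetD)
  have new: "ys @ as \<notin> Fs" "xs @ ?bs \<notin> Fs"
  proof -
    have "hd as \<notin> H" using hl(1) asD(2) by blast
    moreover have "hd as \<in> set (ys @ as)" "rv (hd as) \<in> set (xs @ ?bs)" using hl(1) by auto
    ultimately show "ys @ as \<notin> Fs" "xs @ ?bs \<notin> Fs"
      using sub[of "ys @ as"] sub[of "xs @ ?bs"] asH[OF hl(1)] by blast+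
  qed
  have nneq: "ys @ as \<noteq> xs @ ?bs"
  proof -
    have "hd ys \<noteq> hd xs" using pq xs hl by auto
    then show ?thesis using xs(1,2) by (metis hd_append2)
  qed
  have RA: "?R \<inter> ?A \<noteq> {}" using a0 AR by auto
  have "regional ?H ?Fs"
    unfolding regional_def
  proof (intro conjI exI[of _ chi'] ballI)
    fix g assume "g \<in> ?Fs"
    then consider "g = xs @ ?bs" | "g = ys @ as" | "g \<in> Fs" by blast
    then show "rvfree g"
    proof cases
      case 1
      have "rv d \<notin> set g" if "d \<in> set g" for d
      proof -
        consider "d \<in> set xs" | a where "a \<in> set as" "d = rv a" using \<open>d \<in> set g\<close> 1 by auto
        then show ?thesis
        proof cases
          case a: 1
          then have "d \<in> H" using xs(3) fH by auto
          then have "rv d \<notin> rv ` set as" using asD by (metis DiffD2 imageE rv_rv subsetD)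
          then show ?thesis using a 1 rfxy by (auto simp: rvfree_def)
        next
          case (2 a)
          have "a \<notin> set xs" using 2 asD xs(3) fH by auto
          moreover have "a \<notin> rv ` set as" using 2 ear_facts(2)[OF ear] by auto
          ultimately show ?thesis using 1 2 by auto
        qed
      qed
      then show ?thesis by (simp add: rvfree_def)
    next
      case 2
      have "rv d \<notin> set g" if "d \<in> set g" for d
      proof -
        consider "d \<in> set ys" | "d \<in> set as" using \<open>d \<in> set g\<close> 2 by auto
        then show ?thesis
        proof cases
          case a: 1
          then have "rv d \<in> H" using xs(3) fH C2 by auto
          then have "rv d \<notin> set as" using asD by auto
          then show ?thesis using a 2 rfxy by (auto simp: rvfree_def)
        next
          case a: 2
          have "rv d \<notin> set ys" using asH[OF a] xs(3) fH by auto
          moreover have "rv d \<notin> set as" using ear_facts(2)[OF ear] a by auto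
          ultimately show ?thesis using 2 by auto
        qed
      qed
      then show ?thesis by (simp add: rvfree_def)
    next
      case 3
      then show ?thesis by (rule rf)
    qed
  next
    show "inj_on chi' (components (- U ?H))"
    proof
      fix S1 S2 assume S: "S1 \<in> components (- U ?H)" "S2 \<in> components (- U ?H)" "chi' S1 = chi' S2"
      show "S1 = S2"
      proof (cases "S1 \<in> components (- U H)")
        case 1: True
        show ?thesis
        proof (cases "S2 \<in> components (- U H)")
          case True
          then show ?thesis using 1 S(3) chi(1) by (auto simp: chi'_def inj_on_def)
        next
          case False
          then show ?thesis using 1 S(3) chi(2)[OF 1] new by (auto simp: chi'_def split: if_splits)
        qed
      next
        case 1: False
        show ?thesis
        proof (cases "S2 \<in> components (- U H)")
          case True
          then show ?thesis using 1 S(3) chi(2)[OF True] new by (auto simp: chi'_def split: if_splits)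
        next
          case 2: False
          have iff: "frontier S1 \<subseteq> ?c2 \<union> ?A \<longleftrightarrow> frontier S2 \<subseteq> ?c2 \<union> ?A"
            using S(3) 1 2 nneq nneq[symmetric] unfolding chi'_def by (metis (full_types))
          show ?thesis
          proof (cases "frontier S1 \<subseteq> ?c2 \<union> ?A")
            case True
            then show ?thesis using uniq2[OF S(1) 1 S(2) 2] iff by simp
          next
            case False
            then show ?thesis using uniq1[OF S(1) 1 S(2) 2] iff front[OF S(1) 1] front[OF S(2) 2] by blast
          qed
        qed
      qed
    qed
  next
    fix S assume S: "S \<in> components (- U ?H)"
    show "chi' S \<in> ?Fs"
    proof (cases "S \<in> components (- U H)")
      case True
      have "S \<inter> ?A = {}" using in_components_subset[OF S] UH by auto
      then have "S \<noteq> ?R" using RA by auto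
      then have "\<kappa> S \<noteq> f" using chi(1) True R unfolding f_def by (metis inj_onD)
      then show ?thesis using chi(2)[OF True] True by (simp add: chi'_def)
    qed (simp add: chi'_def)
    show "frontier S \<subseteq> U (set (chi' S))"
    proof (cases "S \<in> components (- U H)")
      case True
      then show ?thesis using chi(2) by (simp add: chi'_def)
    next
      case False
      then show ?thesis using front[OF S False] ls by (auto simp: chi'_def)
    qed
  qed
  then show ?thesis using comb' by blast
qed

text \<open>A single piece already satisfies \<open>facial\<close>, but its face runs along both of
  its sides. The first ear closes it to a Jordan curve with two regions and two faces, where
  \<open>regional\<close> can start.\<close>

lemma regional_base:
  assumes d0: "d0 \<in> D0" and ear: "ear {d0, rv d0} (org d0) as (org (rv d0))"
  shows "\<exists>Fs. facial ({d0, rv d0} \<union> set as \<union> rv ` set as) Fs \<and> regional ({d0, rv d0} \<union> set as \<union> rv ` set as) Fs"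
proof -
  let ?H = "{d0, rv d0}" let ?bs = "rev (map rv as)" let ?A = "U (set as)"
  have ne: "org d0 \<noteq> org (rv d0)" "rv d0 \<noteq> d0" using org_ne rv_ne d0 by auto
  have cs0: "cyclic_steps [d0, rv d0] = {(rv d0, d0), (d0, rv d0)}" by (auto simp: cyclic_steps_def steps_def)
  have cb: "facial ?H {[d0, rv d0]}"
    unfolding facial_def using d0 rv_D0 ne by (auto simp: cs0)
  have "facial (?H \<union> set as \<union> rv ` set as) (insert ([d0] @ ?bs) (insert ([rv d0] @ as) ({[d0, rv d0]} - {[d0, rv d0]})))"
    by (rule facial_step[OF cb _ _ _ _ _ _ _ _ ear]) (use ne in auto)
  then have cb': "facial (?H \<union> set as \<union> rv ` set as) {[d0] @ ?bs, [rv d0] @ as}" by simp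
  have arcA: "arc_set ?A (org d0) (org (rv d0))" using ear_arc[OF ear] .
  have asD: "as \<noteq> []" "set as \<subseteq> D0 - ?H" using ear by (auto simp: ear_def)
  have "?A \<inter> U ?H \<subseteq> {org d0, org (rv d0)}" by (rule ear_meets[OF ear]) (use d0 rv_D0 in auto)
  then have "loop_set (im d0 \<union> ?A)"
    by (intro loop_set_join[OF im_arc[OF d0] arc_set_rev[OF arcA]]) (auto simp: U_def)
  then obtain I J where IJ: "components (- (im d0 \<union> ?A)) = {I, J}" "I \<noteq> J"
    "frontier I = im d0 \<union> ?A" "frontier J = im d0 \<union> ?A" using loop_components by metis
  have UH: "U (?H \<union> set as \<union> rv ` set as) = im d0 \<union> ?A" by (simp add: U_Un U_rv) (simp add: U_def im_rv)
  have Ul: "U (set ([d0] @ ?bs)) = im d0 \<union> ?A" "U (set ([rv d0] @ as)) = im d0 \<union> ?A"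
  proof -
    show "U (set ([d0] @ ?bs)) = im d0 \<union> ?A" using U_Un[of "{d0}" "rv ` set as"] by (simp add: U_rv) (simp add: U_def)
    show "U (set ([rv d0] @ as)) = im d0 \<union> ?A" using U_Un[of "{rv d0}" "set as"] by (simp add: U_def im_rv)
  qed
  have ash: "rv a \<noteq> d0 \<and> rv a \<noteq> rv d0 \<and> a \<noteq> d0 \<and> a \<noteq> rv d0" if "a \<in> set as" for a
    using that asD rv_rv by (metis DiffD2 insertI1 insertI2 singletonI subsetD)
  have rr: "rv a \<notin> set as" if "a \<in> set as" for a using ear_facts(2)[OF ear] that by auto
  have "regional (?H \<union> set as \<union> rv ` set as) {[d0] @ ?bs, [rv d0] @ as}"
    unfolding regional_def UH IJ(1)
  proof (intro conjI exI[of _ "\<lambda>S. if S = I then [d0] @ ?bs else [rv d0] @ as"] ballI)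
    fix g assume "g \<in> {[d0] @ ?bs, [rv d0] @ as}"
    then have "set g = insert d0 (rv ` set as) \<or> set g = insert (rv d0) (set as)" by auto
    moreover have "rv a = rv b \<longleftrightarrow> a = b" for a b by (metis rv_rv)
    moreover have "a \<notin> rv ` set as" if "a \<in> set as" for a using rr that by auto
    moreover have "d0 \<notin> set as" "rv d0 \<notin> set as" using asD(2) by auto
    ultimately show "rvfree g" using ash rr ne(2) ne(2)[symmetric] unfolding rvfree_def by auto
  next
    show "inj_on (\<lambda>S. if S = I then [d0] @ ?bs else [rv d0] @ as) {I, J}"
      using IJ(2) ne by (auto simp: inj_on_def)
  qed (use IJ Ul in \<open>auto split: if_splits\<close>)
  then show ?thesis using cb' by blast
qed

text \<open>No part of the map is attached to the rest in fewer than two points.\<close>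

definition nonseparable :: "'d set \<Rightarrow> bool" where
  "nonseparable D \<longleftrightarrow> (\<forall>K. K \<subseteq> D \<longrightarrow> rv ` K \<subseteq> K \<longrightarrow> K \<noteq> {} \<longrightarrow> K \<noteq> D \<longrightarrow> 2 \<le> card (org ` K \<inter> org ` (D - K)))"

text \<open>If the path has already visited \<open>org (rv d)\<close> it is cut there, otherwise
  \<open>d\<close> is appended.\<close>

lemma ear_extend:
  assumes ear: "ear H x as v" and v: "v \<notin> org ` H" and d: "d \<in> D0 - H" "org d = v" "org (rv d) \<noteq> x"
  shows "\<exists>as'. ear H x as' (org (rv d)) \<and> set as' \<subseteq> insert d (set as)"
proof -
  have e: "as \<noteq> []" "set as \<subseteq> D0 - H" "walk as" "org (hd as) = x" "org (rv (last as)) = v"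
    "distinct (map org as @ [v])" "\<forall>a\<in>set (tl as). org a \<notin> org ` H" using ear by (auto simp: ear_def)
  show ?thesis
  proof (cases "org (rv d) \<in> org ` set as")
    case True
    then obtain a where a: "a \<in> set as" "org a = org (rv d)" by auto
    then obtain as1 as2 where as: "as = as1 @ a # as2" by (meson split_list)
    have ne: "as1 \<noteq> []" using as e(4) a(2) d(3) by (cases as1) auto
    have "(last as1, a) \<in> steps as" using as steps_append[OF ne, of "a # as2"] by simp
    then have "org (rv (last as1)) = org a" using e(3) by (auto simp: walk_def)
    moreover have "walk as1" using e(3) as steps_append[OF ne, of "a # as2"] by (auto simp: walk_def)
    moreover have "distinct (map org as1 @ [org a])" using e(6) as by auto
    moreover have "set (tl as1) \<subseteq> set (tl as)" using as ne by (cases as1) auto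
    moreover have "hd as1 = hd as" using as ne by simp
    ultimately have "ear H x as1 (org (rv d))" using e ne as a(2) by (auto simp: ear_def)
    then show ?thesis using as by (intro exI[of _ as1]) auto
  next
    case False
    have "walk (as @ [d])" using e(1,3,5) d(2) steps_append[OF e(1), of "[d]"] by (auto simp: walk_def)
    moreover have "distinct (map org (as @ [d]) @ [org (rv d)])"
      using e(6) d False org_ne[of d] by auto
    ultimately have "ear H x (as @ [d]) (org (rv d))"
      using e d v by (auto simp: ear_def)
    then show ?thesis by (intro exI[of _ "as @ [d]"]) auto
  qed
qed

text \<open>If no ear existed, the part reachable from one point \<open>?x\<close> of
  \<open>H\<close> without returning to \<open>H\<close> would be attached to the rest at
  \<open>?x\<close> alone, against \<open>nonseparable\<close>.\<close>

lemma ear_exists: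
  assumes D: "D \<subseteq> D0" "rv ` D \<subseteq> D" "nonseparable D" and H: "H \<subseteq> D" "rv ` H \<subseteq> H" "H \<noteq> {}" "H \<noteq> D"
  shows "\<exists>as x y. ear H x as y \<and> set as \<subseteq> D \<and> x \<in> org ` H \<and> y \<in> org ` H"
proof (rule ccontr)
  assume no: "\<not> ?thesis"
  have "2 \<le> card (org ` H \<inter> org ` (D - H))" using D(3) H unfolding nonseparable_def by blast
  then have "org ` H \<inter> org ` (D - H) \<noteq> {}" by (intro notI) simp
  then obtain z where z: "z \<in> org ` H" "z \<in> org ` (D - H)" by blast
  from z(2) obtain d0 where "d0 \<in> D - H" "z = org d0" by (rule imageE) simp
  then have d0: "d0 \<in> D - H" "org d0 \<in> org ` H" using z(1) by simp_all
  let ?x = "org d0"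
  \<comment> \<open>Points off \<open>H\<close> reached from \<open>?x\<close> by paths whose inner
    points avoid \<open>H\<close>; \<open>K\<close> collects the pieces at these points and the
    initial piece \<open>d0\<close>.\<close>
  define W where "W = {v. v \<notin> org ` H \<and> (\<exists>as. ear H ?x as v \<and> set as \<subseteq> D)}"
  define K where "K = {d \<in> D - H. org d \<in> W \<or> org (rv d) \<in> W \<or> d = d0 \<or> d = rv d0}"
  have rvH: "rv d \<in> D - H" if "d \<in> D - H" for d using that D(2) H(2) by (metis DiffD1 DiffD2 DiffI image_eqI rv_rv subsetD)
  have K: "K \<subseteq> D" "K \<noteq> {}" "K \<noteq> D" using d0 H(1,3) by (auto simp: K_def)
  have rvK: "rv ` K \<subseteq> K"
  proof (rule image_subsetI)
    fix d assume d: "d \<in> K"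
    then have "rv d \<in> D - H" using rvH by (simp add: K_def)
    moreover have "org (rv d) \<in> W \<or> org (rv (rv d)) \<in> W \<or> rv d = d0 \<or> rv d = rv d0"
      using d unfolding K_def by auto
    ultimately show "rv d \<in> K" unfolding K_def by blast
  qed
  have "org ` K \<inter> org ` (D - K) \<subseteq> {?x}"
  proof
    fix z assume "z \<in> org ` K \<inter> org ` (D - K)"
    then obtain d d' where d: "d \<in> K" "z = org d" and d': "d' \<in> D - K" "z = org d'" by auto
    show "z \<in> {?x}"
    proof (rule ccontr)
      assume zx: "z \<notin> {?x}"
      have dK: "d \<in> D - H" using d by (simp add: K_def)
      have "\<exists>as. ear H ?x as z \<and> set as \<subseteq> D"
      proof -
        consider "z \<in> W" | "org (rv d) \<in> W" | "d = rv d0" using d zx by (auto simp: K_def)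
        then show ?thesis
        proof cases
          case 1 then show ?thesis by (auto simp: W_def)
        next
          case 2
          then obtain as where "ear H ?x as (org (rv d))" "set as \<subseteq> D" "org (rv d) \<notin> org ` H" by (auto simp: W_def)
          then show ?thesis using ear_extend[of H ?x as "org (rv d)" "rv d"] rvH[OF dK] D(1) d zx by fastforce
        next
          case 3
          have "ear H ?x [d0] z" using d0 D(1) d 3 zx by (auto simp: ear_def walk_def)
          then show ?thesis using d0 by (intro exI[of _ "[d0]"]) auto
        qed
      qed
      then obtain as where as: "ear H ?x as z" "set as \<subseteq> D" by blast
      then have "z \<notin> org ` H" using no d0 by blast
      then have "z \<in> W" using as by (auto simp: W_def)
      then have "d' \<in> K" using d' \<open>z \<notin> org ` H\<close> by (auto simp: K_def)
      then show False using d' by simp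
    qed
  qed
  then have "card (org ` K \<inter> org ` (D - K)) \<le> 1" using card_mono[of "{?x}"] by force
  moreover have "2 \<le> card (org ` K \<inter> org ` (D - K))" using D(3) K rvK unfolding nonseparable_def by blast
  ultimately show False by simp
qed

text \<open>Take a largest subset that carries matching faces and regions; by
  \<open>ear_exists\<close> and \<open>regional_step\<close> a proper subset could be
  enlarged.\<close>

lemma nonseparable_faces:
  assumes D: "D \<subseteq> D0" "rv ` D \<subseteq> D" "nonseparable D" and d0: "d0 \<in> D" "D \<noteq> {d0, rv d0}"
  shows "\<exists>Fs. facial D Fs"
proof -
  define M where "M = {H. H \<subseteq> D \<and> (\<exists>Fs. facial H Fs \<and> regional H Fs)}"
  have finM: "finite M" unfolding M_def using finite_subset[OF D(1) finite_D0] by auto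
  have ins: "H \<union> set as \<union> rv ` set as \<subseteq> D" if "H \<subseteq> D" "set as \<subseteq> D" for H as
    using that D(2) by auto
  have "M \<noteq> {}"
  proof -
    have "{d0, rv d0} \<subseteq> D" using d0 D(2) by auto
    then obtain as x y where a: "ear {d0, rv d0} x as y" "set as \<subseteq> D" "x \<in> org ` {d0, rv d0}" "y \<in> org ` {d0, rv d0}"
      using ear_exists[OF D, of "{d0, rv d0}"] d0 by auto
    have "x \<noteq> y" using ear_facts(6)[OF a(1)] .
    have "\<exists>e\<in>D0. {e, rv e} = {d0, rv d0} \<and> x = org e \<and> y = org (rv e)"
    proof (cases "x = org d0")
      case True
      then show ?thesis using a(4) \<open>x \<noteq> y\<close> d0 D(1) by (intro bexI[of _ d0]) auto
    next
      case False
      then show ?thesis using a(3,4) \<open>x \<noteq> y\<close> d0 D(1) rv_D0 by (intro bexI[of _ "rv d0"]) auto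
    qed
    then obtain e where e: "{e, rv e} = {d0, rv d0}" "x = org e" "y = org (rv e)" "e \<in> D0" by blast
    then have "\<exists>Fs. facial ({d0, rv d0} \<union> set as \<union> rv ` set as) Fs \<and> regional ({d0, rv d0} \<union> set as \<union> rv ` set as) Fs"
      using regional_base[OF e(4), of as] a(1) unfolding e by simp
    then show ?thesis unfolding M_def using ins[OF \<open>{d0, rv d0} \<subseteq> D\<close> a(2)] by blast
  qed
  then have "Max (card ` M) \<in> card ` M" using finM by (intro Max_in) auto
  then obtain H where H0: "H \<in> M" "Max (card ` M) = card H" by (rule imageE) simp
  have H: "H \<in> M" "\<And>H'. H' \<in> M \<Longrightarrow> card H' \<le> card H"
    using H0 finM Max_ge[of "card ` M"] by auto
  then obtain Fs where Fs: "H \<subseteq> D" "facial H Fs" "regional H Fs" by (auto simp: M_def)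
  have "H = D"
  proof (rule ccontr)
    assume ne: "H \<noteq> D"
    have rvH: "rv ` H \<subseteq> H" and c4: "\<Union>(set ` Fs) = H" "card H + 4 \<le> 2 * card Fs + 2 * card (org ` H)" using Fs(2) by (auto simp: facial_def)
    have Hne: "H \<noteq> {}"
    proof
      assume "H = {}"
      then have "Fs \<subseteq> {[]}" using c4(1) by auto
      then have "card Fs \<le> 1" using card_mono[of "{[]}" Fs] by simp
      then show False using c4(2) \<open>H = {}\<close> by simp
    qed
    from ear_exists[OF D Fs(1) rvH Hne ne]
    obtain as x y where a: "ear H x as y" "set as \<subseteq> D" "x \<in> org ` H" "y \<in> org ` H"
      by (elim exE conjE)
    let ?H = "H \<union> set as \<union> rv ` set as"
    have "?H \<in> M" using regional_step[OF Fs(2,3) a(1,3,4)] ins[OF Fs(1) a(2)] by (auto simp: M_def)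
    moreover have "hd as \<in> set as" "set as \<inter> H = {}" using a(1) by (auto simp: ear_def)
    then have "H \<subset> ?H" by blast
    moreover have "finite ?H" using finite_subset[OF D(1) finite_D0] finite_subset[OF Fs(1)] by auto
    ultimately show False using H(2) psubset_card_mono by (metis leD)
  qed
  then show ?thesis using Fs by blast
qed

section \<open>From facial lists to face permutations\<close>

definition rot :: "('d \<Rightarrow> 'd) \<Rightarrow> 'd set \<Rightarrow> 'd \<Rightarrow> 'd" where
  "rot \<phi> H x = (if x \<in> H then \<phi> (rv x) else x)"

definition map_ok :: "'d set \<Rightarrow> ('d \<Rightarrow> 'd) \<Rightarrow> bool" where
  "map_ok D \<phi> \<longleftrightarrow> \<phi> permutes D \<and> (\<forall>d\<in>D. org (\<phi> d) = org (rv d))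
     \<and> (\<forall>d\<in>D. \<forall>d'\<in>D. org d = org d' \<longrightarrow> orbit (rot \<phi> D) d = orbit (rot \<phi> D) d')
     \<and> card D + 4 \<le> 2 * card (orbs \<phi> D) + 2 * card (org ` D)"

lemma rot_permutes:
  assumes "\<phi> permutes D" "rv ` D \<subseteq> D" "finite D"
  shows "rot \<phi> D permutes D"
proof (rule bij_imp_permutes)
  have "inj_on (rot \<phi> D) D"
    by (rule inj_onI) (metis assms(1) permutes_inj injD rot_def rv_rv)
  moreover have "rot \<phi> D ` D \<subseteq> D" using assms(1,2) by (auto simp: rot_def permutes_in_image)
  ultimately show "bij_betw (rot \<phi> D) D D"
    by (simp add: assms(3) bij_betw_def endo_inj_surj)
qed (simp add: rot_def)

lemma facial_map:
  assumes cb: "facial D Fs"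
  shows "\<exists>\<phi>. map_ok D \<phi>"
proof -
  have C1: "D \<subseteq> D0" and C2: "rv ` D \<subseteq> D" and C3: "finite Fs" and C4: "\<Union>(set ` Fs) = D"
    and C5: "\<And>f. f \<in> Fs \<Longrightarrow> f \<noteq> [] \<and> distinct (map org f) \<and> (\<forall>(a, b)\<in>cyclic_steps f. org b = org (rv a))"
    and C6: "\<And>f g. f \<in> Fs \<Longrightarrow> g \<in> Fs \<Longrightarrow> f \<noteq> g \<Longrightarrow> set f \<inter> set g = {}"
    and C7: "\<And>d d'. d \<in> D \<Longrightarrow> d' \<in> D \<Longrightarrow> org d = org d' \<Longrightarrow> (d, d') \<in> turn_related Fs"
    and C8: "card D + 4 \<le> 2 * card Fs + 2 * card (org ` D)"
    using cb unfolding facial_def by simp_all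
  have finD: "finite D" using C1 finite_D0 finite_subset by auto
  have "\<forall>f\<in>Fs. \<exists>p. bij_betw p (set f) (set f) \<and> (\<forall>a b. (a, b) \<in> cyclic_steps f \<longleftrightarrow> a \<in> set f \<and> b = p a)"
  proof
    fix f assume "f \<in> Fs"
    then have "distinct f" "f \<noteq> []" using C5 by (auto simp: distinct_map)
    then obtain p where "bij_betw p (set f) (set f)" "\<And>a b. (a, b) \<in> cyclic_steps f \<longleftrightarrow> a \<in> set f \<and> b = p a"
      by (rule cyclic_steps_perm) simp
    then show "\<exists>p. bij_betw p (set f) (set f) \<and> (\<forall>a b. (a, b) \<in> cyclic_steps f \<longleftrightarrow> a \<in> set f \<and> b = p a)"
      by (intro exI[of _ p]) simp
  qed
  from bchoice[OF this] obtain P where P0: "\<forall>f\<in>Fs. bij_betw (P f) (set f) (set f)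
      \<and> (\<forall>a b. (a, b) \<in> cyclic_steps f \<longleftrightarrow> a \<in> set f \<and> b = P f a)" by (rule exE)
  have P: "\<And>f. f \<in> Fs \<Longrightarrow> bij_betw (P f) (set f) (set f)"
    "\<And>f a b. f \<in> Fs \<Longrightarrow> (a, b) \<in> cyclic_steps f \<longleftrightarrow> a \<in> set f \<and> b = P f a"
    using P0 by simp_all
  define F where "F d = (THE f. f \<in> Fs \<and> d \<in> set f)" for d
  have F: "F d = f" if "f \<in> Fs" "d \<in> set f" for d f
    unfolding F_def using that C6 by (intro the_equality) blast+
  define \<phi> where "\<phi> d = (if d \<in> D then P (F d) d else d)" for d
  have ph: "\<phi> d = P f d" "\<phi> d \<in> set f" if "f \<in> Fs" "d \<in> set f" for d f
    using F[OF that] that C4 P(1)[OF that(1)] by (auto simp: \<phi>_def bij_betw_def)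
  have face: "\<exists>f\<in>Fs. d \<in> set f" if "d \<in> D" for d using that C4 by auto
  have "inj_on \<phi> D"
  proof
    fix a b assume ab: "a \<in> D" "b \<in> D" "\<phi> a = \<phi> b"
    obtain f g where fg: "f \<in> Fs" "a \<in> set f" "g \<in> Fs" "b \<in> set g" using face ab by blast
    then have "f = g" using ph(2)[OF fg(1,2)] ph(2)[OF fg(3,4)] C6 ab(3) by auto
    then show "a = b" using ph(1) fg ab(3) P(1)[OF fg(1)] by (auto simp: bij_betw_def dest: inj_onD)
  qed
  moreover have "\<phi> ` D \<subseteq> D" using face ph(2) C4 by blast
  ultimately have "bij_betw \<phi> D D" using finD by (simp add: bij_betw_def endo_inj_surj)
  then have perm: "\<phi> permutes D" by (rule bij_imp_permutes) (simp add: \<phi>_def)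
  have o: "org (\<phi> d) = org (rv d)" if "d \<in> D" for d
  proof -
    obtain f where f: "f \<in> Fs" "d \<in> set f" using face \<open>d \<in> D\<close> by blast
    then have "(d, \<phi> d) \<in> cyclic_steps f" using P(2) ph by auto
    then show ?thesis using C5[OF f(1)] by auto
  qed
  note rp = rot_permutes[OF perm C2 finD]
  have st: "orbit (rot \<phi> D) a = orbit (rot \<phi> D) b" if ab: "(a, b) \<in> turn Fs" for a b
  proof -
    obtain f where f: "f \<in> Fs" "(rv a, b) \<in> cyclic_steps f" using ab by (auto simp: turn_def)
    then have "rv a \<in> set f" "b = \<phi> (rv a)" using P(2) ph by auto
    moreover have "a \<in> D" using \<open>rv a \<in> set f\<close> f(1) C2 C4 by (metis UN_I image_subset_iff rv_rv)
    ultimately have "b = rot \<phi> D a" by (simp add: rot_def)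
    then show ?thesis using perm_orbit_step[OF finD rp] by simp
  qed
  have "orbit (rot \<phi> D) a = orbit (rot \<phi> D) b" if "(a, b) \<in> turn_related Fs" for a b
    using that by induction (use st in auto)
  then have tr: "\<forall>d\<in>D. \<forall>d'\<in>D. org d = org d' \<longrightarrow> orbit (rot \<phi> D) d = orbit (rot \<phi> D) d'"
    using C7 by blast
  have "card (set ` Fs) \<le> card (orbs \<phi> D)"
  proof (rule card_le_orbs_if_closed_partition[OF finD perm C4])
    show "disjoint (set ` Fs)" using C6 by (auto simp: disjoint_def)
    show "{} \<notin> set ` Fs" using C5 by auto
    show "\<phi> x \<in> Q" if "Q \<in> set ` Fs" "x \<in> Q" for Q x using that ph(2) by auto
  qed
  moreover have "inj_on set Fs"
  proof
    fix f g assume fg: "f \<in> Fs" "g \<in> Fs" "set f = set g"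
    show "f = g"
    proof (rule ccontr)
      assume "f \<noteq> g"
      then have "set f = {}" using C6[OF fg(1,2)] fg(3) by simp
      then show False using C5[OF fg(1)] by simp
    qed
  qed
  ultimately have "card Fs \<le> card (orbs \<phi> D)" by (simp add: card_image)
  then have eu: "card D + 4 \<le> 2 * card (orbs \<phi> D) + 2 * card (org ` D)" using C8 by linarith
  have "map_ok D \<phi>"
    unfolding map_ok_def by (intro conjI perm tr eu ballI o)
  then show ?thesis by blast
qed

text \<open>A single edge contains no cycle from which the ear construction could start, hence the
  separate case.\<close>

lemma nonseparable_map:
  assumes D: "D \<subseteq> D0" "rv ` D \<subseteq> D" "nonseparable D" "D \<noteq> {}"
  shows "\<exists>\<phi>. map_ok D \<phi>"
proof -
  obtain d0 where d0: "d0 \<in> D" using D(4) by auto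
  show ?thesis
  proof (cases "D = {d0, rv d0}")
    case False
    then show ?thesis using nonseparable_faces[OF D(1-3) d0] facial_map by blast
  next
    case True
    have ne: "org d0 \<noteq> org (rv d0)" "rv d0 \<noteq> d0" using org_ne rv_ne d0 D(1) by auto
    have cs0: "cyclic_steps [d0, rv d0] = {(rv d0, d0), (d0, rv d0)}" by (auto simp: cyclic_steps_def steps_def)
    have "facial D {[d0, rv d0]}"
      unfolding facial_def True using True D(1) ne by (auto simp: cs0)
    then show ?thesis by (rule facial_map)
  qed
qed

end

lemma orbit_funpow:
  assumes "a \<in> orbit f x" shows "\<exists>k. (f ^^ k) x = a"
  using assms unfolding orbit_altdef by blast

section \<open>Gluing maps along at most one common point\<close>

context plane_darts
begin

text \<open>
  If the two maps share a point, they are joined by exchanging two values of the face permutation.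
\<close>

lemma map_merge:
  assumes H: "H1 \<subseteq> D0" "H2 \<subseteq> D0" "rv ` H1 \<subseteq> H1" "rv ` H2 \<subseteq> H2" "H1 \<inter> H2 = {}"
    and m1: "map_ok H1 \<phi>1" and m2: "map_ok H2 \<phi>2" and sh: "card (org ` H1 \<inter> org ` H2) \<le> 1"
  shows "\<exists>\<phi>. map_ok (H1 \<union> H2) \<phi>"
proof -
  let ?H = "H1 \<union> H2"
  have fin: "finite H1" "finite H2" using H(1,2) finite_D0 finite_subset by auto
  have p1: "\<phi>1 permutes H1" and o1: "\<And>d. d \<in> H1 \<Longrightarrow> org (\<phi>1 d) = org (rv d)"
    and t1: "\<And>d d'. d \<in> H1 \<Longrightarrow> d' \<in> H1 \<Longrightarrow> org d = org d' \<Longrightarrow> orbit (rot \<phi>1 H1) d = orbit (rot \<phi>1 H1) d'"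
    and e1: "card H1 + 4 \<le> 2 * card (orbs \<phi>1 H1) + 2 * card (org ` H1)"
    using m1 unfolding map_ok_def by blast+
  have p2: "\<phi>2 permutes H2" and o2: "\<And>d. d \<in> H2 \<Longrightarrow> org (\<phi>2 d) = org (rv d)"
    and t2: "\<And>d d'. d \<in> H2 \<Longrightarrow> d' \<in> H2 \<Longrightarrow> org d = org d' \<Longrightarrow> orbit (rot \<phi>2 H2) d = orbit (rot \<phi>2 H2) d'"
    and e2: "card H2 + 4 \<le> 2 * card (orbs \<phi>2 H2) + 2 * card (org ` H2)"
    using m2 unfolding map_ok_def by blast+
  have r1: "rot \<phi>1 H1 permutes H1" and r2: "rot \<phi>2 H2 permutes H2"
    using rot_permutes p1 p2 H fin by auto
  have in1: "\<phi>1 d \<in> H1 \<longleftrightarrow> d \<in> H1" for d using p1 by (rule permutes_in_image)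
  have in2: "\<phi>2 d \<in> H2 \<longleftrightarrow> d \<in> H2" for d using p2 by (rule permutes_in_image)
  have rv1: "rv d \<in> H1 \<longleftrightarrow> d \<in> H1" for d using H(3) by (metis image_subset_iff rv_rv)
  have rv2: "rv d \<in> H2 \<longleftrightarrow> d \<in> H2" for d using H(4) by (metis image_subset_iff rv_rv)
  define \<phi> where "\<phi> d = (if d \<in> H1 then \<phi>1 d else \<phi>2 d)" for d
  have ph1: "\<phi> d = \<phi>1 d" if "d \<in> H1" for d using that by (simp add: \<phi>_def)
  have ph2: "\<phi> d = \<phi>2 d" if "d \<in> H2" for d using that H(5) by (auto simp: \<phi>_def)
  have "\<phi> = \<phi>1 \<circ> \<phi>2"
  proof
    fix d
    have "\<phi>2 d = d" if "d \<notin> H2" using p2 that by (simp add: permutes_def)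
    moreover have "\<phi>1 d = d" if "d \<notin> H1" for d using p1 that by (simp add: permutes_def)
    moreover have "d \<notin> H1" "\<phi>2 d \<notin> H1" if "d \<in> H2" using that in2[of d] H(5) by auto
    ultimately show "\<phi> d = (\<phi>1 \<circ> \<phi>2) d" unfolding \<phi>_def by (cases "d \<in> H2") auto
  qed
  then have ph: "\<phi> permutes ?H"
    using permutes_compose[OF permutes_subset[OF p2] permutes_subset[OF p1], of ?H] by simp
  have finH: "finite ?H" using fin by simp
  have sub1: "P \<subseteq> H1" if "P \<in> orbs \<phi>1 H1" for P using that Union_orbs[OF fin(1) p1] by blast
  have sub2: "P \<subseteq> H2" if "P \<in> orbs \<phi>2 H2" for P using that Union_orbs[OF fin(2) p2] by blast
  have ne: "P \<noteq> {}" if "P \<in> orbs \<psi> A" for P \<psi> and A :: "'d set" using that orbit_nonempty[of \<psi>] unfolding orbs_def by fast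
  have cF: "card (orbs \<phi>1 H1) + card (orbs \<phi>2 H2) \<le> card (orbs \<phi> ?H)"
  proof -
    have "orbs \<phi>1 H1 \<inter> orbs \<phi>2 H2 = {}"
    proof (rule ccontr)
      assume "\<not> ?thesis"
      then obtain P where P: "P \<in> orbs \<phi>1 H1" "P \<in> orbs \<phi>2 H2" by auto
      then show False using sub1[OF P(1)] sub2[OF P(2)] ne[OF P(1)] H(5) by blast
    qed
    then have "card (orbs \<phi>1 H1 \<union> orbs \<phi>2 H2) = card (orbs \<phi>1 H1) + card (orbs \<phi>2 H2)"
      using fin by (intro card_Un_disjoint) (auto simp: orbs_def)
    moreover have "card (orbs \<phi>1 H1 \<union> orbs \<phi>2 H2) \<le> card (orbs \<phi> ?H)"
    proof (rule card_le_orbs_if_closed_partition[OF finH ph])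
      show "\<Union> (orbs \<phi>1 H1 \<union> orbs \<phi>2 H2) = ?H" using Union_orbs[OF fin(1) p1] Union_orbs[OF fin(2) p2] by blast
      show "{} \<notin> orbs \<phi>1 H1 \<union> orbs \<phi>2 H2" using ne by blast
      show "disjoint (orbs \<phi>1 H1 \<union> orbs \<phi>2 H2)"
        unfolding disjoint_def
      proof (intro ballI impI)
        fix P Q assume PQ: "P \<in> orbs \<phi>1 H1 \<union> orbs \<phi>2 H2" "Q \<in> orbs \<phi>1 H1 \<union> orbs \<phi>2 H2" "P \<noteq> Q"
        then consider "P \<in> orbs \<phi>1 H1" "Q \<in> orbs \<phi>1 H1" | "P \<in> orbs \<phi>2 H2" "Q \<in> orbs \<phi>2 H2"
          | "P \<subseteq> H1" "Q \<subseteq> H2" | "P \<subseteq> H2" "Q \<subseteq> H1" using sub1 sub2 by blast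
        then show "P \<inter> Q = {}"
          by cases (use orbs_disjoint[OF fin(1) p1 _ _ PQ(3)] orbs_disjoint[OF fin(2) p2 _ _ PQ(3)] H(5) in blast)+
      qed
      show "\<phi> x \<in> P" if P: "P \<in> orbs \<phi>1 H1 \<union> orbs \<phi>2 H2" "x \<in> P" for P x
      proof (cases "P \<in> orbs \<phi>1 H1")
        case True
        then have "\<phi> x = \<phi>1 x" using sub1[OF True] P(2) ph1[of x] by blast
        then show ?thesis using True P(2) by (auto simp: orbs_def intro: orbit.step)
      next
        case False
        then have *: "P \<in> orbs \<phi>2 H2" using P by blast
        then have "\<phi> x = \<phi>2 x" using sub2[OF *] P(2) ph2[of x] by blast
        then show ?thesis using * P(2) by (auto simp: orbs_def intro: orbit.step)
      qed
    qed
    ultimately show ?thesis by simp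
  qed
  have cH: "card ?H = card H1 + card H2" using fin H(5) by (rule card_Un_disjoint)
  have cO: "card (org ` ?H) + card (org ` H1 \<inter> org ` H2) = card (org ` H1) + card (org ` H2)"
    using card_Un_Int[of "org ` H1" "org ` H2"] fin by (simp add: image_Un)
  have orb_tr: "orbit \<tau> y = orbit \<tau> x"
    if "y \<in> orbit \<sigma> x" "\<And>z. z \<in> orbit \<sigma> x \<or> z = x \<Longrightarrow> orbit \<tau> (\<sigma> z) = orbit \<tau> z" for \<tau> \<sigma> :: "'d \<Rightarrow> 'd" and x y
    using that(1)
  proof induction
    case base
    then show ?case using that(2) by simp
  next
    case (step y)
    then show ?case using that(2)[of y] by simp
  qed
  show ?thesis
  proof (cases "org ` H1 \<inter> org ` H2 = {}")
    case True
    have rp: "rot \<phi> ?H permutes ?H" by (rule rot_permutes[OF ph _ finH]) (use H in auto)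
    have *: "orbit (rot \<phi> ?H) d = orbit (rot \<phi> ?H) d'" if d: "d \<in> ?H" "d' \<in> ?H" "org d = org d'" for d d'
    proof -
      consider "d \<in> H1" "d' \<in> H1" | "d \<in> H2" "d' \<in> H2" using d True by blast
      then show ?thesis
      proof cases
        case 1
        have "d' \<in> orbit (rot \<phi>1 H1) d" using t1[OF 1 d(3)] perm_self_in_orbit[OF fin(1) r1] by simp
        moreover have "rot \<phi>1 H1 z = rot \<phi> ?H z" if "z \<in> orbit (rot \<phi>1 H1) d \<or> z = d" for z
          using that perm_orbit_subset[OF r1 1(1)] 1 ph1[of "rv z"] rv1[of z] by (auto simp: rot_def)
        ultimately show ?thesis using orb_tr[of d' _ d "rot \<phi> ?H"] perm_orbit_step[OF finH rp] by simp
      next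
        case 2
        have "d' \<in> orbit (rot \<phi>2 H2) d" using t2[OF 2 d(3)] perm_self_in_orbit[OF fin(2) r2] by simp
        moreover have "rot \<phi>2 H2 z = rot \<phi> ?H z" if "z \<in> orbit (rot \<phi>2 H2) d \<or> z = d" for z
          using that perm_orbit_subset[OF r2 2(1)] 2 ph2[of "rv z"] rv2[of z] by (auto simp: rot_def)
        ultimately show ?thesis using orb_tr[of d' _ d "rot \<phi> ?H"] perm_orbit_step[OF finH rp] by simp
      qed
    qed
    \<comment> \<open>Adding the two inequalities gives \<open>card ?H + 8\<close> on the left, so
      disjoint maps leave room to spare.\<close>
    have eu: "card ?H + 4 \<le> 2 * card (orbs \<phi> ?H) + 2 * card (org ` ?H)"
      using cF cH cO e1 e2 True by simp
    have "org (\<phi> d) = org (rv d)" if "d \<in> ?H" for d using that ph1 ph2 o1 o2 by auto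
    then have "map_ok ?H \<phi>" unfolding map_ok_def by (intro conjI ballI impI ph eu *) auto
    then show ?thesis by blast
  next
    case False
    then have c1: "card (org ` H1 \<inter> org ` H2) = 1" using sh fin by (simp add: le_Suc_eq)
    then obtain v where v: "org ` H1 \<inter> org ` H2 = {v}" by (rule card_1_singletonE)
    then have "v \<in> org ` H1" "v \<in> org ` H2" by auto
    then obtain a b where a: "a \<in> H1" "org a = v" and b: "b \<in> H2" "org b = v" by auto
    \<comment> \<open>The swap splices the rotation of the second map at \<open>v\<close> into that
      of the first right after \<open>a\<close>. One point and at most one face are lost, and the
      second constant 4 absorbs both.\<close>
    define \<psi> where "\<psi> = \<phi> \<circ> Transposition.transpose (rv a) (rv b)"
    have ab: "rv a \<in> ?H" "rv b \<in> ?H" using a b rv1 rv2 by auto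
    have ps: "\<psi> permutes ?H" unfolding \<psi>_def
      using permutes_compose[OF permutes_swap_id[OF ab] ph] by simp
    have psa: "\<psi> (rv a) = \<phi>2 (rv b)" "\<psi> (rv b) = \<phi>1 (rv a)"
      using ph1[of "rv a"] ph2[of "rv b"] a b rv1 rv2 by (simp_all add: \<psi>_def)
    have pso: "\<psi> d = \<phi> d" if "d \<noteq> rv a" "d \<noteq> rv b" for d using that by (simp add: \<psi>_def)
    have rp: "rot \<psi> ?H permutes ?H" by (rule rot_permutes[OF ps _ finH]) (use H in auto)
    let ?\<sigma> = "rot \<psi> ?H"
    note st = perm_orbit_step[OF finH rp]
    have neq: "z \<noteq> b" if "z \<in> H1" for z using that b H(5) by auto
    have neq': "z \<noteq> a" if "z \<in> H2" for z using that a H(5) by auto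
    have s1: "?\<sigma> z = rot \<phi>1 H1 z" if "z \<in> H1" "z \<noteq> a" for z
      using that neq[OF that(1)] pso[of "rv z"] ph1[of "rv z"] rv1 rv_rv by (auto simp: rot_def) (metis rv_rv)+
    have s2: "?\<sigma> z = rot \<phi>2 H2 z" if "z \<in> H2" "z \<noteq> b" for z
      using that neq'[OF that(1)] pso[of "rv z"] ph2[of "rv z"] rv2 rv_rv by (auto simp: rot_def) (metis rv_rv)+
    have sa: "?\<sigma> a = rot \<phi>2 H2 b" using psa a b by (simp add: rot_def)
    have i1: "rot \<phi>1 H1 z \<in> H1" if "z \<in> H1" for z using that permutes_in_image[OF r1] by blast
    have i2: "rot \<phi>2 H2 z \<in> H2" if "z \<in> H2" for z using that permutes_in_image[OF r2] by blast
    have k1: "orbit ?\<sigma> z = orbit ?\<sigma> a" if "z \<in> H1" "(rot \<phi>1 H1 ^^ k) z = a" for z k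
      using that
    proof (induction k arbitrary: z)
      case (Suc k)
      show ?case
      proof (cases "z = a")
        case False
        have "(rot \<phi>1 H1 ^^ k) (rot \<phi>1 H1 z) = a" using Suc(3) by (simp add: funpow_swap1)
        then have "orbit ?\<sigma> (rot \<phi>1 H1 z) = orbit ?\<sigma> a" using Suc.IH i1[OF Suc(2)] by blast
        then show ?thesis using st[of z] s1[OF Suc(2) False] by simp
      qed simp
    qed simp
    have k2: "orbit ?\<sigma> z = orbit ?\<sigma> b" if "z \<in> H2" "(rot \<phi>2 H2 ^^ k) z = b" for z k
      using that
    proof (induction k arbitrary: z)
      case (Suc k)
      show ?case
      proof (cases "z = b")
        case False
        have "(rot \<phi>2 H2 ^^ k) (rot \<phi>2 H2 z) = b" using Suc(3) by (simp add: funpow_swap1)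
        then have "orbit ?\<sigma> (rot \<phi>2 H2 z) = orbit ?\<sigma> b" using Suc.IH i2[OF Suc(2)] by blast
        then show ?thesis using st[of z] s2[OF Suc(2) False] by simp
      qed simp
    qed simp
    have "b \<in> orbit (rot \<phi>2 H2) (rot \<phi>2 H2 b)"
      using perm_orbit_step[OF fin(2) r2] perm_self_in_orbit[OF fin(2) r2] by simp
    then have "orbit ?\<sigma> (rot \<phi>2 H2 b) = orbit ?\<sigma> b" using k2[OF i2[OF b(1)]] orbit_funpow by metis
    then have eqab: "orbit ?\<sigma> a = orbit ?\<sigma> b" using st[of a] sa by simp
    have atv: "orbit ?\<sigma> d = orbit ?\<sigma> a" if d: "d \<in> ?H" "org d = v" for d
    proof (cases "d \<in> H1")
      case True
      then have "a \<in> orbit (rot \<phi>1 H1) d" using t1[OF True a(1)] a d perm_self_in_orbit[OF fin(1) r1] by simp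
      then show ?thesis using k1[OF True] orbit_funpow by metis
    next
      case False
      then have d2: "d \<in> H2" using d by auto
      then have "b \<in> orbit (rot \<phi>2 H2) d" using t2[OF d2 b(1)] b d perm_self_in_orbit[OF fin(2) r2] by simp
      then show ?thesis using k2[OF d2] orbit_funpow eqab by metis
    qed
    have *: "orbit ?\<sigma> d = orbit ?\<sigma> d'" if d: "d \<in> ?H" "d' \<in> ?H" "org d = org d'" for d d'
    proof (cases "org d = v")
      case True
      then show ?thesis using atv d by metis
    next
      case nv: False
      have sep: "\<not> (x \<in> H1 \<and> y \<in> H2)" if "org x = org y" "org x \<noteq> v" for x y
        using v that by (metis IntI imageI singletonD)
      then consider "d \<in> H1" "d' \<in> H1" | "d \<in> H2" "d' \<in> H2" using d nv sep[of d d'] sep[of d' d] by auto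
      then show ?thesis
      proof cases
        case 1
        have oo: "org z = org d" if "z \<in> orbit (rot \<phi>1 H1) d" for z
          using that
        proof induction
          case base
          then show ?case using o1[of "rv d"] 1 rv1 by (simp add: rot_def)
        next
          case (step y)
          then have "y \<in> H1" using perm_orbit_subset[OF r1 1(1)] by auto
          then show ?case using o1[of "rv y"] step rv1 by (simp add: rot_def)
        qed
        have "d' \<in> orbit (rot \<phi>1 H1) d" using t1[OF 1 d(3)] perm_self_in_orbit[OF fin(1) r1] by simp
        moreover have "rot \<phi>1 H1 z = ?\<sigma> z" if z: "z \<in> orbit (rot \<phi>1 H1) d \<or> z = d" for z
        proof -
          have "z \<in> H1" using z perm_orbit_subset[OF r1 1(1)] 1 by auto
          moreover have "z \<noteq> a" using z oo nv a by auto
          ultimately show ?thesis using s1 by simp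
        qed
        ultimately show ?thesis using orb_tr[of d' _ d ?\<sigma>] st by simp
      next
        case 2
        have oo: "org z = org d" if "z \<in> orbit (rot \<phi>2 H2) d" for z
          using that
        proof induction
          case base
          then show ?case using o2[of "rv d"] 2 rv2 by (simp add: rot_def)
        next
          case (step y)
          then have "y \<in> H2" using perm_orbit_subset[OF r2 2(1)] by auto
          then show ?case using o2[of "rv y"] step rv2 by (simp add: rot_def)
        qed
        have "d' \<in> orbit (rot \<phi>2 H2) d" using t2[OF 2 d(3)] perm_self_in_orbit[OF fin(2) r2] by simp
        moreover have "rot \<phi>2 H2 z = ?\<sigma> z" if z: "z \<in> orbit (rot \<phi>2 H2) d \<or> z = d" for z
        proof -
          have "z \<in> H2" using z perm_orbit_subset[OF r2 2(1)] 2 by auto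
          moreover have "z \<noteq> b" using z oo nv b by auto
          ultimately show ?thesis using s2 by simp
        qed
        ultimately show ?thesis using orb_tr[of d' _ d ?\<sigma>] st by simp
      qed
    qed
    have "card (orbs \<phi> ?H) \<le> card (orbs \<psi> ?H) + 1"
      unfolding \<psi>_def by (rule card_orbs_swap[OF finH ph ab])
    then have eu: "card ?H + 4 \<le> 2 * card (orbs \<psi> ?H) + 2 * card (org ` ?H)"
      using cF cH cO e1 e2 c1 by linarith
    have os: "org (\<psi> d) = org (rv d)" if "d \<in> ?H" for d
    proof (cases "d = rv a \<or> d = rv b")
      case True
      then show ?thesis using psa o1[of "rv a"] o2[of "rv b"] a b rv1 rv2 by auto
    next
      case False
      then show ?thesis using that pso ph1 ph2 o1 o2 by auto
    qed
    have "map_ok ?H \<psi>" unfolding map_ok_def by (intro conjI ballI impI ps eu * os)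
    then show ?thesis by blast
  qed
qed

text \<open>Cutting off parts attached in at most one point leads down to nonseparable maps, the
  blocks; \<open>map_merge\<close> puts them together again.\<close>

theorem plane_map:
  assumes "H \<subseteq> D0" "rv ` H \<subseteq> H" "H \<noteq> {}"
  shows "\<exists>\<phi>. map_ok H \<phi>"
  using assms
proof (induction "card H" arbitrary: H rule: less_induct)
  case less
  show ?case
  proof (cases "nonseparable H")
    case True
    then show ?thesis using nonseparable_map less by blast
  next
    case False
    then obtain K where K: "K \<subseteq> H" "rv ` K \<subseteq> K" "K \<noteq> {}" "K \<noteq> H" "\<not> 2 \<le> card (org ` K \<inter> org ` (H - K))"
      unfolding nonseparable_def by auto
    have fin: "finite H" using finite_subset[OF less(2) finite_D0] .
    have rvd: "rv ` (H - K) \<subseteq> H - K"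
    proof (rule image_subsetI)
      fix d assume d: "d \<in> H - K"
      then have "rv d \<in> H" using less(3) by auto
      moreover have "rv d \<notin> K" using K(2) d by (metis DiffD2 image_subset_iff rv_rv)
      ultimately show "rv d \<in> H - K" by simp
    qed
    have KD: "K \<subseteq> D0" "H - K \<subseteq> D0" "H - K \<noteq> {}" using K less(2) by auto
    have "card K < card H" using K fin by (intro psubset_card_mono) auto
    from less(1)[OF this KD(1) K(2,3)] obtain \<phi>1 where 1: "map_ok K \<phi>1" by blast
    have "card (H - K) < card H" using K fin by (intro psubset_card_mono) auto
    from less(1)[OF this KD(2) rvd KD(3)] obtain \<phi>2 where 2: "map_ok (H - K) \<phi>2" by blast
    have "\<exists>\<phi>. map_ok (K \<union> (H - K)) \<phi>"
      by (rule map_merge[OF _ _ K(2) rvd _ 1 2]) (use K less in auto)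
    moreover have "K \<union> (H - K) = H" using K by auto
    ultimately show ?thesis by simp
  qed
qed

end

lemma perm_orbit_cycle:
  assumes "finite A" "f permutes A"
  shows "(f ^^ card (orbit f d)) d = d" "orbit f d = (\<lambda>i. (f ^^ i) d) ` {0..<card (orbit f d)}"
proof -
  have d: "d \<in> orbit f d" by (rule perm_self_in_orbit[OF assms])
  let ?k = "funpow_dist1 f d d"
  have o: "orbit f d = (\<lambda>i. (f ^^ i) d) ` {0..<?k}" "inj_on (\<lambda>i. (f ^^ i) d) {0..<?k}"
    using d by (rule orbit_conv_funpow_dist1, rule inj_on_funpow_dist1)
  then have "card (orbit f d) = ?k" by (simp add: card_image)
  then show "(f ^^ card (orbit f d)) d = d" "orbit f d = (\<lambda>i. (f ^^ i) d) ` {0..<card (orbit f d)}"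
    using funpow_dist1_prop[OF d] o(1) by simp_all
qed

section \<open>The map of a drawing\<close>

text \<open>A segment (e, s, t) is the part of the curve of e from parameter s to parameter t.\<close>

type_synonym seg = "complex set \<times> real \<times> real"

locale arcs_drawing =
  fixes V :: "complex set" and E :: "complex set set" and g :: "complex set \<Rightarrow> real \<Rightarrow> complex"
  assumes finV: "finite V" and V_ne: "V \<noteq> {}"
    and edge: "e \<in> E \<Longrightarrow> e \<subseteq> V \<and> e = {g e 0, g e 1}"
    and arc_g: "e \<in> E \<Longrightarrow> arc (g e)"
    and img_V: "e \<in> E \<Longrightarrow> path_image (g e) \<inter> V = e"
    and meet_once: "\<lbrakk>e \<in> E; f \<in> E; e \<noteq> f; p \<in> path_image (g e); p \<in> path_image (g f);
        q \<in> path_image (g e); q \<in> path_image (g f)\<rbrakk> \<Longrightarrow> p = q"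
    and adjacent: "\<lbrakk>e \<in> E; e1 \<in> E; e2 \<in> E; e1 \<noteq> e; e2 \<noteq> e; e1 \<noteq> e2;
        p \<in> path_image (g e1) \<inter> path_image (g e) - V; q \<in> path_image (g e2) \<inter> path_image (g e) - V\<rbrakk>
        \<Longrightarrow> e1 \<inter> e2 \<noteq> {}"
    and degree2: "v \<in> V \<Longrightarrow> \<exists>e\<in>E. \<exists>f\<in>E. e \<noteq> f \<and> v \<in> e \<and> v \<in> f"
begin

section \<open>Edges cut into pieces at their vertices and crossings\<close>

lemma finE: "finite E"
  using finite_subset[of E "Pow V"] finV edge by auto

lemma g_inj: "e \<in> E \<Longrightarrow> s \<in> {0..1} \<Longrightarrow> t \<in> {0..1} \<Longrightarrow> g e s = g e t \<Longrightarrow> s = t"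
  using arc_g[of e] by (auto simp: arc_def inj_on_def)

lemma g_img: "s \<in> {0..1} \<Longrightarrow> g e s \<in> path_image (g e)"
  by (simp add: path_image_def)

lemma vertex_img: "e \<in> E \<Longrightarrow> v \<in> e \<Longrightarrow> v \<in> path_image (g e)"
  using img_V by blast

text \<open>A common endpoint would be a second common point of the two curves.\<close>

lemma cross_nonadjacent:
  assumes "e \<in> E" "f \<in> E" "e \<noteq> f" "p \<in> path_image (g e)" "p \<in> path_image (g f)" "p \<notin> V"
  shows "e \<inter> f = {}"
proof (rule ccontr)
  assume "\<not> ?thesis"
  then obtain w where w: "w \<in> e" "w \<in> f" by auto
  then have "p = w" using meet_once[OF assms(1-5)] vertex_img assms by blast
  then show False using w assms(1,6) edge by blast
qed

text \<open>The two edges that cross \<open>e\<close> at \<open>p\<close> share an endpoint, so they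
  cannot also meet at \<open>p\<close>. This is why every inner common point has exactly four
  darts.\<close>

lemma no_triple:
  assumes "e \<in> E" "f \<in> E" "h \<in> E" "e \<noteq> f" "e \<noteq> h" "p \<notin> V"
    "p \<in> path_image (g e)" "p \<in> path_image (g f)" "p \<in> path_image (g h)"
  shows "f = h"
proof (rule ccontr)
  assume "f \<noteq> h"
  then have "f \<inter> h \<noteq> {}" using adjacent[of e f h p p] assms by auto
  then show False using cross_nonadjacent[of f h p] assms \<open>f \<noteq> h\<close> by auto
qed

text \<open>The parameters of the vertices and crossings on an edge.\<close>

definition T :: "complex set \<Rightarrow> real set" where
  "T e = {t \<in> {0..1}. g e t \<in> V \<or> (\<exists>f\<in>E. f \<noteq> e \<and> g e t \<in> path_image (g f))}"

lemma T_I: "T e \<subseteq> {0..1}" by (auto simp: T_def)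

lemma finite_T: assumes "e \<in> E" shows "finite (T e)"
proof -
  let ?Z = "V \<union> (\<Union>f\<in>E - {e}. path_image (g e) \<inter> path_image (g f))"
  have "finite (path_image (g e) \<inter> path_image (g f))" if f: "f \<in> E - {e}" for f
  proof (cases "path_image (g e) \<inter> path_image (g f) = {}")
    case False
    then obtain p where "p \<in> path_image (g e) \<inter> path_image (g f)" by auto
    then have "path_image (g e) \<inter> path_image (g f) \<subseteq> {p}" using meet_once[OF assms, of f] f by blast
    then show ?thesis by (rule finite_subset) simp
  qed simp
  then have "finite (\<Union>f\<in>E - {e}. path_image (g e) \<inter> path_image (g f))"
    by (rule finite_UN_I[OF finite_Diff[OF finE]])
  then have "finite ?Z" using finV by simp
  moreover have "g e ` T e \<subseteq> ?Z" using g_img by (auto simp: T_def)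
  ultimately have "finite (g e ` T e)" using finite_subset by blast
  moreover have "inj_on (g e) (T e)" using g_inj[OF assms] T_I by (intro inj_onI) blast
  ultimately show ?thesis by (rule finite_imageD)
qed

lemma T_ends: "e \<in> E \<Longrightarrow> 0 \<in> T e \<and> 1 \<in> T e"
  using edge[of e] by (auto simp: T_def)

lemma T_real: "e \<in> E \<Longrightarrow> s \<in> T e \<Longrightarrow> g e s \<in> V \<longleftrightarrow> s = 0 \<or> s = 1"
proof
  assume e: "e \<in> E" "s \<in> T e" "g e s \<in> V"
  then have s: "s \<in> {0..1}" using T_I by blast
  then have "g e s \<in> {g e 0, g e 1}" using e img_V[OF e(1)] g_img[OF s, of e] edge[OF e(1)] by blast
  then show "s = 0 \<or> s = 1" using g_inj[OF e(1) s, of 0] g_inj[OF e(1) s, of 1] by auto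
next
  show "e \<in> E \<Longrightarrow> s \<in> T e \<Longrightarrow> s = 0 \<or> s = 1 \<Longrightarrow> g e s \<in> V" using edge[of e] by auto
qed

definition nb :: "complex set \<Rightarrow> real \<Rightarrow> real \<Rightarrow> bool" where
  "nb e s t \<longleftrightarrow> s \<in> T e \<and> t \<in> T e \<and> s < t \<and> (\<forall>x\<in>T e. \<not> (s < x \<and> x < t))"

definition DD :: "seg set" where "DD = {(e, s, t). e \<in> E \<and> (nb e s t \<or> nb e t s)}"
definition org :: "seg \<Rightarrow> complex" where "org d = (case d of (e, s, t) \<Rightarrow> g e s)"
definition rv :: "seg \<Rightarrow> seg" where "rv d = (case d of (e, s, t) \<Rightarrow> (e, t, s))"
definition img :: "seg \<Rightarrow> complex set" where "img d = (case d of (e, s, t) \<Rightarrow> g e ` closed_segment s t)"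

lemma nb_succ: "e \<in> E \<Longrightarrow> s \<in> T e \<Longrightarrow> s \<noteq> 1 \<Longrightarrow> \<exists>!t. nb e s t"
proof -
  assume e: "e \<in> E" "s \<in> T e" "s \<noteq> 1"
  let ?S = "{t \<in> T e. s < t}"
  have "s < 1" using e T_I by force
  then have S: "finite ?S" "?S \<noteq> {}" using finite_T[OF e(1)] T_ends[OF e(1)] by auto
  have "\<not> (s < x \<and> x < Min ?S)" if "x \<in> T e" for x
    using Min_le[OF S(1), of x] that by auto
  then have "nb e s (Min ?S)" using Min_in[OF S] e(2) unfolding nb_def by blast
  then obtain m where m: "nb e s m" by blast
  have "t = m" if "nb e s t" for t
    using that m unfolding nb_def by (cases t m rule: linorder_cases) blast+
  then show "\<exists>!t. nb e s t" using m by blast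
qed

lemma nb_pred: "e \<in> E \<Longrightarrow> s \<in> T e \<Longrightarrow> s \<noteq> 0 \<Longrightarrow> \<exists>!t. nb e t s"
proof -
  assume e: "e \<in> E" "s \<in> T e" "s \<noteq> 0"
  let ?S = "{t \<in> T e. t < s}"
  have "0 < s" using e T_I by force
  then have S: "finite ?S" "?S \<noteq> {}" using finite_T[OF e(1)] T_ends[OF e(1)] by auto
  have "\<not> (Max ?S < x \<and> x < s)" if "x \<in> T e" for x
    using Max_ge[OF S(1), of x] that by auto
  then have "nb e (Max ?S) s" using Max_in[OF S] e(2) unfolding nb_def by blast
  then obtain m where m: "nb e m s" by blast
  have "t = m" if "nb e t s" for t
    using that m unfolding nb_def by (cases t m rule: linorder_cases) blast+
  then show "\<exists>!t. nb e t s" using m by blast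
qed

lemma nb_overlap:
  assumes n: "nb e s t" "nb e s' t'" and a: "s \<le> a" "a \<le> t" "s' \<le> a" "a \<le> t'" and ne: "s \<noteq> s' \<or> t \<noteq> t'"
  shows "(a = s \<or> a = t) \<and> (a = s' \<or> a = t')"
proof -
  have "s' \<le> s \<or> t \<le> s'" "t' \<le> s \<or> t \<le> t'" "s \<le> s' \<or> t' \<le> s" "t \<le> s' \<or> t' \<le> t" "s < t" "s' < t'"
    using n unfolding nb_def by (force simp: not_less)+
  then show ?thesis using a ne by linarith
qed

lemma finite_DD: "finite DD"
proof -
  have "DD \<subseteq> (\<Union>e\<in>E. {e} \<times> T e \<times> T e)" by (auto simp: DD_def nb_def)
  then show ?thesis using finE finite_T by (auto intro: finite_subset)
qed

lemma rv_rv: "rv (rv d) = d" by (auto simp: rv_def split: prod.splits)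

lemma rv_DD: "d \<in> DD \<Longrightarrow> rv d \<in> DD" by (auto simp: DD_def rv_def)

lemma DD_T: "(e, s, t) \<in> DD \<Longrightarrow> e \<in> E \<and> s \<in> T e \<and> t \<in> T e \<and> s \<noteq> t \<and> s \<in> {0..1} \<and> t \<in> {0..1}"
  using subsetD[OF T_I, of s e] subsetD[OF T_I, of t e] by (auto simp: DD_def nb_def)

lemma DD_between: "(e, s, t) \<in> DD \<Longrightarrow> x \<in> T e \<Longrightarrow> x \<in> closed_segment s t \<Longrightarrow> x = s \<or> x = t"
  unfolding DD_def nb_def closed_segment_eq_real_ivl
  by (cases "s = x"; cases "t = x"; cases "s \<le> t") (auto simp: order_le_less)

lemma seg_I: "(e, s, t) \<in> DD \<Longrightarrow> closed_segment s t \<subseteq> {0..1}"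
  using DD_T[of e s t] by (auto simp: closed_segment_eq_real_ivl)

sublocale pd: plane_darts DD org rv img
proof
  show "finite DD" by (rule finite_DD)
  show "rv (rv d) = d" for d by (rule rv_rv)
  show "rv d \<in> DD" if "d \<in> DD" for d using rv_DD that .
  show "img (rv d) = img d" for d by (auto simp: img_def rv_def closed_segment_commute split: prod.splits)
  show "arc_set (img d) (org d) (org (rv d))" if dD: "d \<in> DD" for d
  proof -
    obtain e s t where d: "d = (e, s, t)" by (cases d)
    note D = DD_T[OF dD[unfolded d]]
    have "arc (subpath s t (g e))" using D arc_g by (intro arc_subpath_arc) auto
    moreover have "path_image (subpath s t (g e)) = g e ` closed_segment s t" by (rule path_image_subpath_gen)
    moreover have "pathstart (subpath s t (g e)) = g e s" "pathfinish (subpath s t (g e)) = g e t" by simp_all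
    ultimately show ?thesis unfolding arc_set_def d by (auto simp: img_def org_def rv_def)
  qed
  show "img d \<inter> img d' \<subseteq> {org d, org (rv d)} \<inter> {org d', org (rv d')}"
    if dd: "d \<in> DD" "d' \<in> DD" "d' \<noteq> d" "d' \<noteq> rv d" for d d'
  proof -
    obtain e s t e' s' t' where d: "d = (e, s, t)" "d' = (e', s', t')" by (cases d, cases d')
    note D = DD_T[OF dd(1)[unfolded d]] and D' = DD_T[OF dd(2)[unfolded d]]
    note I = seg_I[OF dd(1)[unfolded d]] seg_I[OF dd(2)[unfolded d]]
    show ?thesis
    proof
      fix z assume "z \<in> img d \<inter> img d'"
      then obtain a b where ab: "a \<in> closed_segment s t" "b \<in> closed_segment s' t'" "z = g e a" "z = g e' b"
        by (auto simp: img_def d)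
      have aI: "a \<in> {0..1}" "b \<in> {0..1}" using ab I by auto
      have "(a = s \<or> a = t) \<and> (b = s' \<or> b = t')"
      proof (cases "e = e'")
        case False
        have im: "g e a \<in> path_image (g e')" "g e' b \<in> path_image (g e)"
          using g_img[OF aI(1), of e] g_img[OF aI(2), of e'] ab(3,4) by simp_all
        have "a \<in> T e" unfolding T_def using im(1) aI(1) D' False by (intro CollectI conjI disjI2 bexI[of _ e']) auto
        moreover have "b \<in> T e'" unfolding T_def using im(2) aI(2) D False by (intro CollectI conjI disjI2 bexI[of _ e]) auto
        ultimately show ?thesis
          using DD_between[OF dd(1)[unfolded d]] DD_between[OF dd(2)[unfolded d]] ab(1,2) by simp
      next
        case True
        then have eq: "a = b" using g_inj[of e a b] ab aI D by auto
        have lt: "x < y" if "nb e x y" for x y using that by (simp add: nb_def)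
        have iv: "a \<in> closed_segment x y \<longleftrightarrow> x \<le> a \<and> a \<le> y" "a \<in> closed_segment y x \<longleftrightarrow> x \<le> a \<and> a \<le> y"
          if "nb e x y" for x y using lt[OF that] by (auto simp: closed_segment_eq_real_ivl)
        have n: "nb e s t \<or> nb e t s" "nb e s' t' \<or> nb e t' s'" using dd(1,2) True by (auto simp: d DD_def)
        have ne: "\<not> (s' = s \<and> t' = t)" "\<not> (s' = t \<and> t' = s)" using dd(3,4) True by (auto simp: d rv_def)
        have a: "a \<in> closed_segment s t" "a \<in> closed_segment s' t'" using ab eq by auto
        obtain x y where x: "nb e x y" "x \<le> a" "a \<le> y" "(x = s \<and> y = t) \<or> (x = t \<and> y = s)"
          using n(1) a(1) iv by metis
        obtain x' y' where x': "nb e x' y'" "x' \<le> a" "a \<le> y'" "(x' = s' \<and> y' = t') \<or> (x' = t' \<and> y' = s')"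
          using n(2) a(2) iv by metis
        have "x \<noteq> x' \<or> y \<noteq> y'" using x(4) x'(4) ne by auto
        from nb_overlap[OF x(1) x'(1) x(2,3) x'(2,3) this] show ?thesis
          unfolding eq[symmetric] using x(4) x'(4) by auto
      qed
      then show "z \<in> {org d, org (rv d)} \<inter> {org d', org (rv d')}" using ab by (auto simp: d org_def rv_def)
    qed
  qed
qed

section \<open>The data of the map and its axioms\<close>

definition par :: "seg \<Rightarrow> real" where "par d = fst (snd d)"
definition dest :: "seg \<Rightarrow> complex" where "dest d = (case d of (e, s, t) \<Rightarrow> if s < t then g e 1 else g e 0)"
definition rl :: "seg \<Rightarrow> bool" where "rl d \<longleftrightarrow> org d \<in> V"
definition xe :: "seg \<Rightarrow> complex set" where
  "xe d = (SOME f. f \<in> E \<and> f \<noteq> fst d \<and> org d \<in> path_image (g f))"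
definition opp :: "seg \<Rightarrow> seg" where
  "opp d = (SOME d'. d' \<in> DD \<and> fst d' = fst d \<and> par d' = par d \<and> d' \<noteq> d)"
definition rev_seg :: "seg \<Rightarrow> seg" where "rev_seg d = (if d \<in> DD then rv d else d)"

lemma DD_fst: "d \<in> DD \<Longrightarrow> fst d \<in> E" by (auto simp: DD_def)

lemma org_eq: "org d = g (fst d) (par d)" by (auto simp: org_def par_def split: prod.splits)

lemma par_I: "d \<in> DD \<Longrightarrow> par d \<in> {0..1}" "d \<in> DD \<Longrightarrow> par d \<in> T (fst d)"
  using DD_T[of "fst d" "fst (snd d)" "snd (snd d)"] by (auto simp: par_def)

lemma org_img: "d \<in> DD \<Longrightarrow> org d \<in> path_image (g (fst d))"
  using g_img[OF par_I(1)] by (simp add: org_eq)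

lemma par_eqI: "d \<in> DD \<Longrightarrow> d' \<in> DD \<Longrightarrow> fst d = fst d' \<Longrightarrow> org d = org d' \<Longrightarrow> par d = par d'"
  using g_inj[OF DD_fst[of d] par_I(1)[of d] par_I(1)[of d']] by (simp add: org_eq)

lemma rl_par: "d \<in> DD \<Longrightarrow> rl d \<longleftrightarrow> par d = 0 \<or> par d = 1"
  unfolding rl_def org_eq using T_real DD_fst par_I(2) by blast

lemma opp_facts:
  assumes d: "d \<in> DD" "\<not> rl d"
  shows "opp d \<in> DD" "fst (opp d) = fst d" "par (opp d) = par d" "opp d \<noteq> d"
    and "\<And>d'. d' \<in> DD \<Longrightarrow> fst d' = fst d \<Longrightarrow> par d' = par d \<Longrightarrow> d' = d \<or> d' = opp d"
    and "par d < snd (snd d) \<longleftrightarrow> snd (snd (opp d)) < par d"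
proof -
  obtain e s t where D: "d = (e, s, t)" by (cases d)
  note DT = DD_T[OF d(1)[unfolded D]]
  have s01: "s \<noteq> 0" "s \<noteq> 1" using rl_par[OF d(1)] d(2) by (auto simp: D par_def)
  have ex: "\<exists>!a. nb e s a" "\<exists>!b. nb e b s" using nb_succ[of e s] nb_pred[of e s] DT s01 by simp_all
  obtain a b where ab: "nb e s a" "nb e b s" using ex by blast
  have a: "nb e s t \<longleftrightarrow> t = a" and b: "nb e t s \<longleftrightarrow> t = b" for t
    using ab ex by blast+
  have ba: "b < s" "s < a" using ab by (auto simp: nb_def)
  have char: "d' \<in> DD \<and> fst d' = fst d \<and> par d' = par d \<longleftrightarrow> d' = (e, s, a) \<or> d' = (e, s, b)" for d'
    using a b DT by (cases d') (auto simp: D DD_def par_def)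
  have dc: "d = (e, s, a) \<or> d = (e, s, b)" using char[of d] d by blast
  define d0 where "d0 = (if d = (e, s, a) then (e, s, b) else (e, s, a))"
  have d0: "d0 \<in> DD \<and> fst d0 = fst d \<and> par d0 = par d" unfolding char by (simp add: d0_def)
  have d0d: "d0 \<noteq> d" using dc ba by (auto simp: d0_def)
  have "opp d = d0"
    unfolding opp_def
  proof (rule some_equality)
    show "d0 \<in> DD \<and> fst d0 = fst d \<and> par d0 = par d \<and> d0 \<noteq> d" using d0 d0d by blast
    fix d' assume "d' \<in> DD \<and> fst d' = fst d \<and> par d' = par d \<and> d' \<noteq> d"
    then have "d' = (e, s, a) \<or> d' = (e, s, b)" "d' \<noteq> d" using char by blast+
    then show "d' = d0" using dc by (auto simp: d0_def)
  qed
  then show "opp d \<in> DD" "fst (opp d) = fst d" "par (opp d) = par d" "opp d \<noteq> d"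
    "par d < snd (snd d) \<longleftrightarrow> snd (snd (opp d)) < par d"
    using d0 d0d dc ba by (auto simp: d0_def par_def)
  show "d' = d \<or> d' = opp d" if "d' \<in> DD" "fst d' = fst d" "par d' = par d" for d'
  proof -
    have "d' = (e, s, a) \<or> d' = (e, s, b)" using char[of d'] that by blast
    then show ?thesis using dc \<open>opp d = d0\<close> unfolding d0_def by presburger
  qed
qed

lemma xe_facts:
  assumes d: "d \<in> DD" "\<not> rl d"
  shows "xe d \<in> E" "xe d \<noteq> fst d" "org d \<in> path_image (g (xe d))"
    and "\<And>f. f \<in> E \<Longrightarrow> f \<noteq> fst d \<Longrightarrow> org d \<in> path_image (g f) \<Longrightarrow> f = xe d"
proof -
  have "\<exists>f. f \<in> E \<and> f \<noteq> fst d \<and> org d \<in> path_image (g f)"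
    using par_I(2)[OF d(1)] d(2) unfolding T_def rl_def org_eq by auto
  then have x: "xe d \<in> E \<and> xe d \<noteq> fst d \<and> org d \<in> path_image (g (xe d))"
    unfolding xe_def by (rule someI_ex)
  then show "xe d \<in> E" "xe d \<noteq> fst d" "org d \<in> path_image (g (xe d))" by auto
  show "f = xe d" if "f \<in> E" "f \<noteq> fst d" "org d \<in> path_image (g f)" for f
    by (rule no_triple[of "fst d" f "xe d" "org d"]) (use x that d DD_fst org_img in \<open>auto simp: rl_def\<close>)
qed

lemma other_seg:
  assumes d: "d \<in> DD" "\<not> rl d"
  obtains h where "h \<in> DD" "\<not> rl h" "fst h = xe d" "org h = org d" "xe h = fst d"
proof -
  note x = xe_facts[OF d]
  obtain s where s: "s \<in> {0..1}" "g (xe d) s = org d" using x(3) by (auto simp: path_image_def)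
  have "s \<in> T (xe d)" using s x(2) DD_fst[OF d(1)] org_img[OF d(1)] by (auto simp: T_def)
  moreover have "s \<noteq> 1" using s d(2) edge[OF x(1)] by (auto simp: rl_def)
  ultimately obtain t where "nb (xe d) s t" using nb_succ x(1) by blast
  then have h: "(xe d, s, t) \<in> DD" using x(1) by (simp add: DD_def)
  have o: "org (xe d, s, t) = org d" using s by (simp add: org_def)
  then have nr: "\<not> rl (xe d, s, t)" using d by (simp add: rl_def)
  have "fst d = xe (xe d, s, t)"
    using xe_facts(4)[OF h nr, of "fst d"] o x(2) DD_fst[OF d(1)] org_img[OF d(1)] by simp
  then show ?thesis using h o nr by (intro that[of "(xe d, s, t)"]) auto
qed

text \<open>Exactly two edges pass through the point, by the uniqueness in \<open>xe_facts\<close>,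
  and each contributes two darts.\<close>

lemma out_nonreal:
  assumes d: "d \<in> DD" "\<not> rl d"
  obtains h where "{x \<in> DD. org x = org d} = {d, opp d, h, opp h}" "card {d, opp d, h, opp h} = 4"
    "h \<in> DD" "\<not> rl h" "fst h = xe d" "xe h = fst d" "org h = org d"
proof -
  obtain h where h: "h \<in> DD" "\<not> rl h" "fst h = xe d" "org h = org d" "xe h = fst d" using other_seg[OF d] .
  note od = opp_facts[OF d] and oh = opp_facts[OF h(1,2)] and x = xe_facts[OF d]
  have "{x \<in> DD. org x = org d} = {d, opp d, h, opp h}"
  proof
    have "org (opp d) = org d" "org (opp h) = org h" using od(2,3) oh(2,3) by (simp_all add: org_eq)
    then show "{d, opp d, h, opp h} \<subseteq> {x \<in> DD. org x = org d}" using d(1) h(1,4) od(1) oh(1) by simp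
    show "{x \<in> DD. org x = org d} \<subseteq> {d, opp d, h, opp h}"
    proof
      fix y assume "y \<in> {x \<in> DD. org x = org d}"
      then have y: "y \<in> DD" "org y = org d" by auto
      show "y \<in> {d, opp d, h, opp h}"
      proof (cases "fst y = fst d")
        case True
        then show ?thesis using od(5)[OF y(1)] par_eqI[OF y(1) d(1)] y by auto
      next
        case False
        then have "fst y = xe d" using x(4) DD_fst[OF y(1)] org_img[OF y(1)] y by metis
        then have "fst y = fst h" using h by simp
        then show ?thesis using oh(5)[OF y(1)] par_eqI[OF y(1) h(1)] y h by auto
      qed
    qed
  qed
  moreover have "card {d, opp d, h, opp h} = 4"
  proof -
    have "d \<noteq> h" "d \<noteq> opp h" "opp d \<noteq> h" "opp d \<noteq> opp h" using h(3) od(2) oh(2) x(2) by auto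
    then show ?thesis using od(4)[symmetric] oh(4)[symmetric] by simp
  qed
  ultimately show ?thesis using h by (intro that[of h]) auto
qed

lemma real_seg_unique:
  assumes "d \<in> DD" "d' \<in> DD" "rl d" "fst d = fst d'" "org d = org d'" shows "d = d'"
proof -
  have p: "par d = par d'" using par_eqI assms by blast
  obtain e s t t' where D: "d = (e, s, t)" "d' = (e, s, t')" using assms(4) p by (cases d; cases d') (auto simp: par_def)
  note DT = DD_T[OF assms(1)[unfolded D]] DD_T[OF assms(2)[unfolded D]]
  have s: "s = 0 \<or> s = 1" using rl_par[OF assms(1)] assms(3) by (simp add: D par_def)
  then show ?thesis
  proof
    assume s: "s = 0"
    then have "nb e s t" "nb e s t'" using assms(1,2) DT by (auto simp: D DD_def nb_def)
    then show ?thesis using nb_succ[of e s] DT s unfolding D by auto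
  next
    assume s: "s = 1"
    then have "nb e t s" "nb e t' s" using assms(1,2) DT by (auto simp: D DD_def nb_def)
    then show ?thesis using nb_pred[of e s] DT s unfolding D by auto
  qed
qed

lemma real_seg_exists:
  assumes e: "e \<in> E" "v \<in> e" shows "\<exists>d\<in>DD. fst d = e \<and> org d = v"
proof -
  have "v = g e 0 \<or> v = g e 1" using edge[OF e(1)] e(2) by blast
  then show ?thesis
  proof
    assume v: "v = g e 0"
    obtain t where "nb e 0 t" using nb_succ[of e 0] T_ends[OF e(1)] e(1) by auto
    then show ?thesis using v e by (intro bexI[of _ "(e, 0, t)"]) (auto simp: DD_def org_def)
  next
    assume v: "v = g e 1"
    obtain t where "nb e t 1" using nb_pred[of e 1] T_ends[OF e(1)] e(1) by auto
    then show ?thesis using v e by (intro bexI[of _ "(e, 1, t)"]) (auto simp: DD_def org_def)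
  qed
qed

lemma real_org_edge: "d \<in> DD \<Longrightarrow> rl d \<Longrightarrow> org d \<in> fst d"
  using org_img[of d] img_V[OF DD_fst[of d]] by (auto simp: rl_def)

lemma card_real: "card {d \<in> DD. rl d} = 2 * card E"
proof -
  have "bij_betw (\<lambda>d. (fst d, org d)) {d \<in> DD. rl d} (SIGMA e:E. e)"
    unfolding bij_betw_def
  proof
    show "inj_on (\<lambda>d. (fst d, org d)) {d \<in> DD. rl d}"
      using real_seg_unique by (auto intro!: inj_onI)
    show "(\<lambda>d. (fst d, org d)) ` {d \<in> DD. rl d} = (SIGMA e:E. e)"
    proof
      show "(\<lambda>d. (fst d, org d)) ` {d \<in> DD. rl d} \<subseteq> (SIGMA e:E. e)"
        using real_org_edge DD_fst by auto
      show "(SIGMA e:E. e) \<subseteq> (\<lambda>d. (fst d, org d)) ` {d \<in> DD. rl d}"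
      proof
        fix p assume "p \<in> (SIGMA e:E. e)"
        then obtain e v where p: "p = (e, v)" "e \<in> E" "v \<in> e" by auto
        then obtain d where d: "d \<in> DD" "fst d = e" "org d = v" using real_seg_exists by blast
        moreover have "rl d" using d p edge by (auto simp: rl_def)
        ultimately show "p \<in> (\<lambda>d. (fst d, org d)) ` {d \<in> DD. rl d}" using p by (intro image_eqI[of _ _ d]) auto
      qed
    qed
  qed
  then have "card {d \<in> DD. rl d} = card (SIGMA e:E. e)" by (rule bij_betw_same_card)
  also have "\<dots> = (\<Sum>e\<in>E. card e)"
    using finE edge finV by (intro card_SigmaI) (auto intro: finite_subset)
  also have "\<dots> = (\<Sum>e\<in>E. 2)"
  proof (rule sum.cong)
    fix e assume e: "e \<in> E"
    have "g e 0 \<noteq> g e 1" using g_inj[OF e, of 0 1] by auto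
    moreover have "e = {g e 0, g e 1}" using edge[OF e] by blast
    ultimately show "card e = 2" by (metis card_2_iff)
  qed simp
  finally show ?thesis by simp
qed

lemma dest_facts:
  assumes "d \<in> DD"
  shows "fst d = {dest d, dest (rv d)}" "dest d \<noteq> dest (rv d)" "rl d \<Longrightarrow> dest (rv d) = org d"
proof -
  obtain e s t where D: "d = (e, s, t)" by (cases d)
  note DT = DD_T[OF assms[unfolded D]]
  have ne: "g e 0 \<noteq> g e 1" using g_inj[of e 0 1] DT by auto
  have "e = {g e 0, g e 1}" using edge DT by blast
  then show "fst d = {dest d, dest (rv d)}" "dest d \<noteq> dest (rv d)"
    using ne DT by (auto simp: D dest_def rv_def)
  show "dest (rv d) = org d" if "rl d"
    using rl_par[OF assms] that DT by (auto simp: D dest_def rv_def org_def par_def)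
qed

text \<open>\<open>plane_map\<close> makes the rotation at each point a single cycle, of length four
  at inner points. It does not tell whether the two edges alternate there, so a
  \<open>touch_map\<close> and not yet a \<open>planar_map\<close> results.\<close>

lemma touch_map_ex:
  obtains \<phi> where "touch_map DD \<phi> rev_seg opp rl fst xe dest par"
    "2 * card DD + 8 \<le> 4 * card (orbs \<phi> DD) + card {d \<in> DD. \<not> rl d} + 4 * card V"
proof -
  obtain v e where "v \<in> V" "e \<in> E" "v \<in> e" using V_ne degree2 by blast
  then have DDne: "DD \<noteq> {}" using real_seg_exists by blast
  then obtain \<phi> where mo: "pd.map_ok DD \<phi>" using pd.plane_map[of DD] rv_DD by blast
  have perm: "\<phi> permutes DD" and o: "\<And>d. d \<in> DD \<Longrightarrow> org (\<phi> d) = org (rv d)"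
    and tr: "\<And>d d'. d \<in> DD \<Longrightarrow> d' \<in> DD \<Longrightarrow> org d = org d' \<Longrightarrow> orbit (pd.rot \<phi> DD) d = orbit (pd.rot \<phi> DD) d'"
    and eu: "card DD + 4 \<le> 2 * card (orbs \<phi> DD) + 2 * card (org ` DD)"
    using mo unfolding pd.map_ok_def by blast+
  let ?\<sigma> = "pd.rot \<phi> DD"
  have sp: "?\<sigma> permutes DD" by (rule pd.rot_permutes[OF perm _ finite_DD]) (use rv_DD in auto)
  have seq: "\<phi> (rev_seg d) = ?\<sigma> d" for d
    using permutes_not_in[OF perm] by (simp add: rev_seg_def pd.rot_def)
  have sD: "?\<sigma> d \<in> DD" if "d \<in> DD" for d using permutes_in_image[OF sp] that by blast
  have so: "org (?\<sigma> d) = org d" if "d \<in> DD" for d using o[OF rv_DD[OF that]] that rv_rv by (simp add: pd.rot_def)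
  have orb: "orbit ?\<sigma> d = {x \<in> DD. org x = org d}" if d: "d \<in> DD" for d
  proof
    show "orbit ?\<sigma> d \<subseteq> {x \<in> DD. org x = org d}"
    proof
      fix y assume "y \<in> orbit ?\<sigma> d"
      then show "y \<in> {x \<in> DD. org x = org d}" by induction (use d sD so in auto)
    qed
    show "{x \<in> DD. org x = org d} \<subseteq> orbit ?\<sigma> d"
    proof
      fix y assume "y \<in> {x \<in> DD. org x = org d}"
      then have "orbit ?\<sigma> y = orbit ?\<sigma> d" using tr[of y d] d by simp
      then show "y \<in> orbit ?\<sigma> d" using perm_self_in_orbit[OF finite_DD sp, of y] by simp
    qed
  qed
  have four: "card (orbit ?\<sigma> d) = 4" if "d \<in> DD" "\<not> rl d" for d
    by (rule out_nonreal[OF that]) (simp add: orb[OF that(1)])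
  have cyc: "(?\<sigma> ^^ 4) d = d" "orbit ?\<sigma> d = {d, ?\<sigma> d, ?\<sigma> (?\<sigma> d), ?\<sigma> (?\<sigma> (?\<sigma> d))}"
    if "d \<in> DD" "\<not> rl d" for d
    using perm_orbit_cycle[OF finite_DD sp, of d] four[OF that]
    by (simp_all add: eval_nat_numeral atLeast0_lessThan_Suc insert_commute)
  have rD: "rev_seg d = rv d" "rev_seg d \<in> DD" if "d \<in> DD" for d using that rv_DD by (auto simp: rev_seg_def)
  have rr: "rev_seg (rev_seg d) = d" for d using rv_DD rv_rv by (auto simp: rev_seg_def)
  have rvfst: "fst (rv d) = fst d" for d by (auto simp: rv_def split: prod.splits)
  have other: "fst y = xe d \<and> xe y = fst d" if d: "d \<in> DD" "\<not> rl d" and y: "y \<in> orbit ?\<sigma> d" "y \<noteq> d" "y \<noteq> opp d" for d y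
  proof -
    obtain h where h: "{x \<in> DD. org x = org d} = {d, opp d, h, opp h}" and "card {d, opp d, h, opp h} = 4"
      and hD: "h \<in> DD" "\<not> rl h" "fst h = xe d" "xe h = fst d" "org h = org d"
      using out_nonreal[OF d] .
    have yD: "y \<in> DD" "org y = org d" using y(1) orb[OF d(1)] by auto
    have yr: "\<not> rl y" using yD d by (simp add: rl_def)
    have "y \<in> {d, opp d, h, opp h}" using y(1) unfolding orb[OF d(1)] h .
    then have "y = h \<or> y = opp h" using y(2,3) by blast
    then have "fst y = xe d" using hD(3) opp_facts(2)[OF hD(1,2)] by auto
    moreover have "fst d = xe y"
      using xe_facts(4)[OF yD(1) yr, of "fst d"] calculation xe_facts(2)[OF d] DD_fst[OF d(1)] org_img[OF d(1)] yD by simp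
    ultimately show ?thesis by simp
  qed
  have distinct4: "?\<sigma> d \<noteq> d \<and> ?\<sigma> (?\<sigma> d) \<noteq> d \<and> ?\<sigma> (?\<sigma> (?\<sigma> d)) \<noteq> d" if d: "d \<in> DD" "\<not> rl d" for d
  proof -
    have "card {d, ?\<sigma> d, ?\<sigma> (?\<sigma> d), ?\<sigma> (?\<sigma> (?\<sigma> d))} = 4" using cyc(2)[OF d] four[OF d] by simp
    then show ?thesis by (auto simp: card_insert_if split: if_splits)
  qed
  have "touch_map DD \<phi> rev_seg opp rl fst xe dest par"
  proof
    show "finite DD" by (rule finite_DD)
    show "\<phi> permutes DD" by (rule perm)
    show "rev_seg permutes DD"
      by (rule bij_imp_permutes[OF bij_betw_byWitness[where f' = rev_seg]]) (use rr rD in \<open>auto simp: rev_seg_def\<close>)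
    show "rev_seg (rev_seg d) = d" for d by (rule rr)
    show "rl (\<phi> (rev_seg d)) \<longleftrightarrow> rl d" if "d \<in> DD" for d using seq so[OF that] by (simp add: rl_def)
    show "\<phi> (rev_seg d) \<noteq> d" if d: "d \<in> DD" for d
    proof (cases "rl d")
      case False
      then show ?thesis using distinct4[OF d] seq by simp
    next
      case True
      \<comment> \<open>A second edge at the vertex keeps the rotation from fixing
        \<open>d\<close>.\<close>
      obtain e f where ef: "e \<in> E" "f \<in> E" "e \<noteq> f" "org d \<in> e" "org d \<in> f"
        using degree2[of "org d"] True by (auto simp: rl_def)
      obtain x y where xy: "x \<in> DD" "fst x = e" "org x = org d" "y \<in> DD" "fst y = f" "org y = org d"
        using real_seg_exists[OF ef(1,4)] real_seg_exists[OF ef(2,5)] by blast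
      have "x \<in> orbit ?\<sigma> d" "y \<in> orbit ?\<sigma> d" "x \<noteq> y" using xy ef orb[OF d] by auto
      then have ns: "\<not> orbit ?\<sigma> d \<subseteq> {d}" by blast
      show ?thesis
      proof
        assume "\<phi> (rev_seg d) = d"
        then have "orbit ?\<sigma> d = {d}" using seq orbit_eq_singleton_iff[of ?\<sigma> d] by simp
        then show False using ns by simp
      qed
    qed
    show "fst (rev_seg d) = fst d" if "d \<in> DD" for d using rD[OF that] rvfst by simp
    show "fst d = {dest d, dest (rev_seg d)}" "dest d \<noteq> dest (rev_seg d)" if "d \<in> DD" for d
      using dest_facts[OF that] rD[OF that] by simp_all
    show "dest (rev_seg (\<phi> (rev_seg d))) = dest (rev_seg d)" if d: "d \<in> DD" "rl d" for d
    proof -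
      have "rl (?\<sigma> d)" using so[OF d(1)] d by (simp add: rl_def)
      then show ?thesis unfolding seq using so[OF d(1)] rD[OF sD[OF d(1)]] rD[OF d(1)] dest_facts(3)[OF sD[OF d(1)]] dest_facts(3)[OF d(1)] d by simp
    qed
    show "d = d'" if "d \<in> DD" "d' \<in> DD" "rl d" "rl d'" "fst d = fst d'" "dest (rev_seg d) = dest (rev_seg d')" for d d'
      using real_seg_unique[OF that(1-3,5)] dest_facts(3) that rD by simp
    have f4: "(?\<sigma> ^^ 4) d = ?\<sigma> (?\<sigma> (?\<sigma> (?\<sigma> d)))" for d by (simp add: eval_nat_numeral)
    show "\<phi> (rev_seg (\<phi> (rev_seg (\<phi> (rev_seg (\<phi> (rev_seg d))))))) = d" if "d \<in> DD" "\<not> rl d" for d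
      unfolding seq using cyc(1)[OF that] f4 by simp
    show "\<phi> (rev_seg (\<phi> (rev_seg d))) \<noteq> d" if "d \<in> DD" "\<not> rl d" for d
      unfolding seq using distinct4[OF that] by simp
    show "opp d \<in> {\<phi> (rev_seg d), \<phi> (rev_seg (\<phi> (rev_seg d))), \<phi> (rev_seg (\<phi> (rev_seg (\<phi> (rev_seg d)))))}"
      if d: "d \<in> DD" "\<not> rl d" for d
    proof -
      have "opp d \<in> orbit ?\<sigma> d" using opp_facts[OF d] orb[OF d(1)] by (simp add: org_eq)
      then show ?thesis unfolding seq using cyc(2)[OF d] opp_facts(4)[OF d] by auto
    qed
    show "opp (opp d) = d" if d: "d \<in> DD" "\<not> rl d" for d
    proof -
      note f = opp_facts[OF d]
      have "\<not> rl (opp d)" using f d by (simp add: rl_def org_eq)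
      from opp_facts(1-4)[OF f(1) this] show ?thesis using f(2,3) f(5)[of "opp (opp d)"] by auto
    qed
    show "fst (opp d) = fst d \<and> xe (opp d) = xe d" if d: "d \<in> DD" "\<not> rl d" for d
    proof -
      note f = opp_facts[OF d]
      have o: "org (opp d) = org d" using f by (simp add: org_eq)
      then have nr: "\<not> rl (opp d)" using d by (simp add: rl_def)
      have "xe d = xe (opp d)" using xe_facts(4)[OF f(1) nr, of "xe d"] xe_facts(1-3)[OF d] f(2) o by simp
      then show ?thesis using f by simp
    qed
    show "fst y = xe d \<and> xe y = fst d"
      if d: "d \<in> DD" "\<not> rl d" and y: "y \<in> {\<phi> (rev_seg d), \<phi> (rev_seg (\<phi> (rev_seg d))), \<phi> (rev_seg (\<phi> (rev_seg (\<phi> (rev_seg d)))))}" "y \<noteq> opp d" for d y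
    proof (rule other[OF d _ _ y(2)])
      show "y \<in> orbit ?\<sigma> d" using y(1) cyc(2)[OF d] unfolding seq by auto
      show "y \<noteq> d" using y(1) distinct4[OF d] unfolding seq by auto
    qed
    show "dest (opp d) = dest (rev_seg d)" if d: "d \<in> DD" "\<not> rl d" for d
    proof -
      note f = opp_facts[OF d]
      obtain e s t t' where D: "d = (e, s, t)" "opp d = (e, s, t')"
        using f(2,3) by (cases d; cases "opp d") (auto simp: par_def)
      have "t \<noteq> s" "t' \<noteq> s" using DD_T[OF d(1)[unfolded D(1)]] DD_T[OF f(1)[unfolded D(2)]] by auto
      then show ?thesis using f(6) unfolding rD(1)[OF d(1)] D(2) unfolding D(1) by (auto simp: dest_def rv_def par_def)
    qed
    show "par d \<noteq> par (rev_seg d)" if "d \<in> DD" for d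
      unfolding rD(1)[OF that] using that by (auto simp: DD_def nb_def par_def rv_def)
    show "par (opp d) = par d" if "d \<in> DD" "\<not> rl d" for d using opp_facts[OF that] by simp
    show "par (rev_seg d) < par d \<longleftrightarrow> par (opp d) < par (rev_seg (opp d))" if d: "d \<in> DD" "\<not> rl d" for d
    proof -
      note f = opp_facts[OF d]
      obtain e s t t' where D: "d = (e, s, t)" "opp d = (e, s, t')"
        using f(2,3) by (cases d; cases "opp d") (auto simp: par_def)
      have "t \<noteq> s" "t' \<noteq> s" using DD_T[OF d(1)[unfolded D(1)]] DD_T[OF f(1)[unfolded D(2)]] by auto
      then show ?thesis using f(6) unfolding rD(1)[OF d(1)] rD(1)[OF f(1)] unfolding D(2) unfolding D(1) by (auto simp: rv_def par_def)
    qed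
    show "fst d \<inter> xe d = {}" if d: "d \<in> DD" "\<not> rl d" for d
      using cross_nonadjacent[OF DD_fst[OF d(1)] xe_facts(1)[OF d] xe_facts(2)[OF d, symmetric] org_img[OF d(1)] xe_facts(3)[OF d]] d(2)
      by (simp add: rl_def)
    show "d' = d \<or> d' = opp d"
      if d: "d \<in> DD" "d' \<in> DD" "\<not> rl d" "\<not> rl d'" "fst d = fst d'" "xe d = xe d'" for d d'
    proof -
      have "org d = org d'"
        using meet_once[OF DD_fst[OF d(1)] xe_facts(1)[OF d(1,3)] xe_facts(2)[OF d(1,3), symmetric] org_img[OF d(1)] xe_facts(3)[OF d(1,3)]]
          org_img[OF d(2)] xe_facts(3)[OF d(2,4)] unfolding d(5,6) .
      then show ?thesis using opp_facts(5)[OF d(1,3,2)] par_eqI[OF d(1,2,5)] d(5) by simp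
    qed
    show "xe d \<inter> xe d' \<noteq> {}"
      if d: "d \<in> DD" "d' \<in> DD" "\<not> rl d" "\<not> rl d'" "fst d = fst d'" for d d'
    proof (cases "xe d = xe d'")
      case True
      then show ?thesis using edge[OF xe_facts(1)[OF d(1,3)]] by blast
    next
      case False
      show ?thesis
        using adjacent[OF DD_fst[OF d(1)] xe_facts(1)[OF d(1,3)] xe_facts(1)[OF d(2,4)] xe_facts(2)[OF d(1,3)] _ False, of "org d" "org d'"]
          xe_facts(3)[OF d(1,3)] xe_facts(2,3)[OF d(2,4)] org_img[OF d(1)] org_img[OF d(2)] d(3-5)
        by (simp add: rl_def)
    qed
  qed
  moreover have "2 * card DD + 8 \<le> 4 * card (orbs \<phi> DD) + card {d \<in> DD. \<not> rl d} + 4 * card V"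
  proof -
    \<comment> \<open>Each inner point is the origin of four darts, so the number of points is at
      most \<open>card V\<close> plus a quarter of \<open>card ?N\<close>; doubling Euler's
      inequality clears the fraction.\<close>
    let ?N = "{d \<in> DD. \<not> rl d}"
    have fN: "finite ?N" using finite_DD by simp
    have "card ?N = (\<Sum>p\<in>org ` ?N. card {d \<in> ?N. org d = p})"
      using sum.group[OF fN, of "org ` ?N" org "\<lambda>_. 1::nat"] fN by simp
    also have "\<dots> = (\<Sum>p\<in>org ` ?N. 4)"
    proof (rule sum.cong)
      fix p assume "p \<in> org ` ?N"
      then obtain d where d: "d \<in> DD" "\<not> rl d" "p = org d" by auto
      have "{d' \<in> ?N. org d' = p} = {x \<in> DD. org x = org d}" using d by (auto simp: rl_def)
      then show "card {d' \<in> ?N. org d' = p} = 4" using four[OF d(1,2)] orb[OF d(1)] by simp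
    qed simp
    finally have "card ?N = 4 * card (org ` ?N)" by simp
    moreover have "org ` DD \<subseteq> V \<union> org ` ?N" by (auto simp: rl_def)
    then have "card (org ` DD) \<le> card (V \<union> org ` ?N)" using finV fN by (intro card_mono) auto
    moreover have "card (V \<union> org ` ?N) \<le> card V + card (org ` ?N)" by (rule card_Un_le)
    ultimately show ?thesis using eu by linarith
  qed
  ultimately show ?thesis by (rule that)
qed

theorem arcs_edge_bound:
  "card E + 10 \<le> 5 * card V"
  "z \<in> V \<Longrightarrow> card {e \<in> E. z \<in> e} = 3 \<Longrightarrow>
   (\<And>e f p. e \<in> E \<Longrightarrow> f \<in> E \<Longrightarrow> z \<in> e \<Longrightarrow> f \<noteq> e \<Longrightarrow> p \<in> path_image (g e) \<Longrightarrow> p \<in> path_image (g f) \<Longrightarrow> p \<in> V)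
   \<Longrightarrow> card E + 13 \<le> 5 * card V"
proof -
  obtain \<phi> where tm: "touch_map DD \<phi> rev_seg opp rl fst xe dest par"
    and eu: "2 * card DD + 8 \<le> 4 * card (orbs \<phi> DD) + card {d \<in> DD. \<not> rl d} + 4 * card V"
    using touch_map_ex .
  have z': "{d \<in> DD. rl d \<and> dest (rev_seg d) = z} = {d \<in> DD. rl d \<and> org d = z}" for z
    using dest_facts(3) by (auto simp: rev_seg_def)
  show "card E + 10 \<le> 5 * card V"
  proof -
    \<comment> \<open>A point outside \<open>V\<close> marks no dart, which gives the bound without
      the extra summand.\<close>
    obtain z :: complex where z: "z \<notin> V" using finV infinite_UNIV_char_0 by (metis ex_new_if_finite)
    have "card E + 10 + card {d \<in> DD. rl d \<and> dest (rev_seg d) = z} \<le> 5 * card V"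
    proof (rule edge_bound[OF tm eu card_real])
      show "rl (rev_seg d)" if "d \<in> DD" "rl d" "dest (rev_seg d) = z" for d
      proof -
        have "d \<in> {d \<in> DD. rl d \<and> dest (rev_seg d) = z}" using that by simp
        then have "org d = z" unfolding z' by simp
        then show ?thesis using z that by (simp add: rl_def)
      qed
    qed
    then show ?thesis by linarith
  qed
  assume zV: "z \<in> V" and c3: "card {e \<in> E. z \<in> e} = 3"
    and un: "\<And>e f p. e \<in> E \<Longrightarrow> f \<in> E \<Longrightarrow> z \<in> e \<Longrightarrow> f \<noteq> e \<Longrightarrow> p \<in> path_image (g e) \<Longrightarrow> p \<in> path_image (g f) \<Longrightarrow> p \<in> V"
  have "card E + 10 + card {d \<in> DD. rl d \<and> dest (rev_seg d) = z} \<le> 5 * card V"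
  proof (rule edge_bound[OF tm eu card_real])
    show "rl (rev_seg d)" if d: "d \<in> DD" "rl d" "dest (rev_seg d) = z" for d
    proof -
      have "d \<in> {d \<in> DD. rl d \<and> dest (rev_seg d) = z}" using d by simp
      then have "org d = z" unfolding z' by simp
      then have ze: "z \<in> fst d" using real_org_edge[OF d(1,2)] by simp
      have rd: "rev_seg d \<in> DD" "fst (rev_seg d) = fst d" using d(1) rv_DD by (auto simp: rev_seg_def rv_def split: prod.splits)
      show ?thesis
      proof (rule ccontr)
        assume nr: "\<not> rl (rev_seg d)"
        note x = xe_facts[OF rd(1) nr]
        have "org (rev_seg d) \<in> V"
          using un[OF DD_fst[OF d(1)] x(1) ze, of "org (rev_seg d)"] x(2,3) org_img[OF rd(1)] rd(2) by simp
        then show False using nr by (simp add: rl_def)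
      qed
    qed
  qed
  moreover have "card {d \<in> DD. rl d \<and> dest (rev_seg d) = z} = card {e \<in> E. z \<in> e}"
    unfolding z'
  proof (rule bij_betw_same_card[of fst])
    show "bij_betw fst {d \<in> DD. rl d \<and> org d = z} {e \<in> E. z \<in> e}"
      unfolding bij_betw_def
    proof
      show "inj_on fst {d \<in> DD. rl d \<and> org d = z}" using real_seg_unique by (auto intro!: inj_onI)
      show "fst ` {d \<in> DD. rl d \<and> org d = z} = {e \<in> E. z \<in> e}"
      proof
        show "fst ` {d \<in> DD. rl d \<and> org d = z} \<subseteq> {e \<in> E. z \<in> e}" using real_org_edge DD_fst by auto
        show "{e \<in> E. z \<in> e} \<subseteq> fst ` {d \<in> DD. rl d \<and> org d = z}"
        proof
          fix e assume "e \<in> {e \<in> E. z \<in> e}"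
          then obtain d where "d \<in> DD" "fst d = e" "org d = z" using real_seg_exists by blast
          then show "e \<in> fst ` {d \<in> DD. rl d \<and> org d = z}" using zV by (intro image_eqI[of _ _ d]) (auto simp: rl_def)
        qed
      qed
    qed
  qed
  ultimately show "card E + 13 \<le> 5 * card V" using c3 by linarith
qed

end

section \<open>Drawings\<close>

text \<open>The codomain is any Euclidean space, so that one locale covers the given drawing in
  \<open>real^2\<close>, its copy in \<open>complex\<close> and the inverted one.\<close>

locale drawn =
  fixes V :: "'v set" and E :: "'v set set" and P :: "'v \<Rightarrow> 'b::euclidean_space"
    and c :: "'v set \<Rightarrow> real \<Rightarrow> 'b"
  assumes finite_V: "finite V" and inj_P: "inj_on P V"
    and edge_V: "e \<in> E \<Longrightarrow> e \<subseteq> V" and card_edge: "e \<in> E \<Longrightarrow> card e = 2"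
    and arc_c: "e \<in> E \<Longrightarrow> arc (c e)" and ends: "e \<in> E \<Longrightarrow> {c e 0, c e 1} = P ` e"
    and image_V: "e \<in> E \<Longrightarrow> path_image (c e) \<inter> P ` V = P ` e"
    and once: "\<lbrakk>e \<in> E; f \<in> E; e \<noteq> f; p \<in> path_image (c e); p \<in> path_image (c f);
        q \<in> path_image (c e); q \<in> path_image (c f)\<rbrakk> \<Longrightarrow> p = q"
    and crossing_adjacent: "\<lbrakk>e \<in> E; e1 \<in> E; e2 \<in> E; e1 \<noteq> e; e2 \<noteq> e; e1 \<noteq> e2;
        p \<in> path_image (c e1) \<inter> path_image (c e) - P ` V;
        q \<in> path_image (c e2) \<inter> path_image (c e) - P ` V\<rbrakk> \<Longrightarrow> e1 \<inter> e2 \<noteq> {}"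
begin

lemma finite_E: "finite E"
  using finite_subset[of E "Pow V"] finite_V edge_V by auto

lemma card_E_le: "card E \<le> card V choose 2"
proof -
  have "E \<subseteq> {e. e \<subseteq> V \<and> card e = 2}" using edge_V card_edge by blast
  then have "card E \<le> card {e. e \<subseteq> V \<and> card e = 2}" using finite_V by (intro card_mono) auto
  then show ?thesis using n_subsets[OF finite_V] by simp
qed

lemma vertex_on_edge: "e \<in> E \<Longrightarrow> v \<in> V \<Longrightarrow> P v \<in> path_image (c e) \<Longrightarrow> v \<in> e"
proof -
  assume a: "e \<in> E" "v \<in> V" "P v \<in> path_image (c e)"
  then obtain w where "w \<in> e" "P v = P w" using image_V by blast
  then show "v \<in> e" using inj_onD[OF inj_P, of v w] a edge_V by blast
qed

lemma delete_vertex: "drawn (V - {v}) {e \<in> E. v \<notin> e} P c"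
proof
  fix e assume e: "e \<in> {e \<in> E. v \<notin> e}"
  show "e \<subseteq> V - {v}" using e edge_V by blast
  show "path_image (c e) \<inter> P ` (V - {v}) = P ` e"
    using e image_V[of e] edge_V[of e] vertex_on_edge[of e v] by blast
next
  fix e e1 e2 p q assume a: "e \<in> {e \<in> E. v \<notin> e}" "e1 \<in> {e \<in> E. v \<notin> e}" "e2 \<in> {e \<in> E. v \<notin> e}"
    "e1 \<noteq> e" "e2 \<noteq> e" "e1 \<noteq> e2"
    "p \<in> path_image (c e1) \<inter> path_image (c e) - P ` (V - {v})"
    "q \<in> path_image (c e2) \<inter> path_image (c e) - P ` (V - {v})"
  have "r \<notin> P ` V" if r: "r \<in> path_image (c e) - P ` (V - {v})" for r
  proof
    assume "r \<in> P ` V"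
    then have "v \<in> V" "r = P v" using r by blast+
    then show False using vertex_on_edge[of e v] r a(1) by simp
  qed
  then show "e1 \<inter> e2 \<noteq> {}" using crossing_adjacent[of e e1 e2 p q] a by blast
next
  show "p = q" if "e \<in> {e \<in> E. v \<notin> e}" "f \<in> {e \<in> E. v \<notin> e}" "e \<noteq> f" "p \<in> path_image (c e)" "p \<in> path_image (c f)"
    "q \<in> path_image (c e)" "q \<in> path_image (c f)" for e f p q
    using once[of e f p q] that by simp
qed (use finite_V inj_P arc_c card_edge ends in \<open>auto intro: inj_on_subset\<close>)

lemma compose:
  assumes f: "continuous_on S f" "inj_on f S" "P ` V \<subseteq> S" "\<And>e. e \<in> E \<Longrightarrow> path_image (c e) \<subseteq> S"
  shows "drawn V E (\<lambda>v. f (P v)) (\<lambda>e. f \<circ> c e)"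
proof
  have fP: "(\<lambda>v. f (P v)) ` A = f ` P ` A" for A by (simp add: image_image)
  have im: "path_image (f \<circ> c e) = f ` path_image (c e)" for e by (simp add: path_image_compose)
  have inter: "f ` A \<inter> f ` B = f ` (A \<inter> B)" if "A \<subseteq> S" "B \<subseteq> S" for A B
    using inj_on_image_Int[OF f(2) that] by simp
  show "finite V" by (rule finite_V)
  show "inj_on (\<lambda>v. f (P v)) V" using comp_inj_on[OF inj_P inj_on_subset[OF f(2,3)]] by (simp add: comp_def)
  show "e \<subseteq> V" "card e = 2" if "e \<in> E" for e using that edge_V card_edge by auto
  show "arc (f \<circ> c e)" if e: "e \<in> E" for e
    unfolding arc_def
  proof
    show "path (f \<circ> c e)"
      by (rule path_continuous_image[OF arc_imp_path[OF arc_c[OF e]] continuous_on_subset[OF f(1) f(4)[OF e]]])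
    show "inj_on (f \<circ> c e) {0..1}"
      using arc_c[OF e] inj_on_subset[OF f(2) f(4)[OF e]] by (intro comp_inj_on) (auto simp: arc_def path_image_def)
  qed
  show "{(f \<circ> c e) 0, (f \<circ> c e) 1} = (\<lambda>v. f (P v)) ` e" if e: "e \<in> E" for e
    unfolding fP ends[OF e, symmetric] by simp
  show "path_image (f \<circ> c e) \<inter> (\<lambda>v. f (P v)) ` V = (\<lambda>v. f (P v)) ` e" if e: "e \<in> E" for e
    unfolding fP im inter[OF f(4)[OF e] f(3)] image_V[OF e] ..
  show "p = q" if "e \<in> E" "f' \<in> E" "e \<noteq> f'" "p \<in> path_image (f \<circ> c e)" "p \<in> path_image (f \<circ> c f')"
    "q \<in> path_image (f \<circ> c e)" "q \<in> path_image (f \<circ> c f')" for e f' p q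
  proof -
    have "p \<in> f ` (path_image (c e) \<inter> path_image (c f'))" "q \<in> f ` (path_image (c e) \<inter> path_image (c f'))"
      using that inter[OF f(4) f(4), of e f'] unfolding im by auto
    then show ?thesis using once[OF that(1-3)] by blast
  qed
  show "e1 \<inter> e2 \<noteq> {}" if "e \<in> E" "e1 \<in> E" "e2 \<in> E" "e1 \<noteq> e" "e2 \<noteq> e" "e1 \<noteq> e2"
    "p \<in> path_image (f \<circ> c e1) \<inter> path_image (f \<circ> c e) - (\<lambda>v. f (P v)) ` V"
    "q \<in> path_image (f \<circ> c e2) \<inter> path_image (f \<circ> c e) - (\<lambda>v. f (P v)) ` V" for e e1 e2 p q
  proof -
    have "\<exists>p'. p' \<in> path_image (c e') \<inter> path_image (c e) - P ` V"
      if "e' \<in> E" "r \<in> path_image (f \<circ> c e') \<inter> path_image (f \<circ> c e) - (\<lambda>v. f (P v)) ` V" for e' r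
      using that inter[OF f(4) f(4), of e' e] \<open>e \<in> E\<close> unfolding im fP by auto
    then show ?thesis using crossing_adjacent[OF that(1-6)] that(2,3,7,8) by meson
  qed
qed

text \<open>Deleting a vertex of degree at most 5 costs no more than the bound gives up. The
  induction ends at three vertices with at most three edges, where 3 + k <= 15 explains
  \<open>k \<le> 12\<close>. What remains has all degrees large, and the map construction asks for
  degree two.\<close>

lemma degree_induct:
  assumes "\<And>V E. \<lbrakk>drawn V E P c; E \<subseteq> E0; card V \<ge> 3; \<And>v. v \<in> V \<Longrightarrow> 2 \<le> card {e \<in> E. v \<in> e}\<rbrakk>
      \<Longrightarrow> card E + k \<le> 5 * card V"
    and "k \<le> 12" "E \<subseteq> E0" "3 \<le> card V"
  shows "card E + k \<le> 5 * card V"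
proof -
  have "card E + k \<le> 5 * card V" if "drawn V E P c" "E \<subseteq> E0" "card V = n + 3" for n V E
    using that
  proof (induction n arbitrary: V E)
    case 0
    interpret d: drawn V E P c by (rule 0)
    have "card E \<le> 3" using d.card_E_le 0 by (simp add: choose_two)
    then show ?case using 0 assms(2) by simp
  next
    case (Suc n)
    interpret d: drawn V E P c by (rule Suc)
    show ?case
    proof (cases "\<exists>v\<in>V. card {e \<in> E. v \<in> e} \<le> 5")
      case True
      then obtain v where v: "v \<in> V" "card {e \<in> E. v \<in> e} \<le> 5" by auto
      have "card (V - {v}) = n + 3" using Suc(4) v(1) d.finite_V by simp
      then have "card {e \<in> E. v \<notin> e} + k \<le> 5 * (n + 3)"
        using Suc.IH[OF d.delete_vertex[of v]] Suc(3) by auto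
      moreover have "card E = card {e \<in> E. v \<in> e} + card {e \<in> E. v \<notin> e}"
        using d.finite_E by (subst card_Un_disjoint[symmetric]) (auto intro: arg_cong[where f = card])
      ultimately show ?thesis using v(2) Suc(4) by simp
    next
      case False
      then show ?thesis using assms(1)[of V E] Suc by force
    qed
  qed
  from this[of V E "card V - 3"] show ?thesis using drawn_axioms assms(3,4) by simp
qed

end

section \<open>Bounds for drawings in the complex plane\<close>

lemma two_of_card: "2 \<le> card A \<Longrightarrow> \<exists>a\<in>A. \<exists>b\<in>A. a \<noteq> b"
  using card_le_Suc0_iff_eq[of A] card.infinite[of A] by (cases "finite A") force+

text \<open>Edges become sets of points; the preimage within \<open>V\<close> recovers the abstract
  edge, so that its curve can be looked up.\<close>

lemma drawn_arcs:
  fixes P :: "'v \<Rightarrow> complex"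
  assumes d: "drawn V E P c" and ne: "V \<noteq> {}" and deg: "\<And>v. v \<in> V \<Longrightarrow> 2 \<le> card {e \<in> E. v \<in> e}"
  shows "arcs_drawing (P ` V) ((`) P ` E) (\<lambda>e. c (V \<inter> P -` e))"
proof -
  interpret drawn V E P c by (rule d)
  have inv [simp]: "V \<inter> P -` (P ` e) = e" if "e \<in> E" for e
  proof
    show "e \<subseteq> V \<inter> P -` (P ` e)" using edge_V[OF that] by blast
    show "V \<inter> P -` (P ` e) \<subseteq> e" using inj_onD[OF inj_P] edge_V[OF that] by blast
  qed
  show ?thesis
  proof
    show "finite (P ` V)" "P ` V \<noteq> {}" using finite_V ne by auto
  next
    fix e assume "e \<in> (`) P ` E"
    then obtain e' where e: "e' \<in> E" "e = P ` e'" by blast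
    show "e \<subseteq> P ` V \<and> e = {c (V \<inter> P -` e) 0, c (V \<inter> P -` e) 1}" using e edge_V[OF e(1)] ends[OF e(1)] by auto
    show "arc (c (V \<inter> P -` e))" using e arc_c by simp
    show "path_image (c (V \<inter> P -` e)) \<inter> P ` V = e" using e image_V by simp
  next
    fix e f p q assume a: "e \<in> (`) P ` E" "f \<in> (`) P ` E" "e \<noteq> f" "p \<in> path_image (c (V \<inter> P -` e))"
      "p \<in> path_image (c (V \<inter> P -` f))" "q \<in> path_image (c (V \<inter> P -` e))" "q \<in> path_image (c (V \<inter> P -` f))"
    then obtain e' f' where "e' \<in> E" "e = P ` e'" "f' \<in> E" "f = P ` f'" by blast
    moreover from this have "e' \<noteq> f'" using a(3) by metis
    ultimately show "p = q" using once[of e' f' p q] a(4-7) by simp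
  next
    fix e e1 e2 p q assume a: "e \<in> (`) P ` E" "e1 \<in> (`) P ` E" "e2 \<in> (`) P ` E" "e1 \<noteq> e" "e2 \<noteq> e" "e1 \<noteq> e2"
      "p \<in> path_image (c (V \<inter> P -` e1)) \<inter> path_image (c (V \<inter> P -` e)) - P ` V"
      "q \<in> path_image (c (V \<inter> P -` e2)) \<inter> path_image (c (V \<inter> P -` e)) - P ` V"
    then obtain e' f1 f2 where ef: "e' \<in> E" "e = P ` e'" "f1 \<in> E" "e1 = P ` f1" "f2 \<in> E" "e2 = P ` f2" by blast
    have "f1 \<noteq> e'" "f2 \<noteq> e'" "f1 \<noteq> f2" using a(4-6) ef(2,4,6) by metis+
    then have "f1 \<inter> f2 \<noteq> {}" using crossing_adjacent[OF ef(1,3,5), of p q] a(7,8) ef by simp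
    then show "e1 \<inter> e2 \<noteq> {}" using ef by blast
  next
    fix v assume "v \<in> P ` V"
    then obtain w where w: "w \<in> V" "v = P w" by blast
    obtain e f where ef: "e \<in> E" "f \<in> E" "w \<in> e" "w \<in> f" "e \<noteq> f" using two_of_card[OF deg[OF w(1)]] by blast
    then have "P ` e \<noteq> P ` f" using inv by metis
    then show "\<exists>e\<in>(`) P ` E. \<exists>f\<in>(`) P ` E. e \<noteq> f \<and> v \<in> e \<and> v \<in> f" using ef w by blast
  qed
qed

lemma (in drawn) card_images: "card (P ` V) = card V" "card ((`) P ` E) = card E"
proof -
  show "card (P ` V) = card V" using inj_P by (rule card_image)
  have "inj_on P (\<Union>E)" using inj_P by (rule inj_on_subset) (use edge_V in blast)
  then show "card ((`) P ` E) = card E" by (intro card_image inj_on_image)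
qed

lemma drawn_bound:
  fixes P :: "'v \<Rightarrow> complex"
  assumes "drawn V E P c" "3 \<le> card V"
  shows "card E + 10 \<le> 5 * card V"
proof (rule drawn.degree_induct[OF assms(1) _ _ order_refl assms(2)])
  fix W F assume d: "drawn W F P c" and W: "3 \<le> card W" and deg: "\<And>v. v \<in> W \<Longrightarrow> 2 \<le> card {e \<in> F. v \<in> e}"
  have "W \<noteq> {}" using W by auto
  then show "card F + 10 \<le> 5 * card W"
    using arcs_drawing.arcs_edge_bound(1)[OF drawn_arcs[OF d _ deg]] unfolding drawn.card_images[OF d] by blast
qed simp

lemma drawn_bound_triangle:
  fixes P :: "'v \<Rightarrow> complex"
  assumes d: "drawn V E P c" and deg: "\<And>v. v \<in> V \<Longrightarrow> 2 \<le> card {e \<in> E. v \<in> e}"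
    and z: "z \<in> V" "card {e \<in> E. z \<in> e} = 3"
    and uncrossed: "\<And>e f p. \<lbrakk>e \<in> E; f \<in> E; z \<in> e; f \<noteq> e; p \<in> path_image (c e); p \<in> path_image (c f)\<rbrakk> \<Longrightarrow> p \<in> P ` V"
  shows "card E + 13 \<le> 5 * card V"
proof -
  interpret drawn V E P c by (rule d)
  have inv [simp]: "V \<inter> P -` (P ` e) = e" if "e \<in> E" for e
  proof
    show "e \<subseteq> V \<inter> P -` (P ` e)" using edge_V[OF that] by blast
    show "V \<inter> P -` (P ` e) \<subseteq> e" using inj_onD[OF inj_P] edge_V[OF that] by blast
  qed
  have mem: "P z \<in> P ` e \<longleftrightarrow> z \<in> e" if "e \<in> E" for e using inv[OF that] z(1) by auto
  have "{e \<in> (`) P ` E. P z \<in> e} = (`) P ` {e \<in> E. z \<in> e}" using mem by auto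
  moreover have "inj_on ((`) P) {e \<in> E. z \<in> e}" by (rule inj_onI) (metis inv mem_Collect_eq)
  ultimately have "card {e \<in> (`) P ` E. P z \<in> e} = 3" using z(2) by (simp add: card_image)
  moreover have "V \<noteq> {}" using z by auto
  note arcs_drawing.arcs_edge_bound(2)[OF drawn_arcs[OF d this deg], of "P z"]
  moreover have "p \<in> P ` V"
    if t: "e \<in> (`) P ` E" "f \<in> (`) P ` E" "P z \<in> e" "f \<noteq> e" "p \<in> path_image (c (V \<inter> P -` e))"
      "p \<in> path_image (c (V \<inter> P -` f))" for e f p
  proof -
    from t(1,2) obtain e' f' where ef: "e' \<in> E" "e = P ` e'" "f' \<in> E" "f = P ` f'" by blast
    then have "f' \<noteq> e'" "z \<in> e'" using t(3,4) mem by auto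
    then show ?thesis using uncrossed[OF ef(1,3), of p] t(5,6) ef by simp
  qed
  ultimately show ?thesis using z(1) unfolding card_images by blast
qed

text \<open>
  A new vertex at 0, joined to the three points in A, contributes three edges at a vertex of
  degree 3 that nothing crosses; the sharper bound for the larger graph gives the claim.
\<close>

lemma (in drawn) add_apex:
  fixes Q :: "'v \<Rightarrow> complex"
  assumes "drawn V E Q b" and deg: "\<And>v. v \<in> V \<Longrightarrow> 2 \<le> card {e \<in> E. v \<in> e}"
    and A: "A \<subseteq> V" "card A = 3" and zero: "0 \<notin> Q ` V" "\<And>e. e \<in> E \<Longrightarrow> 0 \<notin> path_image (b e)"
    and seg_edge: "\<And>a e. a \<in> A \<Longrightarrow> e \<in> E \<Longrightarrow> closed_segment 0 (Q a) \<inter> path_image (b e) \<subseteq> {Q a}"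
    and seg_vertex: "\<And>a. a \<in> A \<Longrightarrow> closed_segment 0 (Q a) \<inter> Q ` V \<subseteq> {Q a}"
    and seg_seg: "\<And>a a'. a \<in> A \<Longrightarrow> a' \<in> A \<Longrightarrow> a \<noteq> a' \<Longrightarrow> closed_segment 0 (Q a) \<inter> closed_segment 0 (Q a') \<subseteq> {0}"
  shows "card E + 11 \<le> 5 * card V"
proof -
  interpret q: drawn V E Q b by (rule assms(1))
  \<comment> \<open>\<open>None\<close> is the new vertex; \<open>Q'\<close> places it at 0.\<close>
  define V' where "V' = insert None (Some ` V)"
  define N where "N = (\<lambda>a. {None, Some a}) ` A"
  define E' where "E' = (`) Some ` E \<union> N"
  define Q' where "Q' = case_option 0 Q"
  \<comment> \<open>Since \<open>Q' None = 0\<close>, the sum over the two ends of a new edge is the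
    position of its old end.\<close>
  define b' where "b' x = (if None \<in> x then linepath 0 (\<Sum>w\<in>x. Q' w) else b (Some -` x))" for x
  have Q'0: "Q' None = 0" "Q' (Some v) = Q v" for v by (simp_all add: Q'_def)
  have QV: "Q' ` V' = insert 0 (Q ` V)" by (simp add: V'_def Q'0 image_image)
  have old: "b' (Some ` e) = b e" "Q' ` Some ` e = Q ` e" for e by (auto simp: b'_def Q'0 image_image inj_vimage_image_eq)
  have new: "b' {None, Some a} = linepath 0 (Q a)" "Q' ` {None, Some a} = {0, Q a}" for a by (simp_all add: b'_def Q'0)
  have E'_cases: "(\<And>e. e \<in> E \<Longrightarrow> x = Some ` e \<Longrightarrow> R) \<Longrightarrow> (\<And>a. a \<in> A \<Longrightarrow> x = {None, Some a} \<Longrightarrow> R) \<Longrightarrow> R" if "x \<in> E'" for x R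
    using that unfolding E'_def N_def by blast
  have Q0: "Q a \<noteq> 0" if "a \<in> A" for a using zero(1) A(1) that by (metis image_eqI subsetD)
  \<comment> \<open>Two curves can meet off the vertices only if both are old. So the new edges are
    uncrossed, and the crossing condition reduces to that of the old drawing.\<close>
  have meet: "(\<exists>e f. e \<in> E \<and> f \<in> E \<and> x = Some ` e \<and> y = Some ` f) \<or>
      (\<exists>w\<in>insert 0 (Q ` V). path_image (b' x) \<inter> path_image (b' y) \<subseteq> {w})"
    if xy: "x \<in> E'" "y \<in> E'" "x \<noteq> y" for x y
  proof (rule E'_cases[OF xy(1)]; rule E'_cases[OF xy(2)])
    fix e f assume "e \<in> E" "f \<in> E" "x = Some ` e" "y = Some ` f" then show ?thesis by blast
  next
    fix e a assume a: "e \<in> E" "a \<in> A" "x = Some ` e" "y = {None, Some a}"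
    have "path_image (b' x) \<inter> path_image (b' y) \<subseteq> {Q a}" using seg_edge[OF a(2,1)] unfolding a(3,4) old new by auto
    then show ?thesis using A(1) a(2) by blast
  next
    fix e a assume a: "e \<in> E" "a \<in> A" "y = Some ` e" "x = {None, Some a}"
    have "path_image (b' x) \<inter> path_image (b' y) \<subseteq> {Q a}" using seg_edge[OF a(2,1)] unfolding a(3,4) old new by auto
    then show ?thesis using A(1) a(2) by blast
  next
    fix a a' assume a: "a \<in> A" "a' \<in> A" "x = {None, Some a}" "y = {None, Some a'}"
    then have "a \<noteq> a'" using xy(3) by auto
    then have "path_image (b' x) \<inter> path_image (b' y) \<subseteq> {0}" using seg_seg[OF a(1,2)] unfolding a(3,4) new by auto
    then show ?thesis by blast
  qed
  have both_old: "\<exists>e f. e \<in> E \<and> f \<in> E \<and> x = Some ` e \<and> y = Some ` f"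
    if "x \<in> E'" "y \<in> E'" "x \<noteq> y" "p \<in> path_image (b' x) \<inter> path_image (b' y) - insert 0 (Q ` V)" for x y p
    using meet[OF that(1-3)] that(4) by blast
  have dr: "drawn V' E' Q' b'"
  proof
    show "finite V'" using finite_V by (simp add: V'_def)
    have "inj_on Q' (Some ` V)" using q.inj_P by (auto simp: inj_on_def Q'0)
    moreover have "Q' None \<notin> Q' ` (Some ` V)" using zero(1) by (simp add: Q'0 image_image)
    ultimately show "inj_on Q' V'" unfolding V'_def by simp
  next
    fix x assume x: "x \<in> E'"
    show "x \<subseteq> V'" by (rule E'_cases[OF x]) (use edge_V A(1) in \<open>auto simp: V'_def\<close>)
    show "card x = 2" by (rule E'_cases[OF x]) (simp_all add: card_image card_edge)
    show "arc (b' x)" by (rule E'_cases[OF x]) (auto simp: old new q.arc_c Q0[symmetric])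
    show "{b' x 0, b' x 1} = Q' ` x"
      by (rule E'_cases[OF x]) (simp_all only: old new q.ends, simp add: linepath_def)
    show "path_image (b' x) \<inter> Q' ` V' = Q' ` x"
    proof (rule E'_cases[OF x])
      fix e assume "e \<in> E" "x = Some ` e"
      then show ?thesis using q.image_V[of e] zero(2)[of e] by (simp add: old QV)
    next
      fix a assume a: "a \<in> A" "x = {None, Some a}"
      then have "Q a \<in> Q ` V" using A(1) by blast
      then show ?thesis using seg_vertex[OF a(1)] unfolding a(2) new QV by auto
    qed
  next
    fix x y p r assume a: "x \<in> E'" "y \<in> E'" "x \<noteq> y" "p \<in> path_image (b' x)" "p \<in> path_image (b' y)"
      "r \<in> path_image (b' x)" "r \<in> path_image (b' y)"
    from meet[OF a(1-3)] show "p = r"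
    proof
      assume "\<exists>e f. e \<in> E \<and> f \<in> E \<and> x = Some ` e \<and> y = Some ` f"
      then obtain e f where ef: "e \<in> E" "f \<in> E" "x = Some ` e" "y = Some ` f" by blast
      then have "e \<noteq> f" using a(3) by blast
      then show ?thesis using q.once[OF ef(1,2)] a(4-7) unfolding ef(3,4) old by blast
    next
      assume "\<exists>w\<in>insert 0 (Q ` V). path_image (b' x) \<inter> path_image (b' y) \<subseteq> {w}"
      then show ?thesis using a(4-7) by blast
    qed
  next
    fix x y z p r assume a: "x \<in> E'" "y \<in> E'" "z \<in> E'" "y \<noteq> x" "z \<noteq> x" "y \<noteq> z"
      "p \<in> path_image (b' y) \<inter> path_image (b' x) - Q' ` V'" "r \<in> path_image (b' z) \<inter> path_image (b' x) - Q' ` V'"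
    obtain e f where ef: "e \<in> E" "f \<in> E" "y = Some ` e" "x = Some ` f" using both_old[OF a(2,1,4) a(7)[unfolded QV]] by blast
    obtain h where h: "h \<in> E" "z = Some ` h" using both_old[OF a(3,1,5) a(8)[unfolded QV]] ef(4) by (metis inj_image_eq_iff inj_Some)
    have "e \<noteq> f" "h \<noteq> f" "e \<noteq> h" using a(4-6) ef h by blast+
    then have "e \<inter> h \<noteq> {}"
      using q.crossing_adjacent[OF ef(2,1) h(1), of p r] a(7,8)[unfolded ef h QV old] by blast
    then show "y \<inter> z \<noteq> {}" using ef h by blast
  qed
  have inj_new: "inj_on (\<lambda>a. {None, Some a}) A" by (auto simp: inj_on_def)
  have fA: "finite A" using A(1) finite_V finite_subset by blast
  have N: "card N = 3" "finite N" using A(2) inj_new fA by (simp_all add: N_def card_image)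
  have at_None: "{x \<in> E'. None \<in> x} = N" by (auto simp: E'_def N_def)
  have at_Some: "(`) Some ` {e \<in> E. v \<in> e} \<subseteq> {x \<in> E'. Some v \<in> x}" for v by (auto simp: E'_def)
  have inj_img: "inj_on ((`) Some) X" for X :: "'v set set" by (rule inj_onI) (simp add: inj_image_eq_iff)
  have fE': "finite E'" using finite_E N(2) by (simp add: E'_def)
  have "card E' + 13 \<le> 5 * card V'"
  proof (rule drawn_bound_triangle[OF dr])
    show "None \<in> V'" by (simp add: V'_def)
    show "card {x \<in> E'. None \<in> x} = 3" using at_None N by simp
    fix w assume "w \<in> V'"
    show "2 \<le> card {x \<in> E'. w \<in> x}"
    proof (cases w)
      case None
      then show ?thesis using at_None N by simp
    next
      case (Some v)
      then have "2 \<le> card {e \<in> E. v \<in> e}" using deg \<open>w \<in> V'\<close> by (auto simp: V'_def)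
      also have "\<dots> = card ((`) Some ` {e \<in> E. v \<in> e})" by (rule card_image[OF inj_img, symmetric])
      also have "\<dots> \<le> card {x \<in> E'. w \<in> x}" unfolding Some by (rule card_mono[OF _ at_Some]) (use fE' in simp)
      finally show ?thesis .
    qed
  next
    fix x y p assume a: "x \<in> E'" "y \<in> E'" "None \<in> x" "y \<noteq> x" "p \<in> path_image (b' x)" "p \<in> path_image (b' y)"
    then show "p \<in> Q' ` V'" using both_old[of x y p] unfolding QV by blast
  qed
  moreover have "card E' = card E + 3"
    unfolding E'_def using finite_E N inj_img[of E] by (subst card_Un_disjoint) (auto simp: card_image N_def)
  moreover have "card V' = card V + 1" using finite_V by (simp add: V'_def card_image)
  ultimately show ?thesis by simp
qed

text \<open>For \<open>k < 1\<close> the point \<open>a\<close> would lie strictly between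
  \<open>x\<close> and \<open>y\<close>. So a ray from \<open>x\<close> through a corner leaves the
  hull at that corner.\<close>

lemma extreme_ray:
  fixes x :: "'a::real_vector"
  assumes "a extreme_point_of H" "x \<in> H" "y \<in> H" "a \<noteq> x" "a - x = k *\<^sub>R (y - x)" "0 < k"
  shows "1 \<le> k"
proof (rule ccontr)
  assume k: "\<not> 1 \<le> k"
  have "x \<noteq> y" using assms(4,5) by auto
  moreover have "a = (1 - k) *\<^sub>R x + k *\<^sub>R y" using assms(5) by (simp add: algebra_simps)
  ultimately have "a \<in> open_segment x y" using assms(6) k by (auto simp: in_segment)
  then show False using assms(1-3) by (auto simp: extreme_point_of_def)
qed

lemma interior_finite_Union_closed:
  assumes "finite F" "\<And>S. S \<in> F \<Longrightarrow> closed S \<and> interior S = {}"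
  shows "interior (\<Union>F) = {}"
  using assms
proof (induction F rule: finite_induct)
  case (insert S F)
  then have "closed S" "interior (\<Union>F) = {}" "interior S = {}" by auto
  then show ?case using interior_closed_Un_empty_interior[of S "\<Union>F"] by simp
qed simp

lemma (in drawn) other_end:
  assumes "e \<in> E" "v \<in> e" obtains u where "e = {v, u}" "u \<noteq> v" "u \<in> V"
proof -
  obtain x y where "e = {x, y}" "x \<noteq> y" using card_edge[OF assms(1)] by (auto simp: card_2_iff)
  then show ?thesis using that assms edge_V[OF assms(1)] by (cases "v = x") auto
qed

text \<open>At an extreme point of a collinear set two edges run in the same direction, so one of
  them contains the far end of the other, which is not one of its own endpoints.\<close>

lemma (in drawn) straight_not_collinear:
  assumes straight: "\<And>e. e \<in> E \<Longrightarrow> path_image (c e) = convex hull (P ` e)"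
    and deg: "\<And>v. v \<in> V \<Longrightarrow> 2 \<le> card {e \<in> E. v \<in> e}" and "V \<noteq> {}"
  shows "\<not> collinear (P ` V)"
proof
  assume col: "collinear (P ` V)"
  let ?H = "convex hull (P ` V)"
  have "compact ?H" using finite_V by (simp add: finite_imp_compact_convex_hull)
  moreover have "?H \<noteq> {}" using \<open>V \<noteq> {}\<close> by simp
  ultimately obtain x where x: "x extreme_point_of ?H"
    using extreme_point_exists_convex[of ?H] convex_convex_hull by blast
  then obtain v where v: "v \<in> V" "x = P v" using extreme_point_of_convex_hull by blast
  obtain e f where ef: "e \<in> E" "f \<in> E" "v \<in> e" "v \<in> f" "e \<noteq> f" using two_of_card[OF deg[OF v(1)]] by blast
  obtain u where u: "e = {v, u}" "u \<noteq> v" "u \<in> V" using other_end[OF ef(1,3)] .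
  obtain w where w: "f = {v, w}" "w \<noteq> v" "w \<in> V" using other_end[OF ef(2,4)] .
  have uw: "u \<noteq> w" using ef(5) u w by auto
  have seg: "path_image (c e) = closed_segment (P v) (P u)" "path_image (c f) = closed_segment (P v) (P w)"
    using straight[OF ef(1)] straight[OF ef(2)] by (simp_all add: u w segment_convex_hull)
  have inj: "P u \<noteq> P w" "P u \<noteq> P v" "P w \<noteq> P v" using inj_onD[OF inj_P] u w v uw by metis+
  have "P u \<in> ?H" "P w \<in> ?H" using u w by (auto intro: hull_inc)
  then have "P v \<notin> open_segment (P u) (P w)" using x v by (auto simp: extreme_point_of_def)
  then have "P v \<notin> closed_segment (P u) (P w)" using inj by (simp add: open_segment_def)
  moreover have "P u \<notin> closed_segment (P w) (P v)"
    using vertex_on_edge[OF ef(2) u(3)] seg(2) u(2) uw w(1) by (auto simp: closed_segment_commute)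
  moreover have "P w \<notin> closed_segment (P v) (P u)"
    using vertex_on_edge[OF ef(1) w(3)] seg(1) w(2) uw u(1) by auto
  moreover have "collinear {P v, P u, P w}" using col by (rule collinear_subset) (use u w v in auto)
  ultimately show False unfolding collinear_between_cases between_mem_segment by blast
qed

lemma noncollinear_hull:
  fixes S :: "complex set"
  assumes "finite S" "\<not> collinear S"
  shows "interior (convex hull S) \<noteq> {}" "3 \<le> card {x. x extreme_point_of convex hull S}"
proof -
  have dim: "aff_dim S = 2"
    using assms(2) aff_dim_le_DIM[of S] by (simp add: collinear_aff_dim)
  then have "affine hull (convex hull S) = UNIV" using aff_dim_eq_full[of S] by simp
  then have "interior (convex hull S) = rel_interior (convex hull S)" by (simp add: rel_interior_interior)
  moreover have "S \<noteq> {}" using assms(2) by auto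
  ultimately show "interior (convex hull S) \<noteq> {}" by (simp add: rel_interior_eq_empty)
  let ?X = "{x. x extreme_point_of convex hull S}"
  have fin: "finite ?X" by (rule finite_subset[OF _ assms(1)]) (use extreme_point_of_convex_hull in blast)
  have "convex hull S = convex hull ?X"
    by (rule Krein_Milman_Minkowski) (use assms(1) in \<open>auto simp: finite_imp_compact_convex_hull\<close>)
  then have "aff_dim ?X = 2" using dim by (metis aff_dim_convex_hull)
  then show "3 \<le> card ?X" using aff_dim_le_card[OF fin] by simp
qed

text \<open>
  The inversion at x maps the rays that leave the hull at a corner to segments ending in 0.
\<close>

lemma (in drawn) straight_bound_complex:
  fixes Q :: "'v \<Rightarrow> complex"
  assumes "drawn V E Q b" and straight: "\<And>e. e \<in> E \<Longrightarrow> path_image (b e) = convex hull (Q ` e)"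
    and deg: "\<And>v. v \<in> V \<Longrightarrow> 2 \<le> card {e \<in> E. v \<in> e}" and ne: "V \<noteq> {}"
  shows "card E + 11 \<le> 5 * card V"
proof -
  interpret q: drawn V E Q b by (rule assms(1))
  let ?H = "convex hull (Q ` V)"
  have ncol: "\<not> collinear (Q ` V)" using q.straight_not_collinear[OF straight deg ne] by blast
  note hull = noncollinear_hull[OF finite_imageI[OF finite_V] ncol]
  obtain X where X: "X \<subseteq> {x. x extreme_point_of ?H}" "card X = 3"
    using obtain_subset_with_card_n[OF hull(2)] by metis
  define A where "A = {v \<in> V. Q v \<in> X}"
  have QA: "Q ` A = X" using X(1) extreme_point_of_convex_hull unfolding A_def by fastforce
  have "inj_on Q A" using q.inj_P by (rule inj_on_subset) (auto simp: A_def)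
  then have A: "A \<subseteq> V" "card A = 3" using X(2) card_image[of Q A] QA by (auto simp: A_def)
  have Aex: "Q a extreme_point_of ?H" if "a \<in> A" for a using that X(1) by (auto simp: A_def)
  have VH: "Q v \<in> ?H" if "v \<in> V" for v using that by (auto intro: hull_inc)
  have EH: "path_image (b e) \<subseteq> ?H" if "e \<in> E" for e
    unfolding straight[OF that] using edge_V[OF that] by (intro hull_mono image_mono)
  \<comment> \<open>The drawing itself, a set with empty interior; hence some interior point of the
    hull misses it.\<close>
  define Z where "Z = \<Union>(insert (Q ` V) ((\<lambda>e. path_image (b e)) ` E))"
  have "interior Z = {}"
    unfolding Z_def
  proof (rule interior_finite_Union_closed)
    show "finite (insert (Q ` V) ((\<lambda>e. path_image (b e)) ` E))" using finite_E by simp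
    fix S assume "S \<in> insert (Q ` V) ((\<lambda>e. path_image (b e)) ` E)"
    then show "closed S \<and> interior S = {}"
    proof (elim insertE imageE)
      assume "S = Q ` V"
      then show ?thesis using finite_V by (simp add: finite_imp_closed empty_interior_finite)
    next
      fix e assume e: "S = path_image (b e)" "e \<in> E"
      obtain u v where "e = {u, v}" using card_edge[OF e(2)] by (auto simp: card_2_iff)
      then have "S = closed_segment (Q u) (Q v)" using e straight by (simp add: segment_convex_hull)
      then show ?thesis by (simp add: interior_closed_segment_ge2)
    qed
  qed
  then have "\<not> interior ?H \<subseteq> Z" using hull(1) interior_maximal[OF _ open_interior, of ?H Z] by auto
  then obtain x where xi: "x \<in> interior ?H" and xZ: "x \<notin> Z" by blast
  have xH: "x \<in> ?H" using xi interior_subset by blast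
  have xV: "x \<notin> Q ` V" using xZ by (simp add: Z_def)
  have xE: "x \<notin> path_image (b e)" if "e \<in> E" for e using xZ that by (auto simp: Z_def)
  \<comment> \<open>The reciprocal is an inversion followed by a reflection: rays from
    \<open>x\<close> go to rays from 0, and infinity goes to 0.\<close>
  define h where "h z = inverse (z - x)" for z
  have h0: "h z \<noteq> 0" if "z \<noteq> x" for z using that by (simp add: h_def)
  have ray: "a - x = t *\<^sub>R (y - x) \<and> 0 < t" if "h y = t *\<^sub>R h a" "y \<noteq> x" "0 \<le> t" for a y t
  proof -
    have "t \<noteq> 0" using that h0[of y] by auto
    moreover have "a \<noteq> x" using that h0[of y] by (auto simp: h_def)
    ultimately show ?thesis using that by (auto simp: h_def field_simps scaleR_conv_of_real)
  qed
  \<comment> \<open>The segment from 0 to \<open>h (Q a)\<close> is the image of the ray beyond the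
    corner \<open>Q a\<close>, which meets the hull in that corner alone.\<close>
  have on_ray: "y = Q a" if y: "a \<in> A" "y \<in> ?H" "y \<noteq> x" "h y \<in> closed_segment 0 (h (Q a))" for a y
  proof -
    from y(4) obtain t where t: "h y = t *\<^sub>R h (Q a)" "0 \<le> t" "t \<le> 1" by (auto simp: in_segment)
    note r = ray[OF t(1) y(3) t(2)]
    have "Q a \<noteq> x" using r y(3) by auto
    then have "1 \<le> t" using extreme_ray[OF Aex[OF y(1)] xH y(2)] r by blast
    then show ?thesis using r t by simp
  qed
  have d: "drawn V E (\<lambda>v. h (Q v)) (\<lambda>e. h \<circ> b e)"
  proof (rule q.compose[where S = "- {x}"])
    show "continuous_on (- {x}) h" unfolding h_def by (intro continuous_intros) auto
    show "inj_on h (- {x})" unfolding h_def by (auto simp: inj_on_def)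
  qed (use xV xE in auto)
  show ?thesis
  proof (rule add_apex[OF d deg A])
    have h0': "h ` S \<subseteq> - {0}" if "x \<notin> S" for S using that h0 by fastforce
    show "0 \<notin> (\<lambda>v. h (Q v)) ` V" using h0'[OF xV] by (auto simp: image_image)
    show "0 \<notin> path_image (h \<circ> b e)" if "e \<in> E" for e
      using h0'[OF xE[OF that]] unfolding path_image_compose by blast
  next
    fix a e assume "a \<in> A" "e \<in> E"
    then show "closed_segment 0 (h (Q a)) \<inter> path_image (h \<circ> b e) \<subseteq> {h (Q a)}"
      using on_ray[of a] EH[of e] xE[of e] unfolding path_image_compose by blast
  next
    fix a assume a: "a \<in> A"
    have "h (Q v) = h (Q a)" if v: "v \<in> V" "h (Q v) \<in> closed_segment 0 (h (Q a))" for v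
      using on_ray[OF a VH[OF v(1)] _ v(2)] xV v(1) by force
    then show "closed_segment 0 (h (Q a)) \<inter> (\<lambda>v. h (Q v)) ` V \<subseteq> {h (Q a)}" by blast
  next
    fix a a' assume a: "a \<in> A" "a' \<in> A" "a \<noteq> a'"
    show "closed_segment 0 (h (Q a)) \<inter> closed_segment 0 (h (Q a')) \<subseteq> {0}"
    proof
      fix p assume p: "p \<in> closed_segment 0 (h (Q a)) \<inter> closed_segment 0 (h (Q a'))"
      have seg: "\<exists>t\<ge>0. p = t *\<^sub>R w" if "p \<in> closed_segment 0 w" for w using that by (auto simp: in_segment)
      obtain t t' where t: "p = t *\<^sub>R h (Q a)" "0 \<le> t" "p = t' *\<^sub>R h (Q a')" "0 \<le> t'"
        using p seg by blast
      have V: "Q a \<in> ?H" "Q a' \<in> ?H" "Q a \<noteq> x" "Q a' \<noteq> x" using a A(1) VH xV by auto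
      show "p \<in> {0}"
      proof (rule ccontr)
        assume "p \<notin> {0}"
        then have "t \<noteq> 0" using t(1) by auto
        moreover have "t' \<noteq> 0" using \<open>p \<notin> {0}\<close> t(3) by auto
        ultimately have pos: "0 < t" "0 < t'" using t(2,4) by auto
        have "h (Q a) = (1 / t) *\<^sub>R p" using t(1) pos by simp
        then have e1: "h (Q a) = (t' / t) *\<^sub>R h (Q a')" unfolding t(3) by simp
        have "h (Q a') = (1 / t') *\<^sub>R p" using t(3) pos by simp
        then have e2: "h (Q a') = (t / t') *\<^sub>R h (Q a)" unfolding t(1) by simp
        note r1 = ray[OF e1 V(3)] and r2 = ray[OF e2 V(4)]
        \<comment> \<open>Of two corners on one ray from \<open>x\<close>, neither can be farther
          out than the other.\<close>
        have "1 \<le> t' / t" using extreme_ray[OF Aex[OF a(2)] xH V(1) V(4)] r1 pos by auto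
        moreover have "1 \<le> t / t'" using extreme_ray[OF Aex[OF a(1)] xH V(2) V(3)] r2 pos by auto
        ultimately have "t = t'" using pos by (simp add: field_simps)
        then have "Q a = Q a'" using r1 pos by simp
        then show False using inj_onD[OF q.inj_P, of a a'] a A(1) by blast
      qed
    qed
  qed
qed

section \<open>Transfer to the complex plane, where the Jordan and Janiszewski theorems are
  applied\<close>

definition to_complex :: "real^2 \<Rightarrow> complex" where "to_complex x = Complex (x $ 1) (x $ 2)"

lemma linear_to_complex: "linear to_complex"
  by (rule linearI) (simp_all add: to_complex_def complex_eq_iff)

lemma inj_to_complex: "inj to_complex"
  by (rule injI) (simp add: to_complex_def vec_eq_iff forall_2)

lemma drawn_to_complex:
  assumes "drawn V E P c" shows "drawn V E (\<lambda>v. to_complex (P v)) (\<lambda>e. to_complex \<circ> c e)"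
  by (rule drawn.compose[OF assms, where S = UNIV])
    (use inj_to_complex linear_continuous_on[of to_complex] linear_to_complex in \<open>auto simp: linear_linear\<close>)

lemma straight_drawn_bound:
  assumes d: "drawn V E (P :: 'v \<Rightarrow> real^2) c" and "3 \<le> card V"
    and straight: "\<And>e. e \<in> E \<Longrightarrow> path_image (c e) = convex hull (P ` e)"
  shows "card E + 11 \<le> 5 * card V"
proof (rule drawn.degree_induct[OF d _ _ order_refl assms(2)])
  fix W F assume f: "drawn W F P c" "F \<subseteq> E" and W: "3 \<le> card W" and deg: "\<And>v. v \<in> W \<Longrightarrow> 2 \<le> card {e \<in> F. v \<in> e}"
  show "card F + 11 \<le> 5 * card W"
  proof (rule drawn.straight_bound_complex[OF f(1) drawn_to_complex[OF f(1)] _ deg])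
    fix e assume "e \<in> F"
    then have "path_image (to_complex \<circ> c e) = to_complex ` (convex hull (P ` e))"
      using f(2) straight by (simp add: path_image_compose subset_eq)
    then show "path_image (to_complex \<circ> c e) = convex hull ((\<lambda>v. to_complex (P v)) ` e)"
      by (simp add: convex_hull_linear_image[OF linear_to_complex] image_image)
  qed (use W in auto)
qed simp

lemma drawn_if_good_drawing:
  assumes "loopless_simple_graph V E" "good_drawing V E pos \<gamma>"
  shows "drawn V E pos \<gamma>"
proof -
  have g: "topological_drawing V E pos \<gamma>" "simple_drawing E \<gamma>" "crossing_condition V E pos \<gamma>"
    using assms(2) by (auto simp: good_drawing_def)
  show ?thesis
  proof
    show "finite V" "inj_on pos V" using assms(1) g(1) by (auto simp: loopless_simple_graph_def topological_drawing_def)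
  next
    fix e assume e: "e \<in> E"
    then obtain u v where uv: "u \<in> V" "v \<in> V" "u \<noteq> v" "e = {u, v}"
      using assms(1) unfolding loopless_simple_graph_def by blast
    then show "e \<subseteq> V" "card e = 2" by auto
    show "arc (\<gamma> e)" "{\<gamma> e 0, \<gamma> e 1} = pos ` e" "path_image (\<gamma> e) \<inter> pos ` V = pos ` e"
      using g(1) e unfolding topological_drawing_def pathstart_def pathfinish_def by blast+
  next
    fix e f p q assume a: "e \<in> E" "f \<in> E" "e \<noteq> f" "p \<in> path_image (\<gamma> e)" "p \<in> path_image (\<gamma> f)"
      "q \<in> path_image (\<gamma> e)" "q \<in> path_image (\<gamma> f)"
    \<comment> \<open>\<open>card\<close> of an infinite set is 0, so the bound by one gives
      uniqueness only together with finiteness.\<close>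
    have "finite (path_image (\<gamma> e) \<inter> path_image (\<gamma> f))" using g(1) a(1-3) unfolding topological_drawing_def by blast
    moreover have "card (path_image (\<gamma> e) \<inter> path_image (\<gamma> f)) \<le> Suc 0" using g(2) a(1-3) unfolding simple_drawing_def by simp
    ultimately show "p = q" using a(4-7) card_le_Suc0_iff_eq by blast
  next
    fix e e1 e2 p q assume a: "e \<in> E" "e1 \<in> E" "e2 \<in> E" "e1 \<noteq> e" "e2 \<noteq> e" "e1 \<noteq> e2"
      "p \<in> path_image (\<gamma> e1) \<inter> path_image (\<gamma> e) - pos ` V" "q \<in> path_image (\<gamma> e2) \<inter> path_image (\<gamma> e) - pos ` V"
    then have "crosses V pos \<gamma> e1 e" "crosses V pos \<gamma> e2 e" unfolding crosses_def by blast+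
    then show "e1 \<inter> e2 \<noteq> {}" using g(3) a(1-6) unfolding crossing_condition_def by blast
  qed
qed

theorem theorem1:
  fixes V :: "'v set" and E :: "'v set set"
  assumes "loopless_simple_graph V E"
    and "card V \<ge> 3"
  shows "((\<exists>pos \<gamma>. good_drawing V E pos \<gamma>) \<longrightarrow> card E \<le> 5 * card V - 10)
    \<and> ((\<exists>pos \<gamma>. good_drawing V E pos \<gamma> \<and> straight_line_drawing E pos \<gamma>)
           \<longrightarrow> card E \<le> 5 * card V - 11)"
proof (intro conjI impI; elim exE conjE)
  fix pos \<gamma> assume g: "good_drawing V E pos \<gamma>"
  note d = drawn_if_good_drawing[OF assms(1) g]
  \<comment> \<open>The bounds are proved as sums because subtraction on \<open>nat\<close>
    truncates; with at least three vertices nothing is lost in this form.\<close>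
  show "card E \<le> 5 * card V - 10" using drawn_bound[OF drawn_to_complex[OF d] assms(2)] by simp
next
  fix pos \<gamma> assume g: "good_drawing V E pos \<gamma>" and s: "straight_line_drawing E pos \<gamma>"
  note d = drawn_if_good_drawing[OF assms(1) g]
  have "path_image (\<gamma> e) = convex hull (pos ` e)" if e: "e \<in> E" for e
  proof -
    obtain u v where "e = {u, v}" using assms(1) e unfolding loopless_simple_graph_def by blast
    then show ?thesis using s e unfolding straight_line_drawing_def by (simp add: segment_convex_hull)
  qed
  then show "card E \<le> 5 * card V - 11" using straight_drawn_bound[OF d assms(2)] by simp
qed

end
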